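(* Let $M$ be an object of $\mathcal{M}_{\mathfrak{p}}$. Then $M$ admits a finite direct sum decomposition into indecomposable objects whose endomorphism rings are local; in other words, $\mathcal{M}_{\mathfrak{p}}$ is a Krull–Schmidt category. Consequently, this decomposition of $M$ into indecomposables is unique up to permutation and isomorphism of the summands.
   Context: $\mathfrak{g}$ is a finite-dimensional complex semisimple Lie algebra with Cartan decomposition $\mathfrak{g}=\mathfrak{n}^-\oplus\mathfrak{h}\oplus\mathfrak{n}$, $\mathfrak{b}=\mathfrak{h}\oplus\mathfrak{n}$ is the Borel subalgebra, and $\mathfrak{p}\supset\mathfrak{b}$ is a fixed (standard) parabolic subalgebra. For a $\mathfrak{p}$-module $M$ and $\lambda\in\mathfrak{h}^*$, $M_\lambda$ is the $\lambda$-weight space, $M_\lambda^+=\{v\in M_\lambda : \mathfrak{n}\cdot v=0\}$, nonzero elements of $M_\lambda^+$ are called maximal vectors of weight $\lambda$, and $\Pi^+(M)=\{\lambda : M_\lambda^+\neq 0\}$. $\mathcal{M}_{\mathfrak{p}}$ is the full subcategory of the category of $\mathfrak{p}$-modules whose objects $M$ satisfy: (1) $M$ is $\mathfrak{h}$-semisimple; (2) $M$ is locally $\mathfrak{n}$-finite; (3) $\dim M_\lambda<\infty$ for all $\lambda\in\mathfrak{h}^*$; (4) $\Pi^+(M)$ is finite. A Krull–Schmidt category is an additive category in which every object is a finite direct sum of indecomposable objects with local endomorphism rings. *)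

theory Defs
  imports "Jordan_Normal_Form.VS_Connect"
begin

abbreviation CC :: "complex ring" where
  "CC \<equiv> class_ring"

text \<open>Meaningful for subspaces \<open>W\<close> of \<open>V\<close>.\<close>

abbreviation finite_dim_on :: "(complex, 'v, 'r) module_scheme \<Rightarrow> 'v set \<Rightarrow> bool" where
  "finite_dim_on V W \<equiv> vectorspace.fin_dim CC (V\<lparr>carrier := W\<rparr>)"

section \<open>Preadditive categories\<close>

text \<open>\<open>Comp C X Y Z g f\<close> is the composite of \<open>f : X \<rightarrow> Y\<close> with \<open>g : Y \<rightarrow> Z\<close>. All operations take the
  objects as arguments, so hom-sets of different pairs of objects need not be disjoint.\<close>

record ('o, 'a) preadd_cat =
  Obj :: "'o set"
  Hom :: "'o \<Rightarrow> 'o \<Rightarrow> 'a set"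
  Comp :: "'o \<Rightarrow> 'o \<Rightarrow> 'o \<Rightarrow> 'a \<Rightarrow> 'a \<Rightarrow> 'a"
  Ident :: "'o \<Rightarrow> 'a"
  Hplus :: "'o \<Rightarrow> 'o \<Rightarrow> 'a \<Rightarrow> 'a \<Rightarrow> 'a"
  Hzero :: "'o \<Rightarrow> 'o \<Rightarrow> 'a"

locale preadditive_category =
  fixes C :: "('o, 'a) preadd_cat"
  assumes Ident_closed: "X \<in> Obj C \<Longrightarrow> Ident C X \<in> Hom C X X"
    and Comp_closed: "\<lbrakk>X \<in> Obj C; Y \<in> Obj C; Z \<in> Obj C; f \<in> Hom C X Y; g \<in> Hom C Y Z\<rbrakk>
      \<Longrightarrow> Comp C X Y Z g f \<in> Hom C X Z"
    and Comp_Ident: "\<lbrakk>X \<in> Obj C; Y \<in> Obj C; f \<in> Hom C X Y\<rbrakk> \<Longrightarrow> Comp C X X Y f (Ident C X) = f"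
    and Ident_Comp: "\<lbrakk>X \<in> Obj C; Y \<in> Obj C; f \<in> Hom C X Y\<rbrakk> \<Longrightarrow> Comp C X Y Y (Ident C Y) f = f"
    and Comp_assoc: "\<lbrakk>W \<in> Obj C; X \<in> Obj C; Y \<in> Obj C; Z \<in> Obj C;
        f \<in> Hom C W X; g \<in> Hom C X Y; k \<in> Hom C Y Z\<rbrakk>
      \<Longrightarrow> Comp C W Y Z k (Comp C W X Y g f) = Comp C W X Z (Comp C X Y Z k g) f"
    and Hom_group: "\<lbrakk>X \<in> Obj C; Y \<in> Obj C\<rbrakk>
      \<Longrightarrow> comm_group \<lparr>carrier = Hom C X Y, monoid.mult = Hplus C X Y, one = Hzero C X Y\<rparr>"
    and Comp_plus_left: "\<lbrakk>X \<in> Obj C; Y \<in> Obj C; Z \<in> Obj C;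
        f \<in> Hom C X Y; g \<in> Hom C Y Z; g' \<in> Hom C Y Z\<rbrakk>
      \<Longrightarrow> Comp C X Y Z (Hplus C Y Z g g') f = Hplus C X Z (Comp C X Y Z g f) (Comp C X Y Z g' f)"
    and Comp_plus_right: "\<lbrakk>X \<in> Obj C; Y \<in> Obj C; Z \<in> Obj C;
        f \<in> Hom C X Y; f' \<in> Hom C X Y; g \<in> Hom C Y Z\<rbrakk>
      \<Longrightarrow> Comp C X Y Z g (Hplus C X Y f f') = Hplus C X Z (Comp C X Y Z g f) (Comp C X Y Z g f')"

definition full_subcategory :: "('o, 'a) preadd_cat \<Rightarrow> ('o \<Rightarrow> bool) \<Rightarrow> ('o, 'a) preadd_cat" where
  "full_subcategory C P = C\<lparr>Obj := {X \<in> Obj C. P X}\<rparr>"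

definition end_ring :: "('o, 'a) preadd_cat \<Rightarrow> 'o \<Rightarrow> 'a ring" where
  "end_ring C X = \<lparr>carrier = Hom C X X, monoid.mult = Comp C X X X, one = Ident C X,
     zero = Hzero C X X, add = Hplus C X X\<rparr>"

definition zero_object :: "('o, 'a) preadd_cat \<Rightarrow> 'o \<Rightarrow> bool" where
  "zero_object C Z \<longleftrightarrow> Z \<in> Obj C \<and>
     (\<forall>X\<in>Obj C. (\<exists>!f. f \<in> Hom C X Z) \<and> (\<exists>!f. f \<in> Hom C Z X))"

definition isomorphic_objects :: "('o, 'a) preadd_cat \<Rightarrow> 'o \<Rightarrow> 'o \<Rightarrow> bool" where
  "isomorphic_objects C X Y \<longleftrightarrow> X \<in> Obj C \<and> Y \<in> Obj C \<and>
     (\<exists>f\<in>Hom C X Y. \<exists>g\<in>Hom C Y X. Comp C X Y X g f = Ident C X \<and> Comp C Y X Y f g = Ident C Y)"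

text \<open>\<open>S\<close> is a direct sum (biproduct) of the list \<open>Xs\<close>, with inclusions \<open>\<iota>\<close> and projections \<open>\<pi>\<close>.
  For the empty list the condition says that the identity of \<open>S\<close> is zero.\<close>

definition cat_direct_sum :: "('o, 'a) preadd_cat \<Rightarrow> 'o \<Rightarrow> 'o list \<Rightarrow> bool" where
  "cat_direct_sum C S Xs \<longleftrightarrow> S \<in> Obj C \<and> set Xs \<subseteq> Obj C \<and>
     (\<exists>\<iota> \<pi>. (\<forall>i<length Xs. \<iota> i \<in> Hom C (Xs ! i) S \<and> \<pi> i \<in> Hom C S (Xs ! i)) \<and>
       (\<forall>i<length Xs. \<forall>j<length Xs. Comp C (Xs ! j) S (Xs ! i) (\<pi> i) (\<iota> j) =
          (if i = j then Ident C (Xs ! i) else Hzero C (Xs ! j) (Xs ! i))) \<and>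
       (\<Oplus>\<^bsub>end_ring C S\<^esub>i\<in>{..<length Xs}. Comp C S (Xs ! i) S (\<iota> i) (\<pi> i)) = Ident C S)"

definition additive_category :: "('o, 'a) preadd_cat \<Rightarrow> bool" where
  "additive_category C \<longleftrightarrow> preadditive_category C \<and> (\<exists>Z. zero_object C Z) \<and>
     (\<forall>X\<in>Obj C. \<forall>Y\<in>Obj C. \<exists>S. cat_direct_sum C S [X, Y])"

definition indecomposable_object :: "('o, 'a) preadd_cat \<Rightarrow> 'o \<Rightarrow> bool" where
  "indecomposable_object C X \<longleftrightarrow> X \<in> Obj C \<and> \<not> zero_object C X \<and>
     (\<forall>A B. cat_direct_sum C X [A, B] \<longrightarrow> zero_object C A \<or> zero_object C B)"

text \<open>A possibly noncommutative ring is local if it is nonzero and its non-units are closed under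
  addition.\<close>

definition local_ring :: "'a ring \<Rightarrow> bool" where
  "local_ring R \<longleftrightarrow> ring R \<and> \<one>\<^bsub>R\<^esub> \<noteq> \<zero>\<^bsub>R\<^esub> \<and>
     (\<forall>a\<in>carrier R - Units R. \<forall>b\<in>carrier R - Units R. a \<oplus>\<^bsub>R\<^esub> b \<notin> Units R)"

definition krull_schmidt_decomposition :: "('o, 'a) preadd_cat \<Rightarrow> 'o \<Rightarrow> 'o list \<Rightarrow> bool" where
  "krull_schmidt_decomposition C M Xs \<longleftrightarrow> cat_direct_sum C M Xs \<and>
     (\<forall>X\<in>set Xs. indecomposable_object C X \<and> local_ring (end_ring C X))"

definition krull_schmidt_category :: "('o, 'a) preadd_cat \<Rightarrow> bool" where
  "krull_schmidt_category C \<longleftrightarrow> additive_category C \<and>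
     (\<forall>M\<in>Obj C. \<exists>Xs. krull_schmidt_decomposition C M Xs)"

section \<open>Complex Lie algebras\<close>

record 'g lie_alg = "(complex, 'g) module" +
  bracket :: "'g \<Rightarrow> 'g \<Rightarrow> 'g"

locale lie_algebra = vectorspace CC G for G :: "'g lie_alg" (structure) +
  assumes bracket_closed: "\<lbrakk>x \<in> carrier G; y \<in> carrier G\<rbrakk> \<Longrightarrow> bracket G x y \<in> carrier G"
    and bracket_add_left: "\<lbrakk>x \<in> carrier G; y \<in> carrier G; z \<in> carrier G\<rbrakk>
      \<Longrightarrow> bracket G (x \<oplus>\<^bsub>G\<^esub> y) z = bracket G x z \<oplus>\<^bsub>G\<^esub> bracket G y z"
    and bracket_add_right: "\<lbrakk>x \<in> carrier G; y \<in> carrier G; z \<in> carrier G\<rbrakk>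
      \<Longrightarrow> bracket G x (y \<oplus>\<^bsub>G\<^esub> z) = bracket G x y \<oplus>\<^bsub>G\<^esub> bracket G x z"
    and bracket_smult_left: "\<lbrakk>x \<in> carrier G; y \<in> carrier G\<rbrakk>
      \<Longrightarrow> bracket G (c \<odot>\<^bsub>G\<^esub> x) y = c \<odot>\<^bsub>G\<^esub> bracket G x y"
    and bracket_smult_right: "\<lbrakk>x \<in> carrier G; y \<in> carrier G\<rbrakk>
      \<Longrightarrow> bracket G x (c \<odot>\<^bsub>G\<^esub> y) = c \<odot>\<^bsub>G\<^esub> bracket G x y"
    and bracket_self: "x \<in> carrier G \<Longrightarrow> bracket G x x = \<zero>\<^bsub>G\<^esub>"
    and jacobi: "\<lbrakk>x \<in> carrier G; y \<in> carrier G; z \<in> carrier G\<rbrakk>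
      \<Longrightarrow> bracket G x (bracket G y z) \<oplus>\<^bsub>G\<^esub> bracket G y (bracket G z x)
            \<oplus>\<^bsub>G\<^esub> bracket G z (bracket G x y) = \<zero>\<^bsub>G\<^esub>"

definition lie_subalgebra :: "'g lie_alg \<Rightarrow> 'g set \<Rightarrow> bool" where
  "lie_subalgebra G L \<longleftrightarrow> VectorSpace.subspace CC L G \<and> (\<forall>x\<in>L. \<forall>y\<in>L. bracket G x y \<in> L)"

definition lie_ideal :: "'g lie_alg \<Rightarrow> 'g set \<Rightarrow> bool" where
  "lie_ideal G I \<longleftrightarrow> VectorSpace.subspace CC I G \<and> (\<forall>x\<in>carrier G. \<forall>y\<in>I. bracket G x y \<in> I)"

definition bracket_span :: "'g lie_alg \<Rightarrow> 'g set \<Rightarrow> 'g set \<Rightarrow> 'g set" where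
  "bracket_span G A B = LinearCombinations.module.span CC G {bracket G x y | x y. x \<in> A \<and> y \<in> B}"

definition lie_solvable :: "'g lie_alg \<Rightarrow> 'g set \<Rightarrow> bool" where
  "lie_solvable G L \<longleftrightarrow> (\<exists>k. ((\<lambda>D. bracket_span G D D) ^^ k) L = {\<zero>\<^bsub>G\<^esub>})"

definition lie_nilpotent :: "'g lie_alg \<Rightarrow> 'g set \<Rightarrow> bool" where
  "lie_nilpotent G L \<longleftrightarrow> (\<exists>k. (bracket_span G L ^^ k) L = {\<zero>\<^bsub>G\<^esub>})"

definition lie_semisimple :: "'g lie_alg \<Rightarrow> bool" where
  "lie_semisimple G \<longleftrightarrow> (\<forall>I. lie_ideal G I \<and> lie_solvable G I \<longrightarrow> I = {\<zero>\<^bsub>G\<^esub>})"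

definition cartan_subalgebra :: "'g lie_alg \<Rightarrow> 'g set \<Rightarrow> bool" where
  "cartan_subalgebra G h \<longleftrightarrow> lie_subalgebra G h \<and> lie_nilpotent G h \<and>
     {x \<in> carrier G. \<forall>y\<in>h. bracket G x y \<in> h} = h"

text \<open>Functionals on \<open>h\<close> are taken extensional, so that equality of functions is equality in \<open>h\<^sup>*\<close>.\<close>

definition dual_space :: "'g lie_alg \<Rightarrow> 'g set \<Rightarrow> ('g \<Rightarrow> complex) set" where
  "dual_space G h = {f \<in> extensional h.
     (\<forall>x\<in>h. \<forall>y\<in>h. f (x \<oplus>\<^bsub>G\<^esub> y) = f x + f y) \<and> (\<forall>c. \<forall>x\<in>h. f (c \<odot>\<^bsub>G\<^esub> x) = c * f x)}"

definition root_space :: "'g lie_alg \<Rightarrow> 'g set \<Rightarrow> ('g \<Rightarrow> complex) \<Rightarrow> 'g set" where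
  "root_space G h \<alpha> = {x \<in> carrier G. \<forall>y\<in>h. bracket G y x = \<alpha> y \<odot>\<^bsub>G\<^esub> x}"

definition roots :: "'g lie_alg \<Rightarrow> 'g set \<Rightarrow> ('g \<Rightarrow> complex) set" where
  "roots G h = {\<alpha> \<in> dual_space G h. \<alpha> \<noteq> (\<lambda>y\<in>h. 0) \<and> root_space G h \<alpha> \<noteq> {\<zero>\<^bsub>G\<^esub>}}"

definition nat_combinations :: "'g set \<Rightarrow> ('g \<Rightarrow> complex) set \<Rightarrow> ('g \<Rightarrow> complex) set" where
  "nat_combinations h \<Delta> = {(\<lambda>y\<in>h. \<Sum>\<alpha>\<in>\<Delta>. of_nat (k \<alpha>) * \<alpha> y) | k :: ('g \<Rightarrow> complex) \<Rightarrow> nat. True}"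

definition positive_roots :: "'g lie_alg \<Rightarrow> 'g set \<Rightarrow> ('g \<Rightarrow> complex) set \<Rightarrow> ('g \<Rightarrow> complex) set" where
  "positive_roots G h \<Delta> = roots G h \<inter> nat_combinations h \<Delta>"

definition negative_roots :: "'g lie_alg \<Rightarrow> 'g set \<Rightarrow> ('g \<Rightarrow> complex) set \<Rightarrow> ('g \<Rightarrow> complex) set" where
  "negative_roots G h \<Delta> = {\<beta> \<in> roots G h. (\<lambda>y\<in>h. - \<beta> y) \<in> nat_combinations h \<Delta>}"

definition root_base :: "'g lie_alg \<Rightarrow> 'g set \<Rightarrow> ('g \<Rightarrow> complex) set \<Rightarrow> bool" where
  "root_base G h \<Delta> \<longleftrightarrow> finite \<Delta> \<and> \<Delta> \<subseteq> roots G h \<and>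
     (\<forall>c :: ('g \<Rightarrow> complex) \<Rightarrow> complex.
        (\<forall>y\<in>h. (\<Sum>\<alpha>\<in>\<Delta>. c \<alpha> * \<alpha> y) = 0) \<longrightarrow> (\<forall>\<alpha>\<in>\<Delta>. c \<alpha> = 0)) \<and>
     roots G h = positive_roots G h \<Delta> \<union> negative_roots G h \<Delta>"

text \<open>For semisimple \<open>G\<close> it is a theorem, hence not required here, that \<open>G\<close> is the direct sum of
  \<open>nm\<close>, \<open>h\<close> and \<open>n\<close>.\<close>

definition cartan_decomposition :: "'g lie_alg \<Rightarrow> 'g set \<Rightarrow> 'g set \<Rightarrow> 'g set \<Rightarrow> bool" where
  "cartan_decomposition G nm h n \<longleftrightarrow> cartan_subalgebra G h \<and>
     (\<exists>\<Delta>. root_base G h \<Delta> \<and>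
       nm = LinearCombinations.module.span CC G (\<Union>\<alpha>\<in>negative_roots G h \<Delta>. root_space G h \<alpha>) \<and>
       n = LinearCombinations.module.span CC G (\<Union>\<alpha>\<in>positive_roots G h \<Delta>. root_space G h \<alpha>))"

definition borel :: "'g lie_alg \<Rightarrow> 'g set \<Rightarrow> 'g set \<Rightarrow> 'g set" where
  "borel G h n = LinearCombinations.module.submodule_sum G h n"

definition standard_parabolic :: "'g lie_alg \<Rightarrow> 'g set \<Rightarrow> 'g set \<Rightarrow> 'g set \<Rightarrow> bool" where
  "standard_parabolic G h n p \<longleftrightarrow> lie_subalgebra G p \<and> borel G h n \<subseteq> p"

section \<open>Modules over a subalgebra\<close>

record ('g, 'v) lie_mod = "(complex, 'v) module" +
  act :: "'g \<Rightarrow> 'v \<Rightarrow> 'v"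

definition is_lie_module :: "'g lie_alg \<Rightarrow> 'g set \<Rightarrow> ('g, 'v) lie_mod \<Rightarrow> bool" where
  "is_lie_module G p M \<longleftrightarrow> vectorspace CC M \<and>
     (\<forall>x\<in>p. \<forall>v\<in>carrier M. act M x v \<in> carrier M) \<and>
     (\<forall>x\<in>p. \<forall>y\<in>p. \<forall>v\<in>carrier M. act M (x \<oplus>\<^bsub>G\<^esub> y) v = act M x v \<oplus>\<^bsub>M\<^esub> act M y v) \<and>
     (\<forall>c. \<forall>x\<in>p. \<forall>v\<in>carrier M. act M (c \<odot>\<^bsub>G\<^esub> x) v = c \<odot>\<^bsub>M\<^esub> act M x v) \<and>
     (\<forall>x\<in>p. \<forall>v\<in>carrier M. \<forall>w\<in>carrier M. act M x (v \<oplus>\<^bsub>M\<^esub> w) = act M x v \<oplus>\<^bsub>M\<^esub> act M x w) \<and>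
     (\<forall>c. \<forall>x\<in>p. \<forall>v\<in>carrier M. act M x (c \<odot>\<^bsub>M\<^esub> v) = c \<odot>\<^bsub>M\<^esub> act M x v) \<and>
     (\<forall>x\<in>p. \<forall>y\<in>p. \<forall>v\<in>carrier M.
        act M (bracket G x y) v = act M x (act M y v) \<ominus>\<^bsub>M\<^esub> act M y (act M x v))"

definition lie_module_hom :: "'g set \<Rightarrow> ('g, 'v) lie_mod \<Rightarrow> ('g, 'v) lie_mod \<Rightarrow> ('v \<Rightarrow> 'v) set" where
  "lie_module_hom p M N = {f \<in> LinearCombinations.module_hom CC M N \<inter> extensional (carrier M).
     \<forall>x\<in>p. \<forall>v\<in>carrier M. f (act M x v) = act N x (f v)}"

text \<open>All \<open>p\<close>-modules whose underlying set is a subset of the type \<open>'v\<close>; the fields \<open>mult\<close> and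
  \<open>one\<close> inherited from the record of rings play no role.\<close>

definition lie_module_category ::
    "'g lie_alg \<Rightarrow> 'g set \<Rightarrow> (('g, 'v) lie_mod, 'v \<Rightarrow> 'v) preadd_cat" where
  "lie_module_category G p =
     \<lparr>Obj = {M. is_lie_module G p M},
      Hom = lie_module_hom p,
      Comp = (\<lambda>X Y Z g f. compose (carrier X) g f),
      Ident = (\<lambda>X. \<lambda>v\<in>carrier X. v),
      Hplus = (\<lambda>X Y f g. \<lambda>v\<in>carrier X. f v \<oplus>\<^bsub>Y\<^esub> g v),
      Hzero = (\<lambda>X Y. \<lambda>v\<in>carrier X. \<zero>\<^bsub>Y\<^esub>)\<rparr>"

definition weight_space :: "'g set \<Rightarrow> ('g, 'v) lie_mod \<Rightarrow> ('g \<Rightarrow> complex) \<Rightarrow> 'v set" where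
  "weight_space h M \<mu> = {v \<in> carrier M. \<forall>x\<in>h. act M x v = \<mu> x \<odot>\<^bsub>M\<^esub> v}"

definition maximal_space ::
    "'g set \<Rightarrow> 'g set \<Rightarrow> ('g, 'v) lie_mod \<Rightarrow> ('g \<Rightarrow> complex) \<Rightarrow> 'v set" where
  "maximal_space h n M \<mu> = {v \<in> weight_space h M \<mu>. \<forall>x\<in>n. act M x v = \<zero>\<^bsub>M\<^esub>}"

definition maximal_weights ::
    "'g lie_alg \<Rightarrow> 'g set \<Rightarrow> 'g set \<Rightarrow> ('g, 'v) lie_mod \<Rightarrow> ('g \<Rightarrow> complex) set" where
  "maximal_weights G h n M = {\<mu> \<in> dual_space G h. maximal_space h n M \<mu> \<noteq> {\<zero>\<^bsub>M\<^esub>}}"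

text \<open>The sum of the weight spaces is automatically direct.\<close>

definition weight_semisimple :: "'g lie_alg \<Rightarrow> 'g set \<Rightarrow> ('g, 'v) lie_mod \<Rightarrow> bool" where
  "weight_semisimple G h M \<longleftrightarrow>
     LinearCombinations.module.span CC M (\<Union>\<mu>\<in>dual_space G h. weight_space h M \<mu>) = carrier M"

text \<open>The submodule \<open>U(n) v\<close>, described as the least \<open>n\<close>-stable subspace containing \<open>v\<close>.\<close>

definition generated_submodule :: "'g set \<Rightarrow> ('g, 'v) lie_mod \<Rightarrow> 'v \<Rightarrow> 'v set" where
  "generated_submodule n M v = \<Inter>{W. VectorSpace.subspace CC W M \<and> v \<in> W \<and>
     (\<forall>x\<in>n. \<forall>w\<in>W. act M x w \<in> W)}"

definition locally_finite :: "'g set \<Rightarrow> ('g, 'v) lie_mod \<Rightarrow> bool" where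
  "locally_finite n M \<longleftrightarrow> (\<forall>v\<in>carrier M. finite_dim_on M (generated_submodule n M v))"

definition cat_Mp ::
    "'g lie_alg \<Rightarrow> 'g set \<Rightarrow> 'g set \<Rightarrow> 'g set \<Rightarrow> (('g, 'v) lie_mod, 'v \<Rightarrow> 'v) preadd_cat" where
  "cat_Mp G h n p = full_subcategory (lie_module_category G p)
     (\<lambda>M. weight_semisimple G h M \<and> locally_finite n M \<and>
       (\<forall>\<mu>\<in>dual_space G h. finite_dim_on M (weight_space h M \<mu>)) \<and>
       finite (maximal_weights G h n M))"

end

theory Submission
  imports Defs
begin

text \<open>
  Two facts about the category \<open>M\<^sub>p\<close> carry the proof, one for the existence of finite decompositions and
  one for the locality of endomorphism rings. Both become usable because idempotents split in \<open>M\<^sub>p\<close>: the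
  image of an idempotent endomorphism of an object is again an object, as the four defining conditions
  pass to direct summands (\<open>summand_in_Mp\<close>). Hence direct sum decompositions of \<open>M\<close> correspond to
  decompositions of \<open>1\<close> into orthogonal idempotents of \<open>End(M)\<close> (\<open>cat_direct_sum_iff_idems\<close>), and an object
  is indecomposable if and only if it is nonzero and has no idempotents besides \<open>0\<close> and \<open>1\<close>.

  Finiteness: every nonzero object contains a maximal vector (\<open>maximal_vector_exists\<close>), because \<open>n\<close> raises
  weights and \<open>U(n) v\<close> has only finitely many of them. So every nonzero summand of \<open>M\<close> meets \<open>M\<^sub>\<mu>\<close> for one
  of the finitely many \<open>\<mu>\<close> in \<open>\<Pi>\<^sup>+(M)\<close>, and \<open>M\<close> has at most \<open>\<Sum>\<^sub>\<mu> dim M\<^sub>\<mu>\<close> nonzero summands in any decomposition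
  (\<open>orthogonal_idems_bound\<close>). A decomposition with the largest number of nonzero summands consists of
  indecomposable objects (\<open>primitive_decomposition\<close>).

  Locality: an endomorphism \<open>f\<close> of \<open>M\<close> preserves the finite-dimensional weight spaces, so the Fitting
  decompositions of these spaces add up to a decomposition of \<open>M\<close> into a submodule on which \<open>f\<close> is locally
  nilpotent and one on which \<open>f\<close> is bijective (\<open>fitting_sum\<close>). If \<open>M\<close> is indecomposable, then \<open>f\<close> is
  locally nilpotent or bijective, and \<open>f\<close> or \<open>1 - f\<close> is invertible (\<open>fitting_local\<close>).

  Uniqueness is the theorem of Krull, Remak, Schmidt and Azumaya, which holds for decompositions into
  objects with local endomorphism rings in any preadditive category. It is proved in the ring \<open>End(M)\<close> by
  Gaussian elimination (\<open>local_idems_unique\<close>): two decompositions of \<open>1\<close> make \<open>1\<close> an invertible matrix whose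
  entries map the summands of one decomposition to those of the other; locality provides an invertible
  entry, and the Schur complement of this pivot is again invertible.

  Since objects have their carriers inside a fixed type, direct sums in \<open>M\<^sub>p\<close> are transported into this
  type by cardinal arithmetic (\<open>carrier_product_injection\<close>).
\<close>

section \<open>Idempotents in a ring\<close>

text \<open>The Peirce corner \<open>e R e\<close> of an idempotent \<open>e\<close>, a ring with unit \<open>e\<close>; for the idempotent of a
  direct summand \<open>X\<close> of \<open>M\<close> in \<open>End(M)\<close> it is a copy of \<open>End(X)\<close>.\<close>
definition (in ring) corner :: "'a \<Rightarrow> 'a set" where
  "corner e = {x \<in> carrier R. e \<otimes> x = x \<and> x \<otimes> e = x}"

definition (in ring) corner_unit :: "'a \<Rightarrow> 'a \<Rightarrow> bool" where
  "corner_unit e x \<longleftrightarrow> x \<in> corner e \<and> (\<exists>y\<in>corner e. x \<otimes> y = e \<and> y \<otimes> x = e)"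

text \<open>The corner ring of \<open>e\<close> is local.\<close>
definition (in ring) local_idem :: "'a \<Rightarrow> bool" where
  "local_idem e \<longleftrightarrow> e \<in> carrier R \<and> e \<otimes> e = e \<and> e \<noteq> \<zero> \<and>
     (\<forall>x\<in>corner e. \<forall>y\<in>corner e. corner_unit e (x \<oplus> y) \<longrightarrow> corner_unit e x \<or> corner_unit e y)"

definition (in ring) primitive_idem :: "'a \<Rightarrow> bool" where
  "primitive_idem e \<longleftrightarrow> e \<in> carrier R \<and> e \<otimes> e = e \<and> e \<noteq> \<zero> \<and>
     (\<forall>x\<in>corner e. x \<otimes> x = x \<longrightarrow> x = \<zero> \<or> x = e)"

text \<open>Murray--von Neumann equivalence of idempotents. In an endomorphism ring it says that the two
  summands are isomorphic, while only ring elements occur.\<close>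
definition (in ring) idem_iso :: "'a \<Rightarrow> 'a \<Rightarrow> bool" where
  "idem_iso e f \<longleftrightarrow> (\<exists>u\<in>carrier R. \<exists>v\<in>carrier R. f \<otimes> u = u \<and> u \<otimes> e = u \<and>
     e \<otimes> v = v \<and> v \<otimes> f = v \<and> v \<otimes> u = e \<and> u \<otimes> v = f)"

definition (in ring) orthogonal_idems :: "'i set \<Rightarrow> ('i \<Rightarrow> 'a) \<Rightarrow> bool" where
  "orthogonal_idems I e \<longleftrightarrow> e \<in> I \<rightarrow> carrier R \<and>
     (\<forall>i\<in>I. \<forall>j\<in>I. e i \<otimes> e j = (if i = j then e i else \<zero>))"

context ring
begin

lemma orthogonal_idemsD:
  assumes "orthogonal_idems I e" "i \<in> I"
  shows "e i \<in> carrier R" "e i \<otimes> e i = e i" "\<And>j. j \<in> I \<Longrightarrow> i \<noteq> j \<Longrightarrow> e i \<otimes> e j = \<zero>"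
  using assms unfolding orthogonal_idems_def by auto

lemma orthogonal_idems_mono: "orthogonal_idems I e \<Longrightarrow> J \<subseteq> I \<Longrightarrow> orthogonal_idems J e"
  unfolding orthogonal_idems_def by (auto simp: subset_iff)

lemma orthogonal_idems_finsum:
  assumes "orthogonal_idems I e" "finite I" "J \<subseteq> I" "i \<in> I"
  shows "e i \<otimes> (\<Oplus>j\<in>J. e j) = (if i \<in> J then e i else \<zero>)"
    and "(\<Oplus>j\<in>J. e j) \<otimes> e i = (if i \<in> J then e i else \<zero>)"
proof -
  have J: "finite J" "e \<in> J \<rightarrow> carrier R" "e i \<in> carrier R"
    using assms finite_subset unfolding orthogonal_idems_def by auto
  have 1: "e i \<otimes> (\<Oplus>j\<in>J. e j) = (\<Oplus>j\<in>J. e i \<otimes> e j)"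
    by (rule finsum_rdistr) (use J in auto)
  have 2: "(\<Oplus>j\<in>J. e j) \<otimes> e i = (\<Oplus>j\<in>J. e j \<otimes> e i)"
    by (rule finsum_ldistr) (use J in auto)
  have 3: "(\<Oplus>j\<in>J. e i \<otimes> e j) = (\<Oplus>j\<in>J. if i = j then e i else \<zero>)"
    by (rule finsum_cong') (use assms J in \<open>auto simp: orthogonal_idems_def\<close>)
  have 4: "(\<Oplus>j\<in>J. e j \<otimes> e i) = (\<Oplus>j\<in>J. if i = j then e i else \<zero>)"
    by (rule finsum_cong') (use assms J in \<open>auto simp: orthogonal_idems_def\<close>)
  have 5: "(\<Oplus>j\<in>J. if i = j then e i else \<zero>) = (if i \<in> J then e i else \<zero>)"
  proof (cases "i \<in> J")
    case True
    then show ?thesis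
      using add.finprod_singleton[of i J "\<lambda>_. e i"] J by simp
  next
    case False
    then have "(\<Oplus>j\<in>J. if i = j then e i else \<zero>) = (\<Oplus>j\<in>J. \<zero>)"
      by (intro finsum_cong') auto
    then show ?thesis using False by simp
  qed
  show "e i \<otimes> (\<Oplus>j\<in>J. e j) = (if i \<in> J then e i else \<zero>)"
    "(\<Oplus>j\<in>J. e j) \<otimes> e i = (if i \<in> J then e i else \<zero>)"
    using 1 2 3 4 5 by simp_all
qed

lemma orthogonal_idems_sum_idem:
  assumes "orthogonal_idems I e" "finite I"
  shows "(\<Oplus>j\<in>I. e j) \<otimes> (\<Oplus>j\<in>I. e j) = (\<Oplus>j\<in>I. e j)"
proof -
  have e: "e \<in> I \<rightarrow> carrier R" using assms unfolding orthogonal_idems_def by auto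
  have "(\<Oplus>j\<in>I. e j) \<otimes> (\<Oplus>j\<in>I. e j) = (\<Oplus>i\<in>I. e i \<otimes> (\<Oplus>j\<in>I. e j))"
    by (rule finsum_ldistr) (use assms e in auto)
  also have "\<dots> = (\<Oplus>i\<in>I. e i)"
    by (rule finsum_cong') (use assms e orthogonal_idems_finsum(1)[OF assms] in auto)
  finally show ?thesis .
qed

lemma minus_plus_cancel:
  "a \<in> carrier R \<Longrightarrow> b \<in> carrier R \<Longrightarrow> (a \<ominus> b) \<oplus> b = a"
  by (simp add: minus_eq a_assoc l_neg)

lemma corner_closed: "x \<in> corner e \<Longrightarrow> x \<in> carrier R"
  by (simp add: corner_def)

lemma corner_add:
  assumes "e \<in> carrier R" "x \<in> corner e" "y \<in> corner e" shows "x \<oplus> y \<in> corner e"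
  using assms by (auto simp: corner_def l_distr r_distr)

text \<open>This is how an idempotent is cut in two, both in refining decompositions and in comparing local
  idempotents.\<close>
lemma corner_complement:
  assumes "e \<in> carrier R" "e \<otimes> e = e" "x \<in> corner e" "x \<otimes> x = x"
  shows "e \<ominus> x \<in> corner e" "(e \<ominus> x) \<otimes> (e \<ominus> x) = e \<ominus> x"
    "x \<otimes> (e \<ominus> x) = \<zero>" "(e \<ominus> x) \<otimes> x = \<zero>" "x \<oplus> (e \<ominus> x) = e"
  using assms by (auto simp: corner_def l_distr r_distr minus_eq l_minus r_minus r_neg l_neg a_ac
      minus_add r_neg1 r_neg2)

lemma local_idem_finsum:
  assumes e: "local_idem e" and J: "finite J"
    and x: "x \<in> J \<rightarrow> corner e" and unit: "corner_unit e (\<Oplus>j\<in>J. x j)"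
  shows "\<exists>j\<in>J. corner_unit e (x j)"
proof -
  have "(\<Oplus>j\<in>J. x j) \<in> corner e \<and> (corner_unit e (\<Oplus>j\<in>J. x j) \<longrightarrow> (\<exists>j\<in>J. corner_unit e (x j)))"
    using J x
  proof (induction J)
    case empty
    have "\<zero> \<in> corner e" using e by (simp add: corner_def local_idem_def)
    moreover have "\<not> corner_unit e \<zero>"
      using e by (auto simp: corner_unit_def local_idem_def corner_def)
    ultimately show ?case by simp
  next
    case (insert j J)
    have c: "x \<in> J \<rightarrow> carrier R" "x j \<in> carrier R" "x j \<in> corner e"
      using insert corner_closed by auto
    have eq: "(\<Oplus>i\<in>insert j J. x i) = x j \<oplus> (\<Oplus>i\<in>J. x i)"
      using insert c by simp
    have s: "(\<Oplus>i\<in>J. x i) \<in> corner e" using insert by auto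
    show ?case unfolding eq
      using s c(3) corner_add[of e "x j" "finsum R x J"] e insert.IH insert.prems
      unfolding local_idem_def by blast
  qed
  then show ?thesis using unit by blast
qed

text \<open>One of \<open>g\<close> and \<open>f - g\<close> is invertible in the corner because their sum \<open>f\<close> is, and an invertible
  idempotent is the unit of the corner.\<close>
lemma local_idem_trivial_idems:
  assumes f: "local_idem f" and g: "g \<in> corner f" "g \<otimes> g = g"
  shows "g = \<zero> \<or> g = f"
proof -
  have fR: "f \<in> carrier R" "f \<otimes> f = f" using f by (auto simp: local_idem_def)
  note c = corner_complement[OF fR g]
  have idem_unit: "x = f" if "corner_unit f x" "x \<otimes> x = x" for x
  proof -
    from that obtain y where y: "y \<in> corner f" "x \<otimes> y = f" and x: "x \<in> corner f"
      by (auto simp: corner_unit_def)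
    have "x = x \<otimes> (x \<otimes> y)" using x y by (simp add: corner_def)
    also have "\<dots> = (x \<otimes> x) \<otimes> y" using x y corner_closed by (simp add: m_assoc)
    finally show ?thesis using that y by simp
  qed
  have "corner_unit f f" using fR by (auto simp: corner_unit_def corner_def)
  then have "corner_unit f g \<or> corner_unit f (f \<ominus> g)"
    using f g(1) c(1,5) unfolding local_idem_def by metis
  then show ?thesis
  proof
    assume "corner_unit f (f \<ominus> g)"
    then have "f \<ominus> g = f" using idem_unit c(2) by blast
    then have "g \<otimes> f = \<zero>" using c(3) by simp
    then show ?thesis using g(1) by (simp add: corner_def)
  qed (use idem_unit g in blast)
qed

text \<open>If the unit \<open>e\<close> factors through \<open>f\<close> up to an invertible element, then \<open>e\<close> is equivalent to an
  idempotent below \<open>f\<close>; a local \<open>f\<close> leaves only \<open>f\<close> itself. This produces the isomorphisms in the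
  uniqueness theorem.\<close>
lemma corner_unit_factor_iso:
  assumes e: "e \<in> carrier R" "e \<otimes> e = e" "e \<noteq> \<zero>" and f: "local_idem f"
    and u: "u \<in> carrier R" "f \<otimes> u = u" "u \<otimes> e = u"
    and v: "v \<in> carrier R" "e \<otimes> v = v" "v \<otimes> f = v"
    and unit: "corner_unit e (v \<otimes> u)"
  obtains w where "w \<in> carrier R" "e \<otimes> w = w" "w \<otimes> f = w" "w \<otimes> u = e" "u \<otimes> w = f"
proof -
  from unit obtain c where c: "c \<in> carrier R" "e \<otimes> c = c" "c \<otimes> (v \<otimes> u) = e"
    by (auto simp: corner_unit_def corner_def)
  have fR: "f \<in> carrier R" using f by (simp add: local_idem_def)
  define w where "w = c \<otimes> v"
  have w: "w \<in> carrier R" "e \<otimes> w = w" "w \<otimes> f = w" "w \<otimes> u = e"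
    using c v u fR e by (auto simp: w_def m_assoc) (simp flip: m_assoc)
  define g where "g = u \<otimes> w"
  have gR: "g \<in> carrier R" by (simp add: g_def u w)
  have "g \<otimes> g = u \<otimes> (w \<otimes> u) \<otimes> w" using u(1) w(1) by (simp add: g_def m_assoc)
  then have gg: "g \<otimes> g = g" using u w by (simp add: g_def)
  have "f \<otimes> g = (f \<otimes> u) \<otimes> w" "g \<otimes> f = u \<otimes> (w \<otimes> f)"
    using u(1) w(1) fR by (simp_all add: g_def m_assoc)
  then have gc: "g \<in> corner f"
    using u w gR by (simp add: corner_def g_def)
  have "g \<noteq> \<zero>"
  proof
    assume "g = \<zero>"
    then have "w \<otimes> g \<otimes> u = \<zero>" using w u by simp
    moreover have "w \<otimes> g \<otimes> u = (w \<otimes> u) \<otimes> (w \<otimes> u)" using u(1) w(1) by (simp add: g_def m_assoc)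
    ultimately show False using w e by simp
  qed
  then have "u \<otimes> w = f" using local_idem_trivial_idems[OF f gc gg] by (simp add: g_def)
  with w that show thesis by blast
qed

text \<open>Take \<open>a\<close> and \<open>b\<close> as mutually inverse \<open>2\<times>2\<close> block matrices with respect to \<open>e0 + E\<close> and
  \<open>f0 + F\<close>, with \<open>w\<close> the inverse of the upper left block of \<open>a\<close>. The Schur complement of that block
  in \<open>a\<close> is inverse to the lower right block of \<open>b\<close>, which is how one summand is cancelled on either
  side.\<close>
lemma schur_complement_inverse:
  assumes R: "e0 \<in> carrier R" "E \<in> carrier R" "f0 \<in> carrier R" "F \<in> carrier R"
      "a \<in> carrier R" "b \<in> carrier R" "w \<in> carrier R"
    and e: "e0 \<otimes> E = \<zero>" "E \<otimes> e0 = \<zero>" "E \<otimes> E = E"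
    and f: "f0 \<otimes> F = \<zero>" "F \<otimes> f0 = \<zero>" "F \<otimes> F = F"
    and ba: "b \<otimes> (f0 \<oplus> F) \<otimes> a = e0 \<oplus> E" and ab: "a \<otimes> (e0 \<oplus> E) \<otimes> b = f0 \<oplus> F"
    and w: "e0 \<otimes> w = w" "w \<otimes> f0 = w" "w \<otimes> (f0 \<otimes> a \<otimes> e0) = e0" "(f0 \<otimes> a \<otimes> e0) \<otimes> w = f0"
  defines "a' \<equiv> F \<otimes> (a \<ominus> a \<otimes> w \<otimes> a) \<otimes> E" and "b' \<equiv> E \<otimes> b \<otimes> F"
  shows "b' \<otimes> a' = E" and "a' \<otimes> b' = F"
proof -
  note [simp] = R
  have cancel: "x = z" if "x \<oplus> y = z \<oplus> y" "x \<in> carrier R" "y \<in> carrier R" "z \<in> carrier R" for x y z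
    using that by simp
  have Ew: "E \<otimes> w = \<zero>"
  proof -
    have "E \<otimes> w = E \<otimes> (e0 \<otimes> w)" using w by simp
    also have "\<dots> = (E \<otimes> e0) \<otimes> w" by (simp add: m_assoc)
    finally show ?thesis using e by simp
  qed
  have wF: "w \<otimes> F = \<zero>"
  proof -
    have "w \<otimes> F = (w \<otimes> f0) \<otimes> F" using w by simp
    also have "\<dots> = w \<otimes> (f0 \<otimes> F)" by (simp add: m_assoc)
    finally show ?thesis using f by simp
  qed
  have wae: "w \<otimes> a \<otimes> e0 = e0"
  proof -
    have "w \<otimes> (f0 \<otimes> a \<otimes> e0) = (w \<otimes> f0) \<otimes> a \<otimes> e0" by (simp add: m_assoc)
    then show ?thesis using w by simp
  qed
  have faw: "f0 \<otimes> a \<otimes> w = f0"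
  proof -
    have "(f0 \<otimes> a \<otimes> e0) \<otimes> w = f0 \<otimes> a \<otimes> (e0 \<otimes> w)" by (simp add: m_assoc)
    then show ?thesis using w by simp
  qed
  have bFa: "b \<otimes> F \<otimes> a = (e0 \<oplus> E) \<ominus> b \<otimes> f0 \<otimes> a"
    unfolding ba[symmetric] by (simp add: l_distr r_distr minus_eq a_ac r_neg r_neg1 r_neg2)
  have aEb: "a \<otimes> E \<otimes> b = (f0 \<oplus> F) \<ominus> a \<otimes> e0 \<otimes> b"
    unfolding ab[symmetric] by (simp add: l_distr r_distr minus_eq a_ac r_neg r_neg1 r_neg2)
  have FF: "F \<otimes> (F \<otimes> x) = F \<otimes> x" "E \<otimes> (E \<otimes> x) = E \<otimes> x" if "x \<in> carrier R" for x
    using that by (simp_all flip: m_assoc add: e f)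
  have "b' \<otimes> a' = E \<otimes> (b \<otimes> F \<otimes> a) \<otimes> E \<ominus> E \<otimes> (b \<otimes> F \<otimes> a) \<otimes> w \<otimes> a \<otimes> E"
    unfolding a'_def b'_def by (simp add: l_distr r_distr minus_eq l_minus r_minus m_assoc FF)
  also have "E \<otimes> (b \<otimes> F \<otimes> a) = E \<ominus> E \<otimes> b \<otimes> f0 \<otimes> a"
    unfolding bFa by (simp add: r_distr minus_eq r_minus e m_assoc)
  also have "(E \<ominus> E \<otimes> b \<otimes> f0 \<otimes> a) \<otimes> E = E \<ominus> E \<otimes> b \<otimes> f0 \<otimes> a \<otimes> E"
    by (simp add: l_distr minus_eq l_minus e)
  also have "(E \<ominus> E \<otimes> b \<otimes> f0 \<otimes> a) \<otimes> w = E \<otimes> w \<ominus> E \<otimes> b \<otimes> (f0 \<otimes> a \<otimes> w)"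
    by (simp add: l_distr minus_eq l_minus m_assoc)
  also have "\<dots> = \<ominus> (E \<otimes> b \<otimes> f0)"
    by (simp add: Ew faw minus_eq)
  also have "E \<ominus> E \<otimes> b \<otimes> f0 \<otimes> a \<otimes> E \<ominus> \<ominus> (E \<otimes> b \<otimes> f0) \<otimes> a \<otimes> E = E"
    by (simp add: minus_eq l_minus a_assoc l_neg)
  finally show "b' \<otimes> a' = E" .
  have "a' \<otimes> b' = F \<otimes> (a \<otimes> E \<otimes> b) \<otimes> F \<ominus> F \<otimes> a \<otimes> w \<otimes> (a \<otimes> E \<otimes> b) \<otimes> F"
    unfolding a'_def b'_def by (simp add: l_distr r_distr minus_eq l_minus r_minus m_assoc FF)
  also have "F \<otimes> a \<otimes> w \<otimes> (a \<otimes> E \<otimes> b) \<otimes> F = F \<otimes> a \<otimes> w \<otimes> ((a \<otimes> E \<otimes> b) \<otimes> F)"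
    by (simp add: m_assoc)
  also have "F \<otimes> (a \<otimes> E \<otimes> b) \<otimes> F = F \<otimes> ((a \<otimes> E \<otimes> b) \<otimes> F)"
    by (simp add: m_assoc)
  also have "(a \<otimes> E \<otimes> b) \<otimes> F = F \<ominus> a \<otimes> e0 \<otimes> b \<otimes> F"
    unfolding aEb by (simp add: l_distr minus_eq l_minus f)
  also have "F \<otimes> a \<otimes> w \<otimes> (F \<ominus> a \<otimes> e0 \<otimes> b \<otimes> F) = F \<otimes> a \<otimes> (w \<otimes> F) \<ominus> F \<otimes> a \<otimes> (w \<otimes> a \<otimes> e0) \<otimes> b \<otimes> F"
    by (simp add: r_distr minus_eq r_minus m_assoc)
  also have "\<dots> = \<ominus> (F \<otimes> a \<otimes> e0 \<otimes> b \<otimes> F)"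
    by (simp add: wF wae minus_eq)
  also have "F \<otimes> (F \<ominus> a \<otimes> e0 \<otimes> b \<otimes> F) = F \<ominus> F \<otimes> a \<otimes> e0 \<otimes> b \<otimes> F"
    by (simp add: r_distr minus_eq r_minus f m_assoc)
  also have "F \<ominus> F \<otimes> a \<otimes> e0 \<otimes> b \<otimes> F \<ominus> \<ominus> (F \<otimes> a \<otimes> e0 \<otimes> b \<otimes> F) = F"
    by (simp add: minus_eq a_assoc l_neg)
  finally show "a' \<otimes> b' = F" .
qed

text \<open>The Krull--Remak--Schmidt--Azumaya theorem for idempotents. The starting elements of interest are
  \<open>a = b = 1\<close>; general mutually inverse \<open>a\<close> and \<open>b\<close> make the induction possible, because cancelling a
  pivot replaces them by a Schur complement and a block. A pivot exists by locality: \<open>e i0\<close> is the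
  sum of the elements \<open>e i0 b (f j) a e i0\<close>, one of which must be invertible in the corner.\<close>
theorem local_idems_unique:
  assumes "finite I" "finite J" "orthogonal_idems I e" "orthogonal_idems J f"
    and "\<And>i. i \<in> I \<Longrightarrow> local_idem (e i)" "\<And>j. j \<in> J \<Longrightarrow> local_idem (f j)"
    and "a \<in> carrier R" "b \<in> carrier R"
    and "b \<otimes> (\<Oplus>j\<in>J. f j) \<otimes> a = (\<Oplus>i\<in>I. e i)" "a \<otimes> (\<Oplus>i\<in>I. e i) \<otimes> b = (\<Oplus>j\<in>J. f j)"
  shows "\<exists>\<sigma>. bij_betw \<sigma> I J \<and> (\<forall>i\<in>I. idem_iso (e i) (f (\<sigma> i)))"
  using assms
proof (induction I arbitrary: J a b rule: finite_induct)
  case (empty J a b)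
  have "J = {}"
  proof (rule ccontr)
    assume "J \<noteq> {}"
    then obtain j where j: "j \<in> J" by blast
    have "(\<Oplus>j\<in>J. f j) = \<zero>" using empty by simp
    then have "f j = \<zero>"
      using orthogonal_idems_finsum(1)[OF empty.prems(3) empty.prems(1) subset_refl j]
        orthogonal_idemsD(1)[OF empty.prems(3) j] j by simp
    then show False using empty.prems(5)[OF j] by (simp add: local_idem_def)
  qed
  then show ?case by (auto simp: bij_betw_def)
next
  case (insert i0 I J a b)
  note oe = insert.prems(2) and oJ = insert.prems(3) and finJ = insert.prems(1)
  have [simp]: "a \<in> carrier R" "b \<in> carrier R" by fact+
  have eR: "e \<in> insert i0 I \<rightarrow> carrier R" and fR: "f \<in> J \<rightarrow> carrier R"
    using oe oJ by (auto simp: orthogonal_idems_def)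
  have [simp]: "f j \<in> carrier R" if "j \<in> J" for j using fR that by auto
  have e0: "local_idem (e i0)" using insert by blast
  have e0R [simp]: "e i0 \<in> carrier R" and ee0: "e i0 \<otimes> e i0 = e i0" and e0nz: "e i0 \<noteq> \<zero>"
    using e0 by (auto simp: local_idem_def)
  have finI: "finite (insert i0 I)" using insert by simp
  have e0sum: "e i0 \<otimes> (\<Oplus>i\<in>insert i0 I. e i) = e i0"
    using orthogonal_idems_finsum(1)[OF oe finI subset_refl] by simp
  \<comment> \<open>The contribution of \<open>f j\<close> to \<open>e i0\<close>; some \<open>x j\<close> is the pivot.\<close>
  define x where "x j = e i0 \<otimes> b \<otimes> f j \<otimes> a \<otimes> e i0" for j
  have ee: "e i0 \<otimes> (e i0 \<otimes> z) = e i0 \<otimes> z" if "z \<in> carrier R" for z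
    using that ee0 by (simp flip: m_assoc)
  have xc: "x \<in> J \<rightarrow> corner (e i0)"
    by (rule Pi_I) (simp add: x_def corner_def m_assoc ee0 ee)
  have "(\<Oplus>j\<in>J. x j) = e i0 \<otimes> b \<otimes> (\<Oplus>j\<in>J. f j) \<otimes> a \<otimes> e i0"
  proof -
    have "e i0 \<otimes> b \<otimes> (\<Oplus>j\<in>J. f j) \<otimes> a \<otimes> e i0 = (\<Oplus>j\<in>J. e i0 \<otimes> b \<otimes> f j) \<otimes> a \<otimes> e i0"
      using finJ fR by (subst finsum_rdistr) auto
    also have "\<dots> = (\<Oplus>j\<in>J. e i0 \<otimes> b \<otimes> f j \<otimes> a) \<otimes> e i0"
      using finJ fR by (subst finsum_ldistr) auto
    also have "\<dots> = (\<Oplus>j\<in>J. x j)"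
      unfolding x_def using finJ fR by (subst finsum_ldistr) auto
    finally show ?thesis by simp
  qed
  also have "\<dots> = e i0 \<otimes> (b \<otimes> (\<Oplus>j\<in>J. f j) \<otimes> a) \<otimes> e i0"
    using finJ fR by (simp add: m_assoc)
  also have "\<dots> = e i0"
    using insert.prems(8) e0sum ee0 by simp
  finally have "corner_unit (e i0) (\<Oplus>j\<in>J. x j)"
    using ee0 by (auto simp: corner_unit_def corner_def)
  then obtain j0 where j0: "j0 \<in> J" and unit: "corner_unit (e i0) (x j0)"
    using local_idem_finsum[OF e0 finJ xc] by blast
  have f0: "local_idem (f j0)" using insert j0 by blast
  have f0R [simp]: "f j0 \<in> carrier R" and ff0: "f j0 \<otimes> f j0 = f j0"
    using f0 by (auto simp: local_idem_def)
  have ff: "f j0 \<otimes> (f j0 \<otimes> z) = f j0 \<otimes> z" if "z \<in> carrier R" for z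
    using that ff0 by (simp flip: m_assoc)
  have "(e i0 \<otimes> b \<otimes> f j0) \<otimes> (f j0 \<otimes> a \<otimes> e i0) = x j0"
    by (simp add: x_def m_assoc ff)
  then have unit': "corner_unit (e i0) ((e i0 \<otimes> b \<otimes> f j0) \<otimes> (f j0 \<otimes> a \<otimes> e i0))" using unit by simp
  obtain w where w: "w \<in> carrier R" "e i0 \<otimes> w = w" "w \<otimes> f j0 = w"
      "w \<otimes> (f j0 \<otimes> a \<otimes> e i0) = e i0" "(f j0 \<otimes> a \<otimes> e i0) \<otimes> w = f j0"
    by (rule corner_unit_factor_iso[OF e0R ee0 e0nz f0 _ _ _ _ _ _ unit'])
      (simp_all add: m_assoc ee0 ff0 ee ff)
  have iso0: "idem_iso (e i0) (f j0)"
    unfolding idem_iso_def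
    by (rule bexI[of _ "f j0 \<otimes> a \<otimes> e i0"], rule bexI[of _ w]) (use w in \<open>simp_all add: m_assoc ee0 ff\<close>)
  define J' where "J' = J - {j0}"
  have J: "J = insert j0 J'" "j0 \<notin> J'" "finite J'" "J' \<subseteq> J" using j0 finJ by (auto simp: J'_def)
  define E where "E = (\<Oplus>i\<in>I. e i)"
  define F where "F = (\<Oplus>j\<in>J'. f j)"
  have oe': "orthogonal_idems I e" and oJ': "orthogonal_idems J' f"
    using orthogonal_idems_mono oe oJ J by blast+
  have ER [simp]: "E \<in> carrier R" and FR [simp]: "F \<in> carrier R"
    using eR fR J by (auto simp: E_def F_def)
  have sumE: "(\<Oplus>i\<in>insert i0 I. e i) = e i0 \<oplus> E" and sumF: "(\<Oplus>j\<in>J. f j) = f j0 \<oplus> F"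
    using insert.hyps eR fR J by (auto simp: E_def F_def)
  have E: "e i0 \<otimes> E = \<zero>" "E \<otimes> e i0 = \<zero>" "E \<otimes> E = E"
    using orthogonal_idems_finsum[OF oe finI, of I i0] insert.hyps
      orthogonal_idems_sum_idem[OF oe'] by (auto simp: E_def)
  have F: "f j0 \<otimes> F = \<zero>" "F \<otimes> f j0 = \<zero>" "F \<otimes> F = F"
    using orthogonal_idems_finsum[OF oJ finJ, of J' j0] J j0
      orthogonal_idems_sum_idem[OF oJ'] by (auto simp: F_def)
  define a' where "a' = F \<otimes> (a \<ominus> a \<otimes> w \<otimes> a) \<otimes> E"
  define b' where "b' = E \<otimes> b \<otimes> F"
  have inv: "b' \<otimes> a' = E" "a' \<otimes> b' = F"
    unfolding a'_def b'_def
    by (rule schur_complement_inverse[of "e i0" E "f j0" F a b w]; use w E F insert.prems(8,9) sumE sumF in simp)+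
  have R': "a' \<in> carrier R" "b' \<in> carrier R" using w by (simp_all add: a'_def b'_def)
  have "b' \<otimes> F = b'" "a' \<otimes> E = a'"
    using w E F by (simp_all add: a'_def b'_def m_assoc)
  then have "b' \<otimes> F \<otimes> a' = E" "a' \<otimes> E \<otimes> b' = F" using inv by simp_all
  then have "\<exists>\<sigma>. bij_betw \<sigma> I J' \<and> (\<forall>i\<in>I. idem_iso (e i) (f (\<sigma> i)))"
    using insert.IH[of J' a' b'] J R' oe' oJ' insert.prems(4,5) unfolding E_def F_def by blast
  then obtain \<sigma> where \<sigma>: "bij_betw \<sigma> I J'" "\<And>i. i \<in> I \<Longrightarrow> idem_iso (e i) (f (\<sigma> i))" by blast
  have "bij_betw (\<sigma>(i0 := j0)) (insert i0 I) J"
  proof -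
    have "bij_betw (\<sigma>(i0 := j0)) I J'"
      using \<sigma>(1) insert.hyps by (subst bij_betw_cong[of I _ \<sigma>]) auto
    then show ?thesis
      using J insert.hyps notIn_Un_bij_betw[of i0 I "\<sigma>(i0 := j0)" J'] by simp
  qed
  moreover have "\<forall>i\<in>insert i0 I. idem_iso (e i) (f ((\<sigma>(i0 := j0)) i))"
    using iso0 \<sigma>(2) by simp
  ultimately show ?case by (intro exI[of _ "\<sigma>(i0 := j0)"] conjI)
qed

text \<open>If the number of members in a set of nonzero orthogonal idempotents is bounded, then a set of
  maximal size is a decomposition of \<open>1\<close> into primitive idempotents: a nonzero remainder \<open>1 - s\<close> could be
  added, and an imprimitive member could be replaced by the two parts of a splitting.\<close>
theorem primitive_decomposition:
  assumes bound: "\<And>E. finite E \<Longrightarrow> orthogonal_idems E (\<lambda>x. x) \<Longrightarrow> \<zero> \<notin> E \<Longrightarrow> card E \<le> N"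
  obtains E where "finite E" "orthogonal_idems E (\<lambda>x. x)" "(\<Oplus>x\<in>E. x) = \<one>"
    "\<And>e. e \<in> E \<Longrightarrow> primitive_idem e"
proof -
  define P where "P E \<longleftrightarrow> finite E \<and> orthogonal_idems E (\<lambda>x. x) \<and> \<zero> \<notin> E" for E
  have P0: "P {}" by (simp add: P_def orthogonal_idems_def)
  have "\<exists>E. P E \<and> (\<forall>E'. P E' \<longrightarrow> card E' \<le> card E)"
    by (rule ex_has_greatest_nat[of P "{}" card "N + 1"]) (use P0 bound in \<open>auto simp: P_def le_imp_less_Suc\<close>)
  then obtain E where PE: "P E" and max: "\<And>E'. P E' \<Longrightarrow> card E' \<le> card E" by blast
  then have E: "finite E" "orthogonal_idems E (\<lambda>x. x)" "\<zero> \<notin> E" by (auto simp: P_def)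
  note D = orthogonal_idemsD[OF E(2)]
  \<comment> \<open>Both ways to enlarge a set adjoin an idempotent that is orthogonal to all members.\<close>
  have add_idem: "P (insert x E')" if "P E'" "x \<in> carrier R" "x \<otimes> x = x" "x \<noteq> \<zero>"
    "\<And>e. e \<in> E' \<Longrightarrow> x \<otimes> e = \<zero> \<and> e \<otimes> x = \<zero>" for x E'
    using that by (auto simp: P_def orthogonal_idems_def)
  define s where "s = (\<Oplus>x\<in>E. x)"
  have sR: "s \<in> carrier R" and ss: "s \<otimes> s = s"
    using E orthogonal_idems_sum_idem[OF E(2,1)] by (auto simp: s_def orthogonal_idems_def Pi_def)
  have sE: "e \<otimes> s = e" "s \<otimes> e = e" if "e \<in> E" for e
    using orthogonal_idems_finsum[OF E(2,1) subset_refl that] that by (auto simp: s_def)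
  have "s = \<one>"
  proof (rule ccontr)
    assume "s \<noteq> \<one>"
    define t where "t = \<one> \<ominus> s"
    have t: "t \<in> carrier R" "t \<otimes> t = t" "t \<otimes> s = \<zero>" "s \<otimes> t = \<zero>" "s \<oplus> t = \<one>"
      using corner_complement[of \<one> s] sR ss by (auto simp: t_def corner_def)
    have "t \<noteq> \<zero>" using t \<open>s \<noteq> \<one>\<close> sR by auto
    have te: "t \<otimes> e = \<zero> \<and> e \<otimes> t = \<zero>" if "e \<in> E" for e
    proof -
      have "t \<otimes> (s \<otimes> e) = (t \<otimes> s) \<otimes> e" "(e \<otimes> s) \<otimes> t = e \<otimes> (s \<otimes> t)"
        using t(1) sR D(1)[OF that] by (simp_all add: m_assoc)
      then show ?thesis using sE[OF that] t D(1)[OF that] by simp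
    qed
    have "t \<notin> E" using te t \<open>t \<noteq> \<zero>\<close> by force
    moreover have "P (insert t E)" using add_idem[OF PE t(1,2) \<open>t \<noteq> \<zero>\<close> te] .
    ultimately show False using max[of "insert t E"] E by simp
  qed
  moreover have "primitive_idem e" if e: "e \<in> E" for e
    unfolding primitive_idem_def
  proof (intro conjI ballI impI)
    note eD = D(1,2)[OF e]
    show "e \<in> carrier R" "e \<otimes> e = e" "e \<noteq> \<zero>" using eD E e by auto
    fix x assume x: "x \<in> corner e" "x \<otimes> x = x"
    show "x = \<zero> \<or> x = e"
    proof (rule ccontr)
      assume nt: "\<not> (x = \<zero> \<or> x = e)"
      define y where "y = e \<ominus> x"
      have xR: "x \<in> carrier R" using x corner_closed by blast
      have y: "y \<in> corner e" "y \<otimes> y = y" "x \<otimes> y = \<zero>" "y \<otimes> x = \<zero>" "x \<oplus> y = e"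
        using corner_complement[OF eD x] by (auto simp: y_def)
      have yR: "y \<in> carrier R" using y corner_closed by blast
      have "y \<noteq> \<zero>" using y nt xR by auto
      have orth: "z \<otimes> e' = \<zero> \<and> e' \<otimes> z = \<zero>" if "z \<in> corner e" "e' \<in> E - {e}" for z e'
      proof -
        have zR: "z \<in> carrier R" and e': "e' \<in> carrier R" using that corner_closed D by auto
        have "(z \<otimes> e) \<otimes> e' = z \<otimes> (e \<otimes> e')" "e' \<otimes> (e \<otimes> z) = (e' \<otimes> e) \<otimes> z"
          using zR e' eD by (simp_all add: m_assoc)
        moreover have "e \<otimes> e' = \<zero>" "e' \<otimes> e = \<zero>" using that e D(3) by auto
        ultimately show ?thesis using that(1) zR by (simp add: corner_def)
      qed
      define E' where "E' = E - {e}"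
      have PE': "P E'" using PE orthogonal_idems_mono[OF E(2), of E'] by (auto simp: P_def E'_def)
      have Px: "P (insert x E')"
        by (rule add_idem[OF PE' xR x(2)]) (use nt orth x in \<open>auto simp: E'_def\<close>)
      have "P (insert y (insert x E'))"
        by (rule add_idem[OF Px yR y(2) \<open>y \<noteq> \<zero>\<close>]) (use orth y in \<open>auto simp: E'_def\<close>)
      moreover have "x \<notin> E'" "y \<notin> E'" "y \<noteq> x"
        using orth[OF x(1)] orth[OF y(1)] x y nt \<open>y \<noteq> \<zero>\<close> by (force simp: E'_def)+
      then have "card (insert y (insert x E')) = Suc (card E)"
        using E e card.remove[OF E(1) e] by (simp add: E'_def)
      ultimately show False using max by force
    qed
  qed
  ultimately show thesis using that E by (simp add: s_def)
qed

end

text \<open>The form of locality that Fitting's argument delivers: of \<open>x\<close> and \<open>1 - x\<close> one is a unit. If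
  \<open>a + b\<close> is a unit with inverse \<open>c\<close>, this is applied to \<open>c a\<close> and \<open>c b = 1 - c a\<close>.\<close>
lemma local_ringI:
  fixes R (structure)
  assumes "ring R" "\<one> \<noteq> \<zero>"
    and dich: "\<And>x. x \<in> carrier R \<Longrightarrow> x \<in> Units R \<or> \<one> \<ominus> x \<in> Units R"
  shows "local_ring R"
proof -
  interpret ring R by fact
  have "a \<in> Units R \<or> b \<in> Units R" if ab: "a \<in> carrier R" "b \<in> carrier R" "a \<oplus> b \<in> Units R" for a b
  proof -
    define c where "c = inv (a \<oplus> b)"
    have c: "c \<in> Units R" "c \<in> carrier R" "c \<otimes> (a \<oplus> b) = \<one>" "(a \<oplus> b) \<otimes> c = \<one>"
      using ab by (auto simp: c_def)
    have unit: "z \<in> Units R" if "z \<in> carrier R" "c \<otimes> z \<in> Units R" for z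
    proof -
      have "(a \<oplus> b) \<otimes> (c \<otimes> z) \<in> Units R" using ab that by (simp add: Units_m_closed)
      moreover have "(a \<oplus> b) \<otimes> (c \<otimes> z) = z" using ab c that by (simp flip: m_assoc)
      ultimately show ?thesis by simp
    qed
    have "(c \<otimes> b \<oplus> c \<otimes> a) \<ominus> c \<otimes> a = c \<otimes> b"
      using ab(1,2) c(2) by (simp add: minus_eq a_assoc r_neg)
    moreover have "c \<otimes> b \<oplus> c \<otimes> a = \<one>"
      using ab(1,2) c(2) unfolding c(3)[symmetric] by (simp add: r_distr a_comm)
    ultimately have "\<one> \<ominus> c \<otimes> a = c \<otimes> b" by simp
    moreover have "c \<otimes> a \<in> carrier R" using ab(1) c(2) by simp
    ultimately show ?thesis using dich[of "c \<otimes> a"] unit ab(1,2) by metis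
  qed
  then show ?thesis using assms by (auto simp: local_ring_def)
qed

section \<open>Idempotents and direct sums in a preadditive category\<close>

lemma end_ring_simps [simp]:
  "carrier (end_ring C X) = Hom C X X" "monoid.mult (end_ring C X) = Comp C X X X"
  "one (end_ring C X) = Ident C X" "zero (end_ring C X) = Hzero C X X"
  "add (end_ring C X) = Hplus C X X"
  by (simp_all add: end_ring_def)

context preadditive_category
begin

lemma end_ring_is_ring: "X \<in> Obj C \<Longrightarrow> ring (end_ring C X)"
  by (intro ringI comm_group_abelian_groupI monoidI)
    (simp_all add: Hom_group Ident_closed Comp_closed Comp_Ident Ident_Comp Comp_assoc
      Comp_plus_left Comp_plus_right)

lemma Hzero_closed: "X \<in> Obj C \<Longrightarrow> Y \<in> Obj C \<Longrightarrow> Hzero C X Y \<in> Hom C X Y"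
  using comm_group.axioms(2)[OF Hom_group, THEN group.is_monoid, THEN monoid.one_closed] by simp

lemma Hplus_zero: "X \<in> Obj C \<Longrightarrow> Y \<in> Obj C \<Longrightarrow> Hplus C X Y (Hzero C X Y) (Hzero C X Y) = Hzero C X Y"
  using comm_group.axioms(2)[OF Hom_group, THEN group.is_monoid, THEN monoid.l_one, of X Y "Hzero C X Y"]
    Hzero_closed by simp

lemma Hplus_self_cancel:
  assumes "X \<in> Obj C" "Y \<in> Obj C" "f \<in> Hom C X Y" "Hplus C X Y f f = f"
  shows "f = Hzero C X Y"
  using comm_group.axioms(2)[OF Hom_group[OF assms(1,2)], THEN group.l_cancel_one, of f f] assms by simp

lemma Comp_zero_left:
  assumes "X \<in> Obj C" "Y \<in> Obj C" "Z \<in> Obj C" "f \<in> Hom C X Y"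
  shows "Comp C X Y Z (Hzero C Y Z) f = Hzero C X Z"
  using assms Comp_plus_left[of X Y Z f "Hzero C Y Z" "Hzero C Y Z"]
  by (intro Hplus_self_cancel) (simp_all add: Hplus_zero Hzero_closed Comp_closed)

lemma Comp_zero_right:
  assumes "X \<in> Obj C" "Y \<in> Obj C" "Z \<in> Obj C" "g \<in> Hom C Y Z"
  shows "Comp C X Y Z g (Hzero C X Y) = Hzero C X Z"
  using assms Comp_plus_right[of X Y Z "Hzero C X Y" "Hzero C X Y" g]
  by (intro Hplus_self_cancel) (simp_all add: Hplus_zero Hzero_closed Comp_closed)

lemma zero_object_iff: "zero_object C Z \<longleftrightarrow> Z \<in> Obj C \<and> Ident C Z = Hzero C Z Z"
proof
  assume "zero_object C Z"
  then show "Z \<in> Obj C \<and> Ident C Z = Hzero C Z Z"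
    using Ident_closed Hzero_closed unfolding zero_object_def by blast
next
  assume Z: "Z \<in> Obj C \<and> Ident C Z = Hzero C Z Z"
  have "f = Hzero C X Z" if "X \<in> Obj C" "f \<in> Hom C X Z" for X f
    using that Z Ident_Comp[of X Z f] Comp_zero_left[of X Z Z f] by simp
  moreover have "f = Hzero C Z X" if "X \<in> Obj C" "f \<in> Hom C Z X" for X f
    using that Z Comp_Ident[of Z X f] Comp_zero_right[of Z Z X f] by simp
  ultimately show "zero_object C Z"
    using Z Hzero_closed unfolding zero_object_def by blast
qed

text \<open>The inclusion \<open>i\<close> and projection \<open>p\<close> of a direct summand \<open>X\<close> of \<open>M\<close>; its idempotent is \<open>i p\<close>.\<close>
definition retract :: "'o \<Rightarrow> 'o \<Rightarrow> 'a \<Rightarrow> 'a \<Rightarrow> bool" where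
  "retract M X i p \<longleftrightarrow> M \<in> Obj C \<and> X \<in> Obj C \<and> i \<in> Hom C X M \<and> p \<in> Hom C M X \<and>
     Comp C X M X p i = Ident C X"

text \<open>With the maps of retracts at both ends this transports morphisms from \<open>X \<rightarrow> Y\<close> to endomorphisms of
  \<open>M\<close> (``up'', \<open>j x p\<close>), and endomorphisms of \<open>M\<close> to morphisms \<open>X \<rightarrow> Y\<close> (``down'', \<open>q z i\<close>).\<close>
definition sandwich :: "'o \<Rightarrow> 'o \<Rightarrow> 'o \<Rightarrow> 'o \<Rightarrow> 'a \<Rightarrow> 'a \<Rightarrow> 'a \<Rightarrow> 'a" where
  "sandwich A X Y B p j x = Comp C A Y B j (Comp C A X Y x p)"

abbreviation retract_idem :: "'o \<Rightarrow> 'o \<Rightarrow> 'a \<Rightarrow> 'a \<Rightarrow> 'a" where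
  "retract_idem M X i p \<equiv> Comp C M X M i p"

lemma retractD:
  assumes "retract M X i p"
  shows "M \<in> Obj C" "X \<in> Obj C" "i \<in> Hom C X M" "p \<in> Hom C M X" "Comp C X M X p i = Ident C X"
    "\<And>W f. W \<in> Obj C \<Longrightarrow> f \<in> Hom C W X \<Longrightarrow> Comp C W M X p (Comp C W X M i f) = f"
    "\<And>W f. W \<in> Obj C \<Longrightarrow> f \<in> Hom C X W \<Longrightarrow> Comp C X M W (Comp C M X W f p) i = f"
proof -
  show *: "M \<in> Obj C" "X \<in> Obj C" "i \<in> Hom C X M" "p \<in> Hom C M X" "Comp C X M X p i = Ident C X"
    using assms by (auto simp: retract_def)
  show "Comp C W M X p (Comp C W X M i f) = f" if "W \<in> Obj C" "f \<in> Hom C W X" for W f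
    using that * by (simp add: Comp_assoc Ident_Comp)
  show "Comp C X M W (Comp C M X W f p) i = f" if "W \<in> Obj C" "f \<in> Hom C X W" for W f
    using that * by (simp add: Comp_assoc[symmetric] Comp_Ident)
qed

lemma sandwich_closed:
  assumes "A \<in> Obj C" "X \<in> Obj C" "Y \<in> Obj C" "B \<in> Obj C" "p \<in> Hom C A X" "j \<in> Hom C Y B" "x \<in> Hom C X Y"
  shows "sandwich A X Y B p j x \<in> Hom C A B"
  using assms by (simp add: sandwich_def Comp_closed)

lemma sandwich_add:
  assumes "A \<in> Obj C" "X \<in> Obj C" "Y \<in> Obj C" "B \<in> Obj C" "p \<in> Hom C A X" "j \<in> Hom C Y B"
    "x \<in> Hom C X Y" "y \<in> Hom C X Y"
  shows "sandwich A X Y B p j (Hplus C X Y x y) =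
    Hplus C A B (sandwich A X Y B p j x) (sandwich A X Y B p j y)"
  using assms by (simp add: sandwich_def Comp_closed Comp_plus_left Comp_plus_right)

lemma sandwich_comp:
  assumes r: "retract M Y j q" and ob: "A \<in> Obj C" "X \<in> Obj C" "Z \<in> Obj C" "B \<in> Obj C"
    and h: "p \<in> Hom C A X" "x \<in> Hom C X Y" "y \<in> Hom C Y Z" "k \<in> Hom C Z B"
  shows "Comp C A M B (sandwich M Y Z B q k y) (sandwich A X Y M p j x) =
    sandwich A X Z B p k (Comp C X Y Z y x)"
proof -
  note D = retractD[OF r]
  have "Comp C A M B (sandwich M Y Z B q k y) (sandwich A X Y M p j x) =
    Comp C A Z B k (Comp C A Y Z y (Comp C A M Y q (Comp C A Y M j (Comp C A X Y x p))))"
    using D ob h by (simp add: sandwich_def Comp_closed Comp_assoc)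
  also have "\<dots> = sandwich A X Z B p k (Comp C X Y Z y x)"
    using D ob h by (simp add: sandwich_def Comp_closed) (simp add: Comp_assoc Comp_closed)
  finally show ?thesis .
qed

lemma sandwich_down_up:
  assumes "retract M X i p" "retract M Y j q" "x \<in> Hom C X Y"
  shows "sandwich X M M Y i q (sandwich M X Y M p j x) = x"
proof -
  note D = retractD[OF assms(1)] and E = retractD[OF assms(2)]
  have "sandwich X M M Y i q (sandwich M X Y M p j x) =
    Comp C X M Y (Comp C M M Y q (Comp C M Y M j (Comp C M X Y x p))) i"
    using D E assms(3) by (simp add: sandwich_def Comp_closed Comp_assoc)
  also have "\<dots> = x" using D E assms(3) by (simp add: Comp_closed)
  finally show ?thesis .
qed

lemma sandwich_up_down:
  assumes "retract M X i p" "retract M Y j q" "z \<in> Hom C M M"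
  shows "sandwich M X Y M p j (sandwich X M M Y i q z) =
    Comp C M M M (retract_idem M Y j q) (Comp C M M M z (retract_idem M X i p))"
  using retractD[OF assms(1)] retractD[OF assms(2)] assms(3)
  by (simp add: sandwich_def Comp_closed Comp_assoc)

lemma retract_idem_closed: "retract M X i p \<Longrightarrow> retract_idem M X i p \<in> Hom C M M"
  by (simp add: retract_def Comp_closed)

lemma retract_idem_idem:
  assumes "retract M X i p"
  shows "Comp C M M M (retract_idem M X i p) (retract_idem M X i p) = retract_idem M X i p"
  using sandwich_comp[OF assms, of M X X M p "Ident C X" "Ident C X" i] retractD[OF assms]
  by (simp add: sandwich_def Ident_closed Ident_Comp)

lemma sandwich_retract_idem:
  assumes "retract M X i p"
  shows "sandwich X M M X i p (retract_idem M X i p) = Ident C X"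
  using sandwich_down_up[OF assms assms, of "Ident C X"] retractD[OF assms]
  by (simp add: sandwich_def Ident_closed Ident_Comp)

lemma sandwich_zero:
  assumes "A \<in> Obj C" "X \<in> Obj C" "Y \<in> Obj C" "B \<in> Obj C" "p \<in> Hom C A X" "j \<in> Hom C Y B"
  shows "sandwich A X Y B p j (Hzero C X Y) = Hzero C A B"
  using assms by (simp add: sandwich_def Comp_zero_left Comp_zero_right)

lemma retract_idem_zero_iff:
  assumes "retract M X i p"
  shows "retract_idem M X i p = Hzero C M M \<longleftrightarrow> zero_object C X"
proof
  note D = retractD[OF assms]
  assume "retract_idem M X i p = Hzero C M M"
  then show "zero_object C X"
    using sandwich_retract_idem[OF assms] sandwich_zero[of X M M X i p] D by (simp add: zero_object_iff)
next
  note D = retractD[OF assms]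
  assume "zero_object C X"
  then show "retract_idem M X i p = Hzero C M M"
    using sandwich_zero[of M X X M p i] D
    by (simp add: zero_object_iff sandwich_def Comp_zero_right Comp_zero_left)
      (metis Comp_zero_left Comp_zero_right Ident_Comp)
qed

lemma corner_up_down:
  assumes r: "retract M X i p" and z: "z \<in> ring.corner (end_ring C M) (retract_idem M X i p)"
  shows "sandwich M X X M p i (sandwich X M M X i p z) = z"
proof -
  interpret ring "end_ring C M" using end_ring_is_ring retractD(1)[OF r] .
  show ?thesis using z sandwich_up_down[OF r r, of z] by (simp add: corner_def)
qed

lemma sandwich_in_corner:
  assumes r: "retract M X i p" and x: "x \<in> Hom C X X"
  shows "sandwich M X X M p i x \<in> ring.corner (end_ring C M) (retract_idem M X i p)"
proof -
  note D = retractD[OF r]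
  interpret ring "end_ring C M" using end_ring_is_ring D(1) .
  have up1: "sandwich M X X M p i (Ident C X) = retract_idem M X i p"
    using D by (simp add: sandwich_def Ident_Comp)
  have "Comp C M M M (sandwich M X X M p i (Ident C X)) (sandwich M X X M p i x) = sandwich M X X M p i x"
    "Comp C M M M (sandwich M X X M p i x) (sandwich M X X M p i (Ident C X)) = sandwich M X X M p i x"
    using D x sandwich_comp[OF r, of M X X M] by (simp_all add: Ident_closed Ident_Comp Comp_Ident)
  then show ?thesis using D x by (simp add: corner_def sandwich_closed up1)
qed

text \<open>Going down is multiplicative only on the corner: the factor \<open>i p\<close> that appears between \<open>z\<close> and \<open>y\<close> is
  absorbed by \<open>y\<close>.\<close>
lemma sandwich_down_mult:
  assumes r: "retract M X i p" and y: "y \<in> ring.corner (end_ring C M) (retract_idem M X i p)"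
    and z: "z \<in> Hom C M M"
  shows "sandwich X M M X i p (Comp C M M M z y) =
    Comp C X X X (sandwich X M M X i p z) (sandwich X M M X i p y)"
proof -
  note D = retractD[OF r]
  interpret ring "end_ring C M" using end_ring_is_ring D(1) .
  have yM: "y \<in> Hom C M M" and ey: "Comp C M M M (retract_idem M X i p) y = y"
    using y by (auto simp: corner_def)
  have "Comp C X X X (sandwich X M M X i p z) (sandwich X M M X i p y) =
     Comp C X M X p (Comp C X M M z (Comp C X M M (Comp C M M M (retract_idem M X i p) y) i))"
    using D yM z by (simp add: sandwich_def Comp_assoc Comp_closed)
  also have "\<dots> = sandwich X M M X i p (Comp C M M M z y)"
    unfolding ey using D yM z by (simp add: sandwich_def Comp_assoc Comp_closed)
  finally show ?thesis by simp
qed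

text \<open>The ring \<open>End(X)\<close> and the corner of \<open>i p\<close> in \<open>End(M)\<close> correspond under the sandwich maps, so that
  locality passes from the former to the latter.\<close>
lemma retract_idem_local:
  assumes r: "retract M X i p" and loc: "local_ring (end_ring C X)"
  shows "ring.local_idem (end_ring C M) (retract_idem M X i p)"
proof -
  note D = retractD[OF r]
  interpret R: ring "end_ring C M" using end_ring_is_ring D(1) .
  interpret S: ring "end_ring C X" using end_ring_is_ring D(2) .
  let ?e = "retract_idem M X i p" and ?down = "sandwich X M M X i p" and ?up = "sandwich M X X M p i"
  have down_closed: "?down z \<in> Hom C X X" if "z \<in> R.corner ?e" for z
    using that D R.corner_closed by (simp add: sandwich_closed)
  have down_unit: "?down z \<in> Units (end_ring C X)" if u: "R.corner_unit ?e z" for z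
  proof -
    obtain w where "w \<in> R.corner ?e" "Comp C M M M z w = ?e" "Comp C M M M w z = ?e" "z \<in> R.corner ?e"
      using u by (auto simp: R.corner_unit_def)
    then show ?thesis
      using down_closed sandwich_down_mult[OF r, of w z] sandwich_down_mult[OF r, of z w]
        R.corner_closed sandwich_retract_idem[OF r] by (auto simp: Units_def)
  qed
  have up_unit: "R.corner_unit ?e z" if z: "z \<in> R.corner ?e" "?down z \<in> Units (end_ring C X)" for z
  proof -
    obtain c where c: "c \<in> Hom C X X" "Comp C X X X c (?down z) = Ident C X"
        "Comp C X X X (?down z) c = Ident C X"
      using z(2) by (auto simp: Units_def)
    have "Comp C M M M (?up c) (?up (?down z)) = ?up (Ident C X)"
      "Comp C M M M (?up (?down z)) (?up c) = ?up (Ident C X)"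
      using sandwich_comp[OF r, of M X X M p "?down z" c i] sandwich_comp[OF r, of M X X M p c "?down z" i]
        D c down_closed[OF z(1)] by simp_all
    moreover have "?up (Ident C X) = ?e" using D by (simp add: sandwich_def Ident_Comp)
    ultimately show ?thesis
      using z(1) corner_up_down[OF r z(1)] sandwich_in_corner[OF r c(1)] by (auto simp: R.corner_unit_def)
  qed
  have "R.corner_unit ?e x \<or> R.corner_unit ?e y"
    if xy: "x \<in> R.corner ?e" "y \<in> R.corner ?e" "R.corner_unit ?e (Hplus C M M x y)" for x y
  proof -
    have "?down (Hplus C M M x y) = Hplus C X X (?down x) (?down y)"
      using D xy R.corner_closed by (simp add: sandwich_add)
    then have "?down x \<in> Units (end_ring C X) \<or> ?down y \<in> Units (end_ring C X)"
      using down_unit[OF xy(3)] loc down_closed xy(1,2) unfolding local_ring_def by fastforce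
    then show ?thesis using up_unit xy by blast
  qed
  moreover have "?e \<noteq> Hzero C M M"
    using loc retract_idem_zero_iff[OF r] by (auto simp: local_ring_def zero_object_iff)
  ultimately show ?thesis
    using retract_idem_closed[OF r] retract_idem_idem[OF r] by (simp add: R.local_idem_def)
qed

lemma idem_iso_isomorphic:
  assumes r: "retract M X i p" "retract M Y j q"
    and iso: "ring.idem_iso (end_ring C M) (retract_idem M X i p) (retract_idem M Y j q)"
  shows "isomorphic_objects C X Y"
proof -
  note D = retractD[OF r(1)] and E = retractD[OF r(2)]
  interpret ring "end_ring C M" using end_ring_is_ring D(1) .
  obtain u v where u: "u \<in> Hom C M M" and v: "v \<in> Hom C M M"
    and fu: "Comp C M M M (retract_idem M Y j q) u = u" and ev: "Comp C M M M (retract_idem M X i p) v = v"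
    and vu: "Comp C M M M v u = retract_idem M X i p" and uv: "Comp C M M M u v = retract_idem M Y j q"
    using iso by (auto simp: idem_iso_def)
  have "Comp C X Y X (sandwich Y M M X j p v) (sandwich X M M Y i q u) =
      Comp C X M X p (Comp C X M M v (Comp C X M M (Comp C M M M (retract_idem M Y j q) u) i))"
    using D E u v by (simp add: sandwich_def Comp_assoc Comp_closed)
  also have "\<dots> = sandwich X M M X i p (Comp C M M M v u)"
    unfolding fu using D E u v by (simp add: sandwich_def Comp_assoc Comp_closed)
  finally have 1: "Comp C X Y X (sandwich Y M M X j p v) (sandwich X M M Y i q u) = Ident C X"
    using sandwich_retract_idem[OF r(1)] vu by simp
  have "Comp C Y X Y (sandwich X M M Y i q u) (sandwich Y M M X j p v) =
      Comp C Y M Y q (Comp C Y M M u (Comp C Y M M (Comp C M M M (retract_idem M X i p) v) j))"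
    using D E u v by (simp add: sandwich_def Comp_assoc Comp_closed)
  also have "\<dots> = sandwich Y M M Y j q (Comp C M M M u v)"
    unfolding ev using D E u v by (simp add: sandwich_def Comp_assoc Comp_closed)
  finally have 2: "Comp C Y X Y (sandwich X M M Y i q u) (sandwich Y M M X j p v) = Ident C Y"
    using sandwich_retract_idem[OF r(2)] uv by simp
  show ?thesis
    unfolding isomorphic_objects_def
    using 1 2 D E u v sandwich_closed[of X M M Y i q u] sandwich_closed[of Y M M X j p v] by blast
qed

text \<open>Direct sum decompositions of \<open>M\<close> amount to decompositions of the identity of \<open>M\<close> into orthogonal split
  idempotents; this moves every question about decompositions into the ring \<open>End(M)\<close>.\<close>
lemma cat_direct_sum_iff_idems:
  "cat_direct_sum C M Xs \<longleftrightarrow> M \<in> Obj C \<and> (\<exists>\<iota> \<pi>. (\<forall>k<length Xs. retract M (Xs ! k) (\<iota> k) (\<pi> k)) \<and>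
     ring.orthogonal_idems (end_ring C M) {..<length Xs} (\<lambda>k. retract_idem M (Xs ! k) (\<iota> k) (\<pi> k)) \<and>
     (\<Oplus>\<^bsub>end_ring C M\<^esub>k\<in>{..<length Xs}. retract_idem M (Xs ! k) (\<iota> k) (\<pi> k)) = Ident C M)"
  (is "_ \<longleftrightarrow> _ \<and> (\<exists>\<iota> \<pi>. ?R \<iota> \<pi>)")
proof (cases "M \<in> Obj C")
  case M: True
  interpret ring "end_ring C M" using end_ring_is_ring M .
  show ?thesis
  proof
    assume "cat_direct_sum C M Xs"
    then obtain \<iota> \<pi> where Xs: "set Xs \<subseteq> Obj C"
      and h: "\<And>k. k < length Xs \<Longrightarrow> \<iota> k \<in> Hom C (Xs ! k) M \<and> \<pi> k \<in> Hom C M (Xs ! k)"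
      and d: "\<And>k l. k < length Xs \<Longrightarrow> l < length Xs \<Longrightarrow> Comp C (Xs ! l) M (Xs ! k) (\<pi> k) (\<iota> l) =
          (if k = l then Ident C (Xs ! k) else Hzero C (Xs ! l) (Xs ! k))"
      and s: "(\<Oplus>\<^bsub>end_ring C M\<^esub>k\<in>{..<length Xs}. retract_idem M (Xs ! k) (\<iota> k) (\<pi> k)) = Ident C M"
      unfolding cat_direct_sum_def by blast
    have ob: "Xs ! k \<in> Obj C" if "k < length Xs" for k using Xs that by auto
    have r: "retract M (Xs ! k) (\<iota> k) (\<pi> k)" if "k < length Xs" for k
      using that h ob d M by (simp add: retract_def)
    have z: "Comp C M M M (retract_idem M (Xs ! k) (\<iota> k) (\<pi> k)) (retract_idem M (Xs ! l) (\<iota> l) (\<pi> l)) = Hzero C M M"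
      if kl: "k < length Xs" "l < length Xs" "k \<noteq> l" for k l
    proof -
      have "Comp C M M M (retract_idem M (Xs ! k) (\<iota> k) (\<pi> k)) (retract_idem M (Xs ! l) (\<iota> l) (\<pi> l)) =
        Comp C M (Xs ! k) M (\<iota> k) (Comp C M (Xs ! l) (Xs ! k) (Comp C (Xs ! l) M (Xs ! k) (\<pi> k) (\<iota> l)) (\<pi> l))"
        using kl h ob M by (simp add: Comp_assoc Comp_closed)
      then show ?thesis using kl h ob M d by (simp add: Comp_zero_left Comp_zero_right)
    qed
    have "orthogonal_idems {..<length Xs} (\<lambda>k. retract_idem M (Xs ! k) (\<iota> k) (\<pi> k))"
      using r z retract_idem_closed retract_idem_idem by (auto simp: orthogonal_idems_def)
    then show "M \<in> Obj C \<and> (\<exists>\<iota> \<pi>. ?R \<iota> \<pi>)" using M r s by blast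
  next
    assume "M \<in> Obj C \<and> (\<exists>\<iota> \<pi>. ?R \<iota> \<pi>)"
    then obtain \<iota> \<pi> where r: "\<And>k. k < length Xs \<Longrightarrow> retract M (Xs ! k) (\<iota> k) (\<pi> k)"
      and o: "orthogonal_idems {..<length Xs} (\<lambda>k. retract_idem M (Xs ! k) (\<iota> k) (\<pi> k))"
      and s: "(\<Oplus>\<^bsub>end_ring C M\<^esub>k\<in>{..<length Xs}. retract_idem M (Xs ! k) (\<iota> k) (\<pi> k)) = Ident C M"
      by blast
    have z: "Comp C (Xs ! l) M (Xs ! k) (\<pi> k) (\<iota> l) = Hzero C (Xs ! l) (Xs ! k)"
      if kl: "k < length Xs" "l < length Xs" "k \<noteq> l" for k l
    proof -
      note D = retractD[OF r[OF kl(1)]] and E = retractD[OF r[OF kl(2)]]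
      have "Comp C M M M (retract_idem M (Xs ! k) (\<iota> k) (\<pi> k)) (retract_idem M (Xs ! l) (\<iota> l) (\<pi> l)) = Hzero C M M"
        using orthogonal_idemsD(3)[OF o] kl by simp
      then have "sandwich (Xs ! l) M M (Xs ! k) (\<iota> l) (\<pi> k)
          (sandwich M (Xs ! l) (Xs ! k) M (\<pi> l) (\<iota> k) (Comp C (Xs ! l) M (Xs ! k) (\<pi> k) (\<iota> l))) =
          sandwich (Xs ! l) M M (Xs ! k) (\<iota> l) (\<pi> k) (Hzero C M M)"
        using D(1-4) E(1-4) by (simp add: sandwich_def Comp_assoc Comp_closed)
      then show ?thesis
        using sandwich_down_up[OF r[OF kl(2)] r[OF kl(1)]] D E by (simp add: sandwich_zero Comp_closed)
    qed
    have ob: "set Xs \<subseteq> Obj C" using r retractD(2) by (metis in_set_conv_nth subsetI)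
    show "cat_direct_sum C M Xs"
      unfolding cat_direct_sum_def
      using M ob s z retractD[OF r] by (intro conjI exI[of _ \<iota>] exI[of _ \<pi>]) auto
  qed
qed (simp add: cat_direct_sum_def)

lemma finsum_lessThan_2:
  assumes "M \<in> Obj C" "x 0 \<in> Hom C M M" "x 1 \<in> Hom C M M"
  shows "(\<Oplus>\<^bsub>end_ring C M\<^esub>k\<in>{..<2}. x k) = Hplus C M M (x 0) (x (1::nat))"
proof -
  interpret ring "end_ring C M" using end_ring_is_ring assms(1) .
  have "{..<2} = {0, 1::nat}" by auto
  then show ?thesis using assms r_zero[of "x 1"] by simp
qed

text \<open>A decomposition into two summands gives the idempotent of the first one, which is \<open>0\<close> or \<open>1\<close>; in the
  latter case the second idempotent, being orthogonal to it, is \<open>0\<close>.\<close>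
lemma trivial_idems_indecomposable:
  assumes X: "X \<in> Obj C" and nz: "Ident C X \<noteq> Hzero C X X"
    and triv: "\<And>e. e \<in> Hom C X X \<Longrightarrow> Comp C X X X e e = e \<Longrightarrow> e = Hzero C X X \<or> e = Ident C X"
  shows "indecomposable_object C X"
  unfolding indecomposable_object_def
proof (intro conjI allI impI)
  show "X \<in> Obj C" "\<not> zero_object C X" using X nz by (auto simp: zero_object_iff)
  interpret ring "end_ring C X" using end_ring_is_ring X .
  fix A B assume "cat_direct_sum C X [A, B]"
  then obtain \<iota> \<pi> where r: "\<And>k. k < length [A, B] \<Longrightarrow> retract X ([A, B] ! k) (\<iota> k) (\<pi> k)"
    and o: "orthogonal_idems {..<length [A, B]} (\<lambda>k. retract_idem X ([A, B] ! k) (\<iota> k) (\<pi> k))"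
    unfolding cat_direct_sum_iff_idems by blast
  have rA: "retract X A (\<iota> 0) (\<pi> 0)" and rB: "retract X B (\<iota> 1) (\<pi> 1)" using r[of 0] r[of 1] by simp_all
  let ?a = "retract_idem X A (\<iota> 0) (\<pi> 0)" and ?b = "retract_idem X B (\<iota> 1) (\<pi> 1)"
  have ab: "Comp C X X X ?a ?b = Hzero C X X" using orthogonal_idemsD(3)[OF o, of 0 1] by simp
  have "?a = Hzero C X X \<or> ?a = Ident C X"
    using triv retract_idem_closed[OF rA] retract_idem_idem[OF rA] by blast
  moreover have "?b = Hzero C X X" if "?a = Ident C X"
    using ab that retract_idem_closed[OF rB] X by (simp add: Ident_Comp)
  ultimately show "zero_object C A \<or> zero_object C B"
    using retract_idem_zero_iff[OF rA] retract_idem_zero_iff[OF rB] by blast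
qed

end

locale idempotent_complete_category = preadditive_category +
  assumes split_idem: "\<lbrakk>M \<in> Obj C; e \<in> Hom C M M; Comp C M M M e e = e\<rbrakk>
    \<Longrightarrow> \<exists>X i p. retract M X i p \<and> Comp C M X M i p = e"
begin

text \<open>The zero endomorphism is an idempotent, and its image is a zero object.\<close>
lemma zero_object_exists:
  assumes "M \<in> Obj C" shows "\<exists>Z. zero_object C Z"
  using split_idem[OF assms Hzero_closed Comp_zero_left] assms Hzero_closed retract_idem_zero_iff by metis

text \<open>The converse of \<open>trivial_idems_indecomposable\<close>: splitting \<open>e\<close> and \<open>1 - e\<close> decomposes \<open>X\<close>, so one of the two
  vanishes.\<close>
lemma indecomposable_trivial_idems:
  assumes ind: "indecomposable_object C X" and e: "e \<in> Hom C X X" "Comp C X X X e e = e"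
  shows "e = Hzero C X X \<or> e = Ident C X"
proof -
  have X: "X \<in> Obj C" using ind by (simp add: indecomposable_object_def)
  interpret ring "end_ring C X" using end_ring_is_ring X .
  define f where "f = Ident C X \<ominus>\<^bsub>end_ring C X\<^esub> e"
  have e1: "e \<in> corner (Ident C X)" "e \<otimes>\<^bsub>end_ring C X\<^esub> e = e"
    using e X by (simp_all add: corner_def Ident_Comp Comp_Ident)
  have f: "f \<in> Hom C X X" "Comp C X X X f f = f" "Comp C X X X e f = Hzero C X X"
      "Comp C X X X f e = Hzero C X X" "Hplus C X X e f = Ident C X"
    using corner_complement[OF _ _ e1] X corner_closed[of f "Ident C X"]
    by (simp_all add: f_def Ident_closed Ident_Comp)
  obtain A i p where A: "retract X A i p" "retract_idem X A i p = e" using split_idem X e by blast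
  obtain B j q where B: "retract X B j q" "retract_idem X B j q = f" using split_idem X f by blast
  let ?\<iota> = "\<lambda>k::nat. if k = 0 then i else j" and ?\<pi> = "\<lambda>k::nat. if k = 0 then p else q"
  have "cat_direct_sum C X [A, B]"
    unfolding cat_direct_sum_iff_idems
  proof (rule conjI[OF X], rule exI[of _ ?\<iota>], rule exI[of _ ?\<pi>], intro conjI)
    have lt: "k = 0 \<or> k = 1" if "k < length [A, B]" for k using that by auto
    show "\<forall>k<length [A, B]. retract X ([A, B] ! k) (?\<iota> k) (?\<pi> k)"
      using A B lt by fastforce
    show "orthogonal_idems {..<length [A, B]} (\<lambda>k. retract_idem X ([A, B] ! k) (?\<iota> k) (?\<pi> k))"
      unfolding orthogonal_idems_def using A B e f lt by (auto simp: less_Suc_eq)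
    have "{..<length [A, B]} = {..<2}" by simp
    then show "(\<Oplus>\<^bsub>end_ring C X\<^esub>k\<in>{..<length [A, B]}. retract_idem X ([A, B] ! k) (?\<iota> k) (?\<pi> k)) = Ident C X"
      using A B e f X by (simp only: finsum_lessThan_2) (simp add: finsum_lessThan_2)
  qed
  then have "zero_object C A \<or> zero_object C B" using ind by (simp add: indecomposable_object_def)
  then have "e = Hzero C X X \<or> f = Hzero C X X"
    using retract_idem_zero_iff A B by metis
  then show ?thesis using f e X r_zero[of e] by auto
qed

text \<open>The summands come from splitting a decomposition of \<open>1\<close> into primitive idempotents of \<open>End(M)\<close>. A
  nontrivial idempotent of a summand would go up to a nontrivial idempotent below a primitive one.\<close>
lemma decomposition_into_indecomposables:
  assumes M: "M \<in> Obj C"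
    and bound: "\<And>E. finite E \<Longrightarrow> ring.orthogonal_idems (end_ring C M) E (\<lambda>e. e) \<Longrightarrow>
      Hzero C M M \<notin> E \<Longrightarrow> card E \<le> N"
  shows "\<exists>Xs. cat_direct_sum C M Xs \<and> (\<forall>X\<in>set Xs. indecomposable_object C X)"
proof -
  interpret ring "end_ring C M" using end_ring_is_ring M .
  obtain E where E: "finite E" "orthogonal_idems E (\<lambda>x. x)" "(\<Oplus>\<^bsub>end_ring C M\<^esub>x\<in>E. x) = Ident C M"
    and prim: "\<And>e. e \<in> E \<Longrightarrow> primitive_idem e"
    using primitive_decomposition[of N] bound by auto
  have EM: "e \<in> Hom C M M" "Comp C M M M e e = e" if "e \<in> E" for e
    using orthogonal_idemsD(1,2)[OF E(2) that] by simp_all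
  have "\<forall>e\<in>E. \<exists>X i p. retract M X i p \<and> retract_idem M X i p = e"
    using split_idem[OF M] EM by blast
  then obtain X i p where r: "\<And>e. e \<in> E \<Longrightarrow> retract M (X e) (i e) (p e)"
    and re: "\<And>e. e \<in> E \<Longrightarrow> retract_idem M (X e) (i e) (p e) = e" by metis
  have ind: "indecomposable_object C (X e)" if e: "e \<in> E" for e
  proof (rule trivial_idems_indecomposable)
    note D = retractD[OF r[OF e]]
    have enz: "e \<noteq> Hzero C M M" using prim[OF e] by (simp add: primitive_idem_def)
    show "X e \<in> Obj C" by (rule D)
    show "Ident C (X e) \<noteq> Hzero C (X e) (X e)"
      using enz retract_idem_zero_iff[OF r[OF e]] re[OF e] D by (auto simp: zero_object_iff)
    fix x assume x: "x \<in> Hom C (X e) (X e)" "Comp C (X e) (X e) (X e) x x = x"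
    let ?x = "sandwich M (X e) (X e) M (p e) (i e) x"
    have "?x \<in> corner e" using sandwich_in_corner[OF r[OF e] x(1)] re[OF e] by simp
    moreover have "Comp C M M M ?x ?x = ?x"
      using sandwich_comp[OF r[OF e], of M "X e" "X e" M "p e" x x "i e"] D x by simp
    ultimately have "?x = Hzero C M M \<or> ?x = e"
      using prim[OF e] by (simp add: primitive_idem_def)
    then show "x = Hzero C (X e) (X e) \<or> x = Ident C (X e)"
      using sandwich_down_up[OF r[OF e] r[OF e] x(1)] sandwich_retract_idem[OF r[OF e]] re[OF e]
        sandwich_zero[of "X e" M M "X e" "i e" "p e"] D by auto
  qed
  obtain es where es: "set es = E" "distinct es" using finite_distinct_list[OF E(1)] by blast
  have inE: "es ! k \<in> E" if "k < length es" for k using es that by auto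
  let ?f = "\<lambda>k. retract_idem M (map X es ! k) (i (es ! k)) (p (es ! k))"
  have f: "?f k = es ! k" if "k < length es" for k using re[OF inE[OF that]] that by simp
  have "cat_direct_sum C M (map X es)"
    unfolding cat_direct_sum_iff_idems
  proof (rule conjI[OF M], rule exI[of _ "\<lambda>k. i (es ! k)"], rule exI[of _ "\<lambda>k. p (es ! k)"], intro conjI)
    show "\<forall>k<length (map X es). retract M (map X es ! k) (i (es ! k)) (p (es ! k))"
      using r inE by simp
    show "orthogonal_idems {..<length (map X es)} ?f"
      using E(2) inE es(2) f unfolding orthogonal_idems_def by (auto simp: nth_eq_iff_index_eq)
    have "(\<Oplus>\<^bsub>end_ring C M\<^esub>k\<in>{..<length (map X es)}. ?f k) = (\<Oplus>\<^bsub>end_ring C M\<^esub>k\<in>{..<length es}. es ! k)"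
      using f inE EM(1) by (intro finsum_cong') auto
    also have "\<dots> = (\<Oplus>\<^bsub>end_ring C M\<^esub>x\<in>(!) es ` {..<length es}. x)"
      using inE EM(1) es(2) by (intro finsum_reindex[symmetric]) (auto simp: inj_on_def nth_eq_iff_index_eq)
    also have "(!) es ` {..<length es} = E" using es(1) by (force simp: in_set_conv_nth)
    finally show "(\<Oplus>\<^bsub>end_ring C M\<^esub>k\<in>{..<length (map X es)}. ?f k) = Ident C M" using E(3) by simp
  qed
  then show ?thesis using ind es(1) by (intro exI[of _ "map X es"]) auto
qed

end

text \<open>Both decompositions of \<open>M\<close> are decompositions of \<open>1\<close> into local idempotents of \<open>End(M)\<close>, so the
  ring-theoretic uniqueness theorem matches them up, and equivalent idempotents have isomorphic images.\<close>
theorem (in preadditive_category) decomposition_unique: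
  assumes Xs: "cat_direct_sum C M Xs" "\<And>X. X \<in> set Xs \<Longrightarrow> local_ring (end_ring C X)"
    and Ys: "cat_direct_sum C M Ys" "\<And>Y. Y \<in> set Ys \<Longrightarrow> local_ring (end_ring C Y)"
  shows "\<exists>\<sigma>. bij_betw \<sigma> {..<length Xs} {..<length Ys} \<and>
    (\<forall>i<length Xs. isomorphic_objects C (Xs ! i) (Ys ! \<sigma> i))"
proof -
  have M: "M \<in> Obj C" using Xs by (simp add: cat_direct_sum_def)
  interpret ring "end_ring C M" using end_ring_is_ring M .
  obtain \<iota> \<pi> where x: "\<And>k. k < length Xs \<Longrightarrow> retract M (Xs ! k) (\<iota> k) (\<pi> k)"
    "orthogonal_idems {..<length Xs} (\<lambda>k. retract_idem M (Xs ! k) (\<iota> k) (\<pi> k))"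
    "(\<Oplus>\<^bsub>end_ring C M\<^esub>k\<in>{..<length Xs}. retract_idem M (Xs ! k) (\<iota> k) (\<pi> k)) = Ident C M"
    using Xs(1) unfolding cat_direct_sum_iff_idems by blast
  obtain \<kappa> \<rho> where y: "\<And>k. k < length Ys \<Longrightarrow> retract M (Ys ! k) (\<kappa> k) (\<rho> k)"
    "orthogonal_idems {..<length Ys} (\<lambda>k. retract_idem M (Ys ! k) (\<kappa> k) (\<rho> k))"
    "(\<Oplus>\<^bsub>end_ring C M\<^esub>k\<in>{..<length Ys}. retract_idem M (Ys ! k) (\<kappa> k) (\<rho> k)) = Ident C M"
    using Ys(1) unfolding cat_direct_sum_iff_idems by blast
  have "\<exists>\<sigma>. bij_betw \<sigma> {..<length Xs} {..<length Ys} \<and> (\<forall>k\<in>{..<length Xs}.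
      idem_iso (retract_idem M (Xs ! k) (\<iota> k) (\<pi> k)) (retract_idem M (Ys ! \<sigma> k) (\<kappa> (\<sigma> k)) (\<rho> (\<sigma> k))))"
    by (rule local_idems_unique[OF _ _ x(2) y(2), of "Ident C M" "Ident C M"])
      (use x y Xs(2) Ys(2) retract_idem_local M in \<open>simp_all add: Ident_closed Ident_Comp Comp_Ident\<close>)
  then obtain \<sigma> where \<sigma>: "bij_betw \<sigma> {..<length Xs} {..<length Ys}"
    "\<And>k. k < length Xs \<Longrightarrow> idem_iso (retract_idem M (Xs ! k) (\<iota> k) (\<pi> k))
      (retract_idem M (Ys ! \<sigma> k) (\<kappa> (\<sigma> k)) (\<rho> (\<sigma> k)))" by blast
  have "isomorphic_objects C (Xs ! k) (Ys ! \<sigma> k)" if k: "k < length Xs" for k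
  proof -
    have "\<sigma> k < length Ys" using \<sigma>(1) k by (auto simp: bij_betw_def)
    then show ?thesis using idem_iso_isomorphic[OF x(1)[OF k] y(1) \<sigma>(2)[OF k]] by blast
  qed
  then show ?thesis using \<sigma>(1) by blast
qed

section \<open>Finite-dimensional subspaces and linear maps\<close>

context vectorspace
begin

lemma span_subset_subspace:
  assumes "subspace K W V" "S \<subseteq> W" shows "span S \<subseteq> W"
  using assms span_is_subset is_module by blast

text \<open>Containment in the span of a finite set is easier to establish for images, sums and subspaces than
  the existence of a finite generating set inside \<open>W\<close>. By the exchange lemma the two agree.\<close>
lemma fin_dim_subspace_iff:
  assumes W: "subspace K W V"
  shows "vectorspace.fin_dim K (vs W) \<longleftrightarrow> (\<exists>S. finite S \<and> S \<subseteq> carrier V \<and> W \<subseteq> span S)"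
proof -
  have Wc: "W \<subseteq> carrier V" using W by (simp add: subspace_def submodule_def)
  interpret W: vectorspace K "vs W" using subspace_is_vs[OF W] .
  note W_span = span_li_not_depend[OF _ is_module[OF W]]
  show ?thesis
  proof
    assume "W.fin_dim"
    then obtain S where "finite S" "S \<subseteq> W" "W.span S = W" by (auto simp: W.fin_dim_def)
    then show "\<exists>S. finite S \<and> S \<subseteq> carrier V \<and> W \<subseteq> span S"
      using W_span(1) Wc by (intro exI[of _ S]) auto
  next
    assume "\<exists>S. finite S \<and> S \<subseteq> carrier V \<and> W \<subseteq> span S"
    then obtain S where S: "finite S" "S \<subseteq> carrier V" "W \<subseteq> span S" by blast
    have small: "card B \<le> card S" if "finite B" "B \<subseteq> W" "lin_indpt B" for B
      using replacement[of B S] that S by force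
    have li: "finite A \<and> card A \<le> card S" if A: "A \<subseteq> W \<and> W.lin_indpt A" for A
    proof -
      have "card B \<le> card S" if B: "finite B" "B \<subseteq> A" for B
        using small[OF B(1)] A B W.subset_li_is_li[of A B] W_span(2)[of B] by auto
      then show ?thesis
        by (metis finite_if_finite_subsets_card_bdd order_refl)
    qed
    have "W.lin_indpt {}" by (auto simp: W.lin_dep_def)
    then obtain A where A: "finite A" "maximal A (\<lambda>S. S \<subseteq> W \<and> W.lin_indpt S)"
      using maximal_exists[of "\<lambda>A. A \<subseteq> W \<and> W.lin_indpt A" "card S" "{}"] li by auto
    then have "W.gen_set A" using W.max_li_is_gen[of A] by simp
    moreover have "A \<subseteq> W" using A by (simp add: maximal_def)
    ultimately show "W.fin_dim" using A(1) W.fin_dim_def by auto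
  qed
qed

lemma fin_dim_subspaceI:
  assumes "subspace K W V" "finite S" "S \<subseteq> carrier V" "W \<subseteq> span S"
  shows "vectorspace.fin_dim K (vs W)"
  using fin_dim_subspace_iff[OF assms(1)] assms(2-4) by blast

lemma subspace_dim_mono:
  assumes W: "subspace K W V" "vectorspace.fin_dim K (vs W)" and U: "subspace K U V" "U \<subseteq> W"
  shows "vectorspace.dim K (vs U) \<le> vectorspace.dim K (vs W)"
    and "vectorspace.dim K (vs U) = vectorspace.dim K (vs W) \<Longrightarrow> U = W"
proof -
  interpret W: vectorspace K "vs W" using subspace_is_vs[OF W(1)] .
  interpret U: vectorspace K "vs U" using subspace_is_vs[OF U(1)] .
  note W_span = span_li_not_depend[OF _ is_module[OF W(1)]]
  note U_span = span_li_not_depend[OF _ is_module[OF U(1)]]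
  have "U.fin_dim" using W U fin_dim_subspace_iff by (meson subset_trans)
  then obtain B where B: "finite B" "U.basis B" using U.finite_basis_exists by blast
  then have B': "B \<subseteq> U" "U.lin_indpt B" "U.span B = U" and dimU: "U.dim = card B"
    using U.dim_basis by (auto simp: U.basis_def)
  have BW: "B \<subseteq> W" using B' U by blast
  have li: "W.lin_indpt B" using B'(2) U_span(2)[OF B'(1)] W_span(2)[OF BW] by simp
  show "U.dim \<le> W.dim" using W.li_le_dim(2)[OF W(2) _ li] BW dimU by simp
  show "U = W" if "U.dim = W.dim"
  proof -
    have "W.basis B" using W.dim_li_is_basis[OF W(2) B(1) _ li] BW dimU that by simp
    then have "W.span B = W" by (simp add: W.basis_def)
    then show ?thesis using B'(3) U_span(1)[OF B'(1)] W_span(1)[OF BW] by simp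
  qed
qed

lemma lin_indpt_card_le_dim:
  assumes "subspace K W V" "vectorspace.fin_dim K (vs W)" "B \<subseteq> W" "lin_indpt B"
  shows "card B \<le> vectorspace.dim K (vs W)"
proof -
  interpret W: vectorspace K "vs W" using subspace_is_vs[OF assms(1)] .
  show ?thesis
    using W.li_le_dim(2)[OF assms(2), of B] assms(3,4) span_li_not_depend(2)[OF assms(3) is_module[OF assms(1)]]
    by simp
qed

lemma subspace_carrierD:
  assumes "subspace K W V"
  shows "W \<subseteq> carrier V" "\<zero>\<^bsub>V\<^esub> \<in> W" "\<And>v w. v \<in> W \<Longrightarrow> w \<in> W \<Longrightarrow> v \<oplus>\<^bsub>V\<^esub> w \<in> W"
    "\<And>c v. c \<in> carrier K \<Longrightarrow> v \<in> W \<Longrightarrow> c \<odot>\<^bsub>V\<^esub> v \<in> W"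
  using assms by (auto simp: subspace_def submodule_def)

lemma subspaceI:
  assumes "W \<subseteq> carrier V" "\<zero>\<^bsub>V\<^esub> \<in> W" "\<And>v w. v \<in> W \<Longrightarrow> w \<in> W \<Longrightarrow> v \<oplus>\<^bsub>V\<^esub> w \<in> W"
    "\<And>c v. c \<in> carrier K \<Longrightarrow> v \<in> W \<Longrightarrow> c \<odot>\<^bsub>V\<^esub> v \<in> W"
  shows "subspace K W V"
  unfolding subspace_def submodule_def
  using assms vectorspace_axioms module_axioms by auto

lemma subspace_minus:
  assumes "subspace K W V" "v \<in> W" "w \<in> W" shows "v \<ominus>\<^bsub>V\<^esub> w \<in> W"
proof -
  have "w \<in> carrier V" using assms subspace_carrierD(1) by blast
  then have "v \<ominus>\<^bsub>V\<^esub> w = v \<oplus>\<^bsub>V\<^esub> (\<ominus>\<^bsub>K\<^esub> \<one>\<^bsub>K\<^esub>) \<odot>\<^bsub>V\<^esub> w"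
    using smult_minus_1 by (simp add: a_minus_def)
  then show ?thesis using subspace_carrierD(3,4)[OF assms(1)] assms(2,3) by simp
qed

lemma linear_image_subspace:
  assumes W: "subspace K W V" and T: "T \<in> LinearCombinations.module_hom K (vs W) V"
  shows "subspace K (T ` W) V"
proof -
  interpret W: vectorspace K "vs W" using subspace_is_vs[OF W] .
  interpret T: mod_hom K "vs W" V T
    using T W.module_axioms module_axioms by (simp add: mod_hom_def mod_hom_axioms_def)
  have "T.im = T ` W" by (simp add: T.im_def)
  then show ?thesis using T.im_is_submodule vectorspace_axioms by (simp add: subspace_def)
qed

text \<open>Rank-nullity: the kernel of \<open>T\<close> on \<open>W\<close> has dimension \<open>0\<close>.\<close>
lemma linear_surj_imp_inj:
  assumes W: "subspace K W V" "vectorspace.fin_dim K (vs W)" and T: "T \<in> LinearCombinations.module_hom K (vs W) (vs W)"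
    and surj: "T ` W = W" and v: "v \<in> W" "T v = \<zero>\<^bsub>V\<^esub>"
  shows "v = \<zero>\<^bsub>V\<^esub>"
proof -
  interpret W: vectorspace K "vs W" using subspace_is_vs[OF W(1)] .
  interpret T: linear_map K "vs W" "vs W" T
    using T W.vectorspace_axioms W.module_axioms
    by (simp add: linear_map_def mod_hom_def mod_hom_axioms_def)
  have im: "T.im = W" by (simp add: T.im_def surj)
  have ker: "subspace K T.ker (vs W)" by (rule T.kerT_is_subspace)
  interpret Ke: vectorspace K "vs T.ker" using W.subspace_is_vs[OF ker] by simp
  have "vectorspace.dim K (vs T.im) + Ke.dim = W.dim" using T.rank_nullity[OF W(2)] by simp
  then have "Ke.dim = 0" using im by simp
  moreover have Kfd: "Ke.fin_dim"
    using W.fin_dim_subspace_iff[OF ker] W(2) W.fin_dim_def T.ker_def by auto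
  ultimately obtain B where "Ke.basis B" "card B = 0" "finite B"
    using Ke.finite_basis_exists Ke.dim_basis by metis
  then have "Ke.basis {}" by simp
  then have "T.ker = {\<zero>\<^bsub>V\<^esub>}" using Ke.span_empty by (simp add: Ke.basis_def)
  then show ?thesis using v by (auto simp: T.ker_def)
qed

text \<open>The images \<open>T\<^sup>n W\<close> decrease, and their dimensions cannot drop forever.\<close>
lemma linear_image_stabilises:
  assumes W: "subspace K W V" "vectorspace.fin_dim K (vs W)" and T: "T \<in> LinearCombinations.module_hom K (vs W) (vs W)"
  shows "\<exists>n. subspace K ((T ^^ n) ` W) V \<and> (T ^^ n) ` W \<subseteq> W \<and> T ` ((T ^^ n) ` W) = (T ^^ n) ` W"
proof -
  define U where "U n = (T ^^ n) ` W" for n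
  have TW: "T v \<in> W" if "v \<in> W" for v using T that by (auto simp: LinearCombinations.module_hom_def)
  have USuc: "U (Suc n) = T ` U n" for n by (simp add: U_def image_comp)
  have Wc: "W \<subseteq> carrier V" using subspace_carrierD(1)[OF W(1)] .
  have U: "subspace K (U n) V \<and> U n \<subseteq> W" for n
  proof (induction n)
    case 0 then show ?case using W by (simp add: U_def)
  next
    case (Suc n)
    then have "T \<in> LinearCombinations.module_hom K (vs (U n)) V"
      using T Wc by (auto simp: LinearCombinations.module_hom_def Pi_def subset_iff)
    then show ?case using linear_image_subspace Suc TW by (auto simp: USuc)
  qed
  have dec: "U (Suc n) \<subseteq> U n" for n
  proof (induction n)
    case 0 then show ?case using TW by (auto simp: U_def)
  next
    case (Suc n) then show ?case using USuc by (metis image_mono)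
  qed
  have fd: "vectorspace.fin_dim K (vs (U n))" for n
    using U W fin_dim_subspace_iff by (meson subset_trans)
  have "\<exists>n. vectorspace.dim K (vs (U (Suc n))) = vectorspace.dim K (vs (U n))"
  proof (rule ccontr)
    assume "\<not> ?thesis"
    then have less: "vectorspace.dim K (vs (U (Suc n))) < vectorspace.dim K (vs (U n))" for n
      using subspace_dim_mono(1)[OF _ fd _ dec] U by (meson le_neq_implies_less)
    have "vectorspace.dim K (vs (U n)) + n \<le> vectorspace.dim K (vs (U 0))" for n
    proof (induction n)
      case (Suc n) then show ?case using less[of n] by simp
    qed simp
    from this[of "Suc (vectorspace.dim K (vs (U 0)))"] show False by simp
  qed
  then obtain n where "vectorspace.dim K (vs (U (Suc n))) = vectorspace.dim K (vs (U n))" by blast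
  then have "U (Suc n) = U n" using subspace_dim_mono(2)[OF _ fd _ dec] U by blast
  then have "subspace K (U n) V \<and> U n \<subseteq> W \<and> T ` U n = U n" using U USuc by simp
  then show ?thesis unfolding U_def by blast
qed

text \<open>Linear maps are controlled on a span by their values on the spanning set: the preimage of \<open>N\<close> is a
  subspace that contains \<open>S\<close>.\<close>
lemma module_hom_span:
  assumes V': "vectorspace K V'" and T: "T \<in> LinearCombinations.module_hom K V V'" and S: "S \<subseteq> carrier V"
    and N: "subspace K N V'" "T ` S \<subseteq> N"
  shows "T ` span S \<subseteq> N"
proof -
  interpret V': vectorspace K V' by fact
  interpret T: mod_hom K V V' T
    using T V'.module_axioms module_axioms by (simp add: mod_hom_def mod_hom_axioms_def)
  have "subspace K {v \<in> carrier V. T v \<in> N} V"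
    by (rule subspaceI) (auto simp: V'.subspace_carrierD[OF N(1)])
  moreover have "S \<subseteq> {v \<in> carrier V. T v \<in> N}" using S N by auto
  ultimately show ?thesis using span_subset_subspace by blast
qed

end

section \<open>The category of modules over a subalgebra\<close>

abbreviation linear_subspace :: "'v set \<Rightarrow> (complex, 'v, 'r) module_scheme \<Rightarrow> bool" where
  "linear_subspace W V \<equiv> VectorSpace.subspace CC W V"

abbreviation linear_span :: "(complex, 'v, 'r) module_scheme \<Rightarrow> 'v set \<Rightarrow> 'v set" where
  "linear_span V S \<equiv> LinearCombinations.module.span CC V S"

abbreviation linear_maps ::
    "(complex, 'v, 'r) module_scheme \<Rightarrow> (complex, 'w, 's) module_scheme \<Rightarrow> ('v \<Rightarrow> 'w) set" where
  "linear_maps V W \<equiv> LinearCombinations.module_hom CC V W"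

lemma lie_module_hom_iff:
  "f \<in> lie_module_hom p M N \<longleftrightarrow> f \<in> extensional (carrier M) \<and> (\<forall>v\<in>carrier M. f v \<in> carrier N) \<and>
     (\<forall>v\<in>carrier M. \<forall>w\<in>carrier M. f (v \<oplus>\<^bsub>M\<^esub> w) = f v \<oplus>\<^bsub>N\<^esub> f w) \<and>
     (\<forall>c. \<forall>v\<in>carrier M. f (c \<odot>\<^bsub>M\<^esub> v) = c \<odot>\<^bsub>N\<^esub> f v) \<and>
     (\<forall>x\<in>p. \<forall>v\<in>carrier M. f (act M x v) = act N x (f v))"
  by (auto simp: lie_module_hom_def LinearCombinations.module_hom_def)

lemma lie_module_homD:
  assumes "f \<in> lie_module_hom p M N"
  shows "\<And>v. v \<in> carrier M \<Longrightarrow> f v \<in> carrier N"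
    "\<And>v w. v \<in> carrier M \<Longrightarrow> w \<in> carrier M \<Longrightarrow> f (v \<oplus>\<^bsub>M\<^esub> w) = f v \<oplus>\<^bsub>N\<^esub> f w"
    "\<And>c v. v \<in> carrier M \<Longrightarrow> f (c \<odot>\<^bsub>M\<^esub> v) = c \<odot>\<^bsub>N\<^esub> f v"
    "\<And>x v. x \<in> p \<Longrightarrow> v \<in> carrier M \<Longrightarrow> f (act M x v) = act N x (f v)"
    "f \<in> extensional (carrier M)"
    "f \<in> linear_maps M N"
  using assms by (auto simp: lie_module_hom_iff LinearCombinations.module_hom_def)

text \<open>The difference is expressed by operations that are inherited verbatim by a record with a smaller
  carrier, whereas the additive inverse is defined through the carrier.\<close>
lemma minus_as_smult:
  assumes "vectorspace CC M" "v \<in> carrier M" "w \<in> carrier M"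
  shows "v \<ominus>\<^bsub>M\<^esub> w = v \<oplus>\<^bsub>M\<^esub> (-1 :: complex) \<odot>\<^bsub>M\<^esub> w"
proof -
  interpret vectorspace CC M by fact
  have "(-1 :: complex) \<odot>\<^bsub>M\<^esub> w \<oplus>\<^bsub>M\<^esub> (1 :: complex) \<odot>\<^bsub>M\<^esub> w = (-1 + 1 :: complex) \<odot>\<^bsub>M\<^esub> w"
    using smult_l_distr[of "-1" 1 w] assms by simp
  then have "(-1 :: complex) \<odot>\<^bsub>M\<^esub> w \<oplus>\<^bsub>M\<^esub> w = \<zero>\<^bsub>M\<^esub>"
    using smult_one[of w] smult_l_null[of w] assms by simp
  then have "\<ominus>\<^bsub>M\<^esub> w = (-1 :: complex) \<odot>\<^bsub>M\<^esub> w"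
    using assms(3) by (intro M.minus_equality) simp_all
  then show ?thesis by (simp add: a_minus_def)
qed

locale lie_module =
  fixes G :: "'g lie_alg" and p :: "'g set" and M :: "('g, 'v) lie_mod" (structure)
  assumes lie_module: "is_lie_module G p M"
begin

sublocale vectorspace CC M
  using lie_module by (simp add: is_lie_module_def)

lemma act_rules:
  shows act_closed: "x \<in> p \<Longrightarrow> v \<in> carrier M \<Longrightarrow> act M x v \<in> carrier M"
    and act_plus_left: "x \<in> p \<Longrightarrow> y \<in> p \<Longrightarrow> v \<in> carrier M \<Longrightarrow> act M (x \<oplus>\<^bsub>G\<^esub> y) v = act M x v \<oplus> act M y v"
    and act_smult_left: "x \<in> p \<Longrightarrow> v \<in> carrier M \<Longrightarrow> act M (c \<odot>\<^bsub>G\<^esub> x) v = c \<odot> act M x v"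
    and act_plus_right: "x \<in> p \<Longrightarrow> v \<in> carrier M \<Longrightarrow> w \<in> carrier M \<Longrightarrow> act M x (v \<oplus> w) = act M x v \<oplus> act M x w"
    and act_smult_right: "x \<in> p \<Longrightarrow> v \<in> carrier M \<Longrightarrow> act M x (c \<odot> v) = c \<odot> act M x v"
    and act_bracket: "x \<in> p \<Longrightarrow> y \<in> p \<Longrightarrow> v \<in> carrier M \<Longrightarrow>
      act M (bracket G x y) v = act M x (act M y v) \<ominus> act M y (act M x v)"
  using lie_module unfolding is_lie_module_def by blast+

lemma smult_simps:
  shows smult_zero_right: "c \<odot> \<zero> = \<zero>"
    and smult_zero_left: "v \<in> carrier M \<Longrightarrow> (0 :: complex) \<odot> v = \<zero>"
    and smult_assoc: "v \<in> carrier M \<Longrightarrow> c \<odot> (d \<odot> v) = (c * d) \<odot> v"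
    and smult_add_left: "v \<in> carrier M \<Longrightarrow> (c + d) \<odot> v = c \<odot> v \<oplus> d \<odot> v"
    and smult_add_right: "v \<in> carrier M \<Longrightarrow> w \<in> carrier M \<Longrightarrow>
      c \<odot> (v \<oplus> w) = c \<odot> v \<oplus> c \<odot> w"
    and smult_1: "v \<in> carrier M \<Longrightarrow> (1 :: complex) \<odot> v = v"
  using smult_r_null[of c] smult_l_null[of v] smult_assoc1[of c d v] smult_l_distr[of c d v]
    smult_r_distr[of c v w] smult_one[of v] by simp_all

lemma smult_neg_plus:
  assumes "v \<in> carrier M" shows "(-1 :: complex) \<odot> v \<oplus> v = \<zero>"
  using smult_add_left[OF assms, of "-1" 1] smult_1[OF assms] smult_zero_left[OF assms] by simp

lemma smult_cancel_right:
  fixes c d :: complex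
  assumes v: "v \<in> carrier M" "v \<noteq> \<zero>" and eq: "c \<odot> v = d \<odot> v"
  shows "c = d"
proof (rule ccontr)
  assume "c \<noteq> d"
  have "(c - d) \<odot> v = (d - d) \<odot> v"
    using eq smult_add_left[OF v(1), of c "- d"] smult_add_left[OF v(1), of d "- d"] by simp
  then have "(1 / (c - d)) \<odot> ((c - d) \<odot> v) = \<zero>"
    using smult_zero_left[OF v(1)] smult_zero_right by simp
  then show False using \<open>c \<noteq> d\<close> v by (simp add: smult_assoc smult_1)
qed

lemma smult_eq_zero:
  fixes c :: complex
  assumes "v \<in> carrier M" "v \<noteq> \<zero>" "c \<odot> v = \<zero>"
  shows "c = 0"
  using smult_cancel_right[OF assms(1,2), of c 0] assms smult_zero_left by simp

lemma act_zero: "x \<in> p \<Longrightarrow> act M x \<zero> = \<zero>"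
  using act_smult_right[of x "\<zero>" 0] smult_zero_left act_closed by simp

lemma sum_swap:
  "a \<in> carrier M \<Longrightarrow> b \<in> carrier M \<Longrightarrow> c \<in> carrier M \<Longrightarrow> d \<in> carrier M \<Longrightarrow>
    (a \<oplus> b) \<oplus> (c \<oplus> d) = (a \<oplus> c) \<oplus> (b \<oplus> d)"
  by (simp add: M.a_ac)

end

lemma lie_hom_zero:
  assumes "lie_module G p M" "lie_module G p N" "f \<in> lie_module_hom p M N"
  shows "f \<zero>\<^bsub>M\<^esub> = \<zero>\<^bsub>N\<^esub>"
proof -
  interpret M: lie_module G p M by fact
  interpret N: lie_module G p N by fact
  have "f ((0 :: complex) \<odot>\<^bsub>M\<^esub> \<zero>\<^bsub>M\<^esub>) = (0 :: complex) \<odot>\<^bsub>N\<^esub> f \<zero>\<^bsub>M\<^esub>"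
    using lie_module_homD(3)[OF assms(3), of "\<zero>\<^bsub>M\<^esub>" 0] by simp
  then show ?thesis
    using M.smult_zero_left N.smult_zero_left lie_module_homD(1)[OF assms(3), of "\<zero>\<^bsub>M\<^esub>"] by simp
qed

lemma lie_hom_minus:
  assumes "lie_module G p M" "lie_module G p N" "f \<in> lie_module_hom p M N" "v \<in> carrier M" "w \<in> carrier M"
  shows "f (v \<ominus>\<^bsub>M\<^esub> w) = f v \<ominus>\<^bsub>N\<^esub> f w"
proof -
  interpret M: lie_module G p M by fact
  interpret N: lie_module G p N by fact
  note f = lie_module_homD[OF assms(3)]
  show ?thesis
    using assms(4,5) f by (simp add: minus_as_smult[OF M.vectorspace_axioms] minus_as_smult[OF N.vectorspace_axioms])
qed

lemma lie_hom_id: "lie_module G p M \<Longrightarrow> (\<lambda>v\<in>carrier M. v) \<in> lie_module_hom p M M"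
proof -
  assume "lie_module G p M"
  then interpret lie_module G p M .
  show ?thesis by (simp add: lie_module_hom_iff act_closed)
qed

lemma lie_hom_compose:
  assumes "lie_module G p X" "f \<in> lie_module_hom p X Y" "g \<in> lie_module_hom p Y Z"
  shows "compose (carrier X) g f \<in> lie_module_hom p X Z"
proof -
  interpret lie_module G p X by fact
  note f = lie_module_homD[OF assms(2)] and g = lie_module_homD[OF assms(3)]
  show ?thesis
    unfolding lie_module_hom_iff using f g act_closed by (simp add: compose_def)
qed

lemma lie_hom_plus:
  assumes "lie_module G p X" "lie_module G p Y" "f \<in> lie_module_hom p X Y" "g \<in> lie_module_hom p X Y"
  shows "(\<lambda>v\<in>carrier X. f v \<oplus>\<^bsub>Y\<^esub> g v) \<in> lie_module_hom p X Y"
proof -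
  interpret X: lie_module G p X by fact
  interpret Y: lie_module G p Y by fact
  note f = lie_module_homD[OF assms(3)] and g = lie_module_homD[OF assms(4)]
  show ?thesis
    unfolding lie_module_hom_iff using f g X.act_closed
    by (simp add: Y.sum_swap Y.smult_add_right Y.act_plus_right)
qed

lemma lie_hom_scale:
  assumes "lie_module G p X" "lie_module G p Y" "f \<in> lie_module_hom p X Y"
  shows "(\<lambda>v\<in>carrier X. (c :: complex) \<odot>\<^bsub>Y\<^esub> f v) \<in> lie_module_hom p X Y"
proof -
  interpret X: lie_module G p X by fact
  interpret Y: lie_module G p Y by fact
  note f = lie_module_homD[OF assms(3)]
  show ?thesis
    unfolding lie_module_hom_iff using f X.act_closed
    by (simp add: Y.smult_add_right Y.act_smult_right Y.smult_assoc mult.commute)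
qed

lemma lie_hom_zero_map:
  assumes "lie_module G p X" "lie_module G p Y"
  shows "(\<lambda>v\<in>carrier X. \<zero>\<^bsub>Y\<^esub>) \<in> lie_module_hom p X Y"
proof -
  interpret X: lie_module G p X by fact
  interpret Y: lie_module G p Y by fact
  show ?thesis
    unfolding lie_module_hom_iff using X.act_closed by (simp add: Y.smult_zero_right Y.act_zero)
qed

lemma lie_hom_comm_group:
  assumes X: "lie_module G p X" and Y: "lie_module G p Y"
  shows "comm_group \<lparr>carrier = lie_module_hom p X Y,
    monoid.mult = (\<lambda>f g. \<lambda>v\<in>carrier X. f v \<oplus>\<^bsub>Y\<^esub> g v), one = (\<lambda>v\<in>carrier X. \<zero>\<^bsub>Y\<^esub>)\<rparr>"
proof (rule comm_groupI; (unfold partial_object.simps monoid.simps)?)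
  interpret X: lie_module G p X by fact
  interpret Y: lie_module G p Y by fact
  show "(\<lambda>v\<in>carrier X. \<zero>\<^bsub>Y\<^esub>) \<in> lie_module_hom p X Y" using lie_hom_zero_map X Y .
  fix f assume f: "f \<in> lie_module_hom p X Y"
  note fD = lie_module_homD[OF f]
  show "(\<lambda>v\<in>carrier X. (\<lambda>v\<in>carrier X. \<zero>\<^bsub>Y\<^esub>) v \<oplus>\<^bsub>Y\<^esub> f v) = f"
    using fD(1) extensional_arb[OF fD(5)] by (auto simp: fun_eq_iff)
  have "(\<lambda>v\<in>carrier X. (\<lambda>v\<in>carrier X. (-1 :: complex) \<odot>\<^bsub>Y\<^esub> f v) v \<oplus>\<^bsub>Y\<^esub> f v) = (\<lambda>v\<in>carrier X. \<zero>\<^bsub>Y\<^esub>)"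
    using fD by (intro restrict_ext) (simp add: Y.smult_neg_plus)
  then show "\<exists>g\<in>lie_module_hom p X Y. (\<lambda>v\<in>carrier X. g v \<oplus>\<^bsub>Y\<^esub> f v) = (\<lambda>v\<in>carrier X. \<zero>\<^bsub>Y\<^esub>)"
    using lie_hom_scale[OF X Y f] by blast
  fix g assume g: "g \<in> lie_module_hom p X Y"
  note gD = lie_module_homD[OF g]
  show "(\<lambda>v\<in>carrier X. f v \<oplus>\<^bsub>Y\<^esub> g v) \<in> lie_module_hom p X Y" using lie_hom_plus X Y f g .
  show "(\<lambda>v\<in>carrier X. f v \<oplus>\<^bsub>Y\<^esub> g v) = (\<lambda>v\<in>carrier X. g v \<oplus>\<^bsub>Y\<^esub> f v)"
    using fD gD by (intro restrict_ext Y.M.a_comm) auto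
  fix k assume k: "k \<in> lie_module_hom p X Y"
  note kD = lie_module_homD[OF k]
  show "(\<lambda>v\<in>carrier X. (\<lambda>v\<in>carrier X. f v \<oplus>\<^bsub>Y\<^esub> g v) v \<oplus>\<^bsub>Y\<^esub> k v) =
      (\<lambda>v\<in>carrier X. f v \<oplus>\<^bsub>Y\<^esub> (\<lambda>v\<in>carrier X. g v \<oplus>\<^bsub>Y\<^esub> k v) v)"
    using fD gD kD by (intro restrict_ext) (simp add: Y.M.a_assoc)
qed

lemma lie_module_category_simps:
  "M \<in> Obj (lie_module_category G p) \<longleftrightarrow> lie_module G p M"
  "Hom (lie_module_category G p) = lie_module_hom p"
  "Comp (lie_module_category G p) = (\<lambda>X Y Z g f. compose (carrier X) g f)"
  "Ident (lie_module_category G p) = (\<lambda>X. \<lambda>v\<in>carrier X. v)"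
  "Hplus (lie_module_category G p) = (\<lambda>X Y f g. \<lambda>v\<in>carrier X. f v \<oplus>\<^bsub>Y\<^esub> g v)"
  "Hzero (lie_module_category G p) = (\<lambda>X Y. \<lambda>v\<in>carrier X. \<zero>\<^bsub>Y\<^esub>)"
  by (simp_all add: lie_module_category_def lie_module_def)

lemma lie_module_category_preadditive:
  "preadditive_category (lie_module_category G p :: (('g, 'v) lie_mod, 'v \<Rightarrow> 'v) preadd_cat)"
  unfolding preadditive_category_def lie_module_category_simps
proof (intro conjI allI impI)
  fix X :: "('g, 'v) lie_mod" assume "lie_module G p X"
  then show "(\<lambda>v\<in>carrier X. v) \<in> lie_module_hom p X X" by (rule lie_hom_id)
next
  fix X Y Z :: "('g, 'v) lie_mod" and f g
  assume "lie_module G p X" "f \<in> lie_module_hom p X Y" "g \<in> lie_module_hom p Y Z"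
  then show "compose (carrier X) g f \<in> lie_module_hom p X Z" by (rule lie_hom_compose)
next
  fix X Y :: "('g, 'v) lie_mod" and f assume "f \<in> lie_module_hom p X Y"
  note f = lie_module_homD[OF this]
  show "compose (carrier X) f (\<lambda>v\<in>carrier X. v) = f" "compose (carrier X) (\<lambda>v\<in>carrier Y. v) f = f"
    using f(1) extensional_arb[OF f(5)] by (auto simp: compose_def fun_eq_iff)
next
  fix W X Y Z :: "('g, 'v) lie_mod" and f g k
  assume f: "f \<in> lie_module_hom p W X"
  show "compose (carrier W) k (compose (carrier W) g f) = compose (carrier W) (compose (carrier X) k g) f"
    using lie_module_homD(1)[OF f] by (auto simp: compose_def fun_eq_iff)
next
  fix X Y :: "('g, 'v) lie_mod" assume "lie_module G p X" "lie_module G p Y"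
  then show "comm_group \<lparr>carrier = lie_module_hom p X Y,
    monoid.mult = (\<lambda>f g. \<lambda>v\<in>carrier X. f v \<oplus>\<^bsub>Y\<^esub> g v), one = (\<lambda>v\<in>carrier X. \<zero>\<^bsub>Y\<^esub>)\<rparr>"
    by (rule lie_hom_comm_group)
next
  fix X Y Z :: "('g, 'v) lie_mod" and f g g'
  assume f: "f \<in> lie_module_hom p X Y"
  show "compose (carrier X) (\<lambda>v\<in>carrier Y. g v \<oplus>\<^bsub>Z\<^esub> g' v) f =
    (\<lambda>v\<in>carrier X. compose (carrier X) g f v \<oplus>\<^bsub>Z\<^esub> compose (carrier X) g' f v)"
    using lie_module_homD(1)[OF f] by (auto simp: compose_def fun_eq_iff)
next
  fix X Y Z :: "('g, 'v) lie_mod" and f f' g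
  assume fg: "f \<in> lie_module_hom p X Y" "f' \<in> lie_module_hom p X Y" "g \<in> lie_module_hom p Y Z"
  show "compose (carrier X) g (\<lambda>v\<in>carrier X. f v \<oplus>\<^bsub>Y\<^esub> f' v) =
    (\<lambda>v\<in>carrier X. compose (carrier X) g f v \<oplus>\<^bsub>Z\<^esub> compose (carrier X) g f' v)"
    using lie_module_homD(1)[OF fg(1)] lie_module_homD(1)[OF fg(2)] lie_module_homD(2)[OF fg(3)]
    by (auto simp: compose_def fun_eq_iff)
qed

lemma full_subcategory_preadditive:
  assumes "preadditive_category C" shows "preadditive_category (full_subcategory C P)"
  using assms unfolding preadditive_category_def full_subcategory_def
  by (simp add: Ball_def)

lemma lie_module_isomorphism_Units:
  fixes X :: "('g, 'v) lie_mod"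
  assumes X: "lie_module G p X" and f: "f \<in> lie_module_hom p X X" and bij: "bij_betw f (carrier X) (carrier X)"
  shows "f \<in> Units (end_ring (lie_module_category G p) X)"
proof -
  interpret lie_module G p X by fact
  note D = lie_module_homD[OF f]
  define g where "g = (\<lambda>v\<in>carrier X. inv_into (carrier X) f v)"
  have g: "g v \<in> carrier X" "f (g v) = v" if "v \<in> carrier X" for v
    using that bij bij_betw_inv_into_right[OF bij] bij_betw_imp_surj_on[OF bij] inv_into_into[of v f "carrier X"]
    by (auto simp: g_def)
  have gf: "g (f v) = v" if "v \<in> carrier X" for v
    using that D(1) bij_betw_inv_into_left[OF bij] by (simp add: g_def)
  have gI: "g v = w" if "w \<in> carrier X" "f w = v" for v w
    using gf that by blast
  have "g \<in> lie_module_hom p X X"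
    unfolding lie_module_hom_iff
  proof (intro conjI ballI allI)
    show "g \<in> extensional (carrier X)" by (simp add: g_def)
    fix v assume v: "v \<in> carrier X"
    show "g v \<in> carrier X" using g v by blast
    show "g (c \<odot>\<^bsub>X\<^esub> v) = c \<odot>\<^bsub>X\<^esub> g v" for c using g v D by (intro gI) simp_all
    show "g (v \<oplus>\<^bsub>X\<^esub> w) = g v \<oplus>\<^bsub>X\<^esub> g w" if "w \<in> carrier X" for w using g v D that by (intro gI) simp_all
    show "g (act X x v) = act X x (g v)" if "x \<in> p" for x
      using g v D that act_closed by (intro gI) simp_all
  qed
  moreover have "compose (carrier X) g f = (\<lambda>v\<in>carrier X. v)" "compose (carrier X) f g = (\<lambda>v\<in>carrier X. v)"
    using g gf by (auto simp: compose_def)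
  ultimately show ?thesis
    using f unfolding Units_def by (auto simp: lie_module_category_simps)
qed

lemma submodule_is_lie_module:
  assumes M: "lie_module G p M" and W: "linear_subspace W M"
    and stable: "\<And>x v. x \<in> p \<Longrightarrow> v \<in> W \<Longrightarrow> act M x v \<in> W"
  shows "lie_module G p (M\<lparr>carrier := W\<rparr>)"
proof -
  interpret lie_module G p M by fact
  interpret W: vectorspace CC "M\<lparr>carrier := W\<rparr>" using subspace_is_vs[OF W] .
  have Wc: "v \<in> W \<Longrightarrow> v \<in> carrier M" for v using subspace_carrierD(1)[OF W] by blast
  have minus: "v \<ominus>\<^bsub>M\<lparr>carrier := W\<rparr>\<^esub> w = v \<ominus>\<^bsub>M\<^esub> w" if "v \<in> W" "w \<in> W" for v w
    using minus_as_smult[OF W.vectorspace_axioms, of v w] minus_as_smult[OF vectorspace_axioms, of v w] that Wc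
    by simp
  show ?thesis
    unfolding lie_module_def is_lie_module_def
    using W.vectorspace_axioms stable Wc
    by (simp add: act_rules minus)
qed

text \<open>The projection onto the first summand of a decomposition \<open>M = K \<oplus> I\<close> into submodules.\<close>
lemma projection_hom:
  assumes M: "lie_module G p M"
    and K: "linear_subspace K M" "\<And>x v. x \<in> p \<Longrightarrow> v \<in> K \<Longrightarrow> act M x v \<in> K"
    and I: "linear_subspace I M" "\<And>x v. x \<in> p \<Longrightarrow> v \<in> I \<Longrightarrow> act M x v \<in> I"
    and int: "K \<inter> I = {\<zero>\<^bsub>M\<^esub>}"
    and sum: "\<And>v. v \<in> carrier M \<Longrightarrow> \<exists>k\<in>K. \<exists>i\<in>I. v = k \<oplus>\<^bsub>M\<^esub> i"
  shows "\<exists>e\<in>lie_module_hom p M M. (\<forall>v\<in>carrier M. e v \<in> K) \<and> (\<forall>v\<in>K. e v = v) \<and> (\<forall>v\<in>I. e v = \<zero>\<^bsub>M\<^esub>)"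
proof -
  interpret lie_module G p M by fact
  note KD = subspace_carrierD[OF K(1)] and ID = subspace_carrierD[OF I(1)]
  have Kc: "v \<in> K \<Longrightarrow> v \<in> carrier M" and Ic: "v \<in> I \<Longrightarrow> v \<in> carrier M" for v using KD ID by auto
  have uniq: "k = k'" if "k \<oplus>\<^bsub>M\<^esub> i = k' \<oplus>\<^bsub>M\<^esub> i'" "k \<in> K" "k' \<in> K" "i \<in> I" "i' \<in> I" for k i k' i'
  proof -
    note c [simp] = Kc[OF that(2)] Kc[OF that(3)] Ic[OF that(4)] Ic[OF that(5)]
    have "(k \<ominus>\<^bsub>M\<^esub> k') \<oplus>\<^bsub>M\<^esub> i = \<ominus>\<^bsub>M\<^esub> k' \<oplus>\<^bsub>M\<^esub> (k \<oplus>\<^bsub>M\<^esub> i)"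
      by (simp add: M.minus_eq M.a_ac)
    also have "\<dots> = i'" unfolding that(1) by (simp add: M.r_neg1)
    finally have "((k \<ominus>\<^bsub>M\<^esub> k') \<oplus>\<^bsub>M\<^esub> i) \<ominus>\<^bsub>M\<^esub> i = i' \<ominus>\<^bsub>M\<^esub> i" by simp
    then have "k \<ominus>\<^bsub>M\<^esub> k' = i' \<ominus>\<^bsub>M\<^esub> i"
      by (simp add: M.minus_eq M.a_assoc M.r_neg)
    moreover have "k \<ominus>\<^bsub>M\<^esub> k' \<in> K" "i' \<ominus>\<^bsub>M\<^esub> i \<in> I"
      using subspace_minus K(1) I(1) that by blast+
    ultimately have "k \<ominus>\<^bsub>M\<^esub> k' \<in> K \<inter> I" by simp
    then have "k \<ominus>\<^bsub>M\<^esub> k' = \<zero>\<^bsub>M\<^esub>" using int by blast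
    moreover have "k = (k \<ominus>\<^bsub>M\<^esub> k') \<oplus>\<^bsub>M\<^esub> k'" by (simp add: M.minus_eq M.a_assoc M.l_neg)
    ultimately show ?thesis by simp
  qed
  define e where "e = (\<lambda>v\<in>carrier M. THE k. k \<in> K \<and> (\<exists>i\<in>I. v = k \<oplus>\<^bsub>M\<^esub> i))"
  have eI: "e (k \<oplus>\<^bsub>M\<^esub> i) = k" if "k \<in> K" "i \<in> I" for k i
  proof -
    have "(THE k'. k' \<in> K \<and> (\<exists>i'\<in>I. k \<oplus>\<^bsub>M\<^esub> i = k' \<oplus>\<^bsub>M\<^esub> i')) = k"
      by (rule the_equality) (use that uniq in blast)+
    then show ?thesis using that Kc Ic by (simp add: e_def)
  qed
  have "e \<in> lie_module_hom p M M"
    unfolding lie_module_hom_iff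
  proof (intro conjI ballI allI)
    show "e \<in> extensional (carrier M)" by (simp add: e_def)
    fix v assume "v \<in> carrier M"
    then obtain k i where v: "k \<in> K" "i \<in> I" "v = k \<oplus>\<^bsub>M\<^esub> i" using sum by blast
    note c = Kc[OF v(1)] Ic[OF v(2)]
    show "e v \<in> carrier M" using v eI c by simp
    have "c \<odot>\<^bsub>M\<^esub> v = c \<odot>\<^bsub>M\<^esub> k \<oplus>\<^bsub>M\<^esub> c \<odot>\<^bsub>M\<^esub> i" for c using v c smult_add_right by simp
    then show "e (c \<odot>\<^bsub>M\<^esub> v) = c \<odot>\<^bsub>M\<^esub> e v" for c using eI v KD ID by simp
    have "act M x v = act M x k \<oplus>\<^bsub>M\<^esub> act M x i" if "x \<in> p" for x using v c that act_plus_right by simp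
    then show "e (act M x v) = act M x (e v)" if "x \<in> p" for x using eI v K(2) I(2) that by simp
    fix w assume "w \<in> carrier M"
    then obtain k' i' where w: "k' \<in> K" "i' \<in> I" "w = k' \<oplus>\<^bsub>M\<^esub> i'" using sum by blast
    have "v \<oplus>\<^bsub>M\<^esub> w = (k \<oplus>\<^bsub>M\<^esub> k') \<oplus>\<^bsub>M\<^esub> (i \<oplus>\<^bsub>M\<^esub> i')"
      unfolding v(3) w(3) using c Kc[OF w(1)] Ic[OF w(2)] by (rule sum_swap)
    then show "e (v \<oplus>\<^bsub>M\<^esub> w) = e v \<oplus>\<^bsub>M\<^esub> e w" using eI v w KD ID by simp
  qed
  moreover have "e v \<in> K" if "v \<in> carrier M" for v
    using sum[OF that] eI by auto
  moreover have "e v = v" if "v \<in> K" for v using eI[OF that ID(2)] Kc[OF that] by simp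
  moreover have "e v = \<zero>\<^bsub>M\<^esub>" if "v \<in> I" for v using eI[OF KD(2) that] Ic[OF that] by simp
  ultimately show ?thesis by blast
qed

section \<open>Direct summands of objects and splitting of idempotents\<close>

lemma cat_Mp_simps [simp]:
  "Hom (cat_Mp G h n p) = lie_module_hom p"
  "Comp (cat_Mp G h n p) = (\<lambda>X Y Z g f. compose (carrier X) g f)"
  "Ident (cat_Mp G h n p) = (\<lambda>X. \<lambda>v\<in>carrier X. v)"
  "Hplus (cat_Mp G h n p) = (\<lambda>X Y f g. \<lambda>v\<in>carrier X. f v \<oplus>\<^bsub>Y\<^esub> g v)"
  "Hzero (cat_Mp G h n p) = (\<lambda>X Y. \<lambda>v\<in>carrier X. \<zero>\<^bsub>Y\<^esub>)"
  by (simp_all add: cat_Mp_def full_subcategory_def lie_module_category_simps)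

lemma cat_Mp_Obj:
  "M \<in> Obj (cat_Mp G h n p) \<longleftrightarrow> lie_module G p M \<and> weight_semisimple G h M \<and> locally_finite n M \<and>
     (\<forall>\<mu>\<in>dual_space G h. finite_dim_on M (weight_space h M \<mu>)) \<and> finite (maximal_weights G h n M)"
  by (simp add: cat_Mp_def full_subcategory_def lie_module_category_simps)

lemma cat_Mp_preadditive:
  "preadditive_category (cat_Mp G h n p :: (('g, 'v) lie_mod, 'v \<Rightarrow> 'v) preadd_cat)"
  unfolding cat_Mp_def by (intro full_subcategory_preadditive lie_module_category_preadditive)

context lie_module
begin

lemma weight_space_subspace:
  assumes "h \<subseteq> p" shows "linear_subspace (weight_space h M \<mu>) M"
proof (rule subspaceI)
  note [simp] = subsetD[OF assms]
  show "weight_space h M \<mu> \<subseteq> carrier M" by (auto simp: weight_space_def)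
  show "\<zero> \<in> weight_space h M \<mu>" by (simp add: weight_space_def act_zero smult_zero_right)
  show "v \<oplus> w \<in> weight_space h M \<mu>" if "v \<in> weight_space h M \<mu>" "w \<in> weight_space h M \<mu>" for v w
    using that by (simp add: weight_space_def act_plus_right smult_add_right)
  show "c \<odot> v \<in> weight_space h M \<mu>" if "v \<in> weight_space h M \<mu>" for c v
    using that by (simp add: weight_space_def act_smult_right smult_assoc mult.commute)
qed

lemma maximal_space_subspace:
  assumes "h \<subseteq> p" "n \<subseteq> p" shows "linear_subspace (maximal_space h n M \<mu>) M"
proof (rule subspaceI)
  note [simp] = subsetD[OF assms(2)]
  note W = subspace_carrierD[OF weight_space_subspace[OF assms(1)]]
  have Wc: "v \<in> weight_space h M \<mu> \<Longrightarrow> v \<in> carrier M" for v using W(1) by blast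
  show "maximal_space h n M \<mu> \<subseteq> carrier M" using W(1) by (auto simp: maximal_space_def)
  show "\<zero> \<in> maximal_space h n M \<mu>" using W by (simp add: maximal_space_def act_zero)
  show "v \<oplus> w \<in> maximal_space h n M \<mu>" if "v \<in> maximal_space h n M \<mu>" "w \<in> maximal_space h n M \<mu>" for v w
    using that W Wc by (simp add: maximal_space_def act_plus_right)
  show "c \<odot> v \<in> maximal_space h n M \<mu>" if "v \<in> maximal_space h n M \<mu>" for c v
    using that W Wc by (simp add: maximal_space_def act_smult_right smult_zero_right)
qed

lemma generated_submodule_props:
  assumes n: "n \<subseteq> p" and v: "v \<in> carrier M"
  shows "linear_subspace (generated_submodule n M v) M" "v \<in> generated_submodule n M v"
    "\<And>x w. x \<in> n \<Longrightarrow> w \<in> generated_submodule n M v \<Longrightarrow> act M x w \<in> generated_submodule n M v"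
    "\<And>W. linear_subspace W M \<Longrightarrow> v \<in> W \<Longrightarrow> (\<And>x w. x \<in> n \<Longrightarrow> w \<in> W \<Longrightarrow> act M x w \<in> W)
      \<Longrightarrow> generated_submodule n M v \<subseteq> W"
proof -
  let ?F = "{W. linear_subspace W M \<and> v \<in> W \<and> (\<forall>x\<in>n. \<forall>w\<in>W. act M x w \<in> W)}"
  have car: "carrier M \<in> ?F"
    using v n act_closed by (auto intro!: subspaceI)
  have sub: "linear_subspace W M" if "W \<in> ?F" for W using that by blast
  show "linear_subspace (generated_submodule n M v) M"
    unfolding generated_submodule_def
  proof (rule subspaceI)
    show "\<Inter>?F \<subseteq> carrier M" using car by blast
    show "\<zero> \<in> \<Inter>?F" using subspace_carrierD(2) by blast
    show "x \<oplus> y \<in> \<Inter>?F" if "x \<in> \<Inter>?F" "y \<in> \<Inter>?F" for x y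
      using that subspace_carrierD(3) by blast
    show "c \<odot> x \<in> \<Inter>?F" if "c \<in> carrier CC" "x \<in> \<Inter>?F" for c x
      using that subspace_carrierD(4) by blast
  qed
  show "v \<in> generated_submodule n M v"
    "\<And>x w. x \<in> n \<Longrightarrow> w \<in> generated_submodule n M v \<Longrightarrow> act M x w \<in> generated_submodule n M v"
    "\<And>W. linear_subspace W M \<Longrightarrow> v \<in> W \<Longrightarrow> (\<And>x w. x \<in> n \<Longrightarrow> w \<in> W \<Longrightarrow> act M x w \<in> W)
      \<Longrightarrow> generated_submodule n M v \<subseteq> W"
    unfolding generated_submodule_def by blast+
qed

end

lemma hom_weight_space:
  assumes "f \<in> lie_module_hom p M N" "h \<subseteq> p" "v \<in> weight_space h M \<mu>"
  shows "f v \<in> weight_space h N \<mu>"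
  using lie_module_homD[OF assms(1)] assms(2,3) by (auto simp: weight_space_def subset_iff) metis

lemma hom_maximal_space:
  assumes M: "lie_module G p M" and N: "lie_module G p N"
    and f: "f \<in> lie_module_hom p M N" "h \<subseteq> p" "n \<subseteq> p" "v \<in> maximal_space h n M \<mu>"
  shows "f v \<in> maximal_space h n N \<mu>"
proof -
  have "v \<in> carrier M" using f(4) by (simp add: maximal_space_def weight_space_def)
  then have "act N x (f v) = \<zero>\<^bsub>N\<^esub>" if "x \<in> n" for x
    using lie_module_homD(4)[OF f(1), of x v] f(3,4) that lie_hom_zero[OF M N f(1)]
    by (auto simp: maximal_space_def)
  then show ?thesis using hom_weight_space[OF f(1,2)] f(4) by (simp add: maximal_space_def)
qed

lemma maximal_weights_iff:
  assumes "lie_module G p M" "h \<subseteq> p" "n \<subseteq> p"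
  shows "\<mu> \<in> maximal_weights G h n M \<longleftrightarrow>
    \<mu> \<in> dual_space G h \<and> (\<exists>v\<in>maximal_space h n M \<mu>. v \<noteq> \<zero>\<^bsub>M\<^esub>)"
proof -
  interpret lie_module G p M by fact
  show ?thesis
    using subspace_carrierD(2)[OF maximal_space_subspace[OF assms(2,3), of \<mu>]]
    by (auto simp: maximal_weights_def)
qed

text \<open>The module \<open>D\<close> is a direct summand of \<open>X \<oplus> Y\<close>, but that sum itself is not formed. Two cases matter:
  the direct sum of \<open>X\<close> and \<open>Y\<close>, and the image of an idempotent of \<open>X\<close>, where \<open>j\<close> and \<open>p2\<close> are \<open>0\<close>.\<close>
locale lie_summand = X?: lie_module G p X + Y?: lie_module G p Y + D?: lie_module G p D
  for G :: "'g lie_alg" and p and X Y D :: "('g, 'v) lie_mod" +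
  fixes i p1 j p2
  assumes i: "i \<in> lie_module_hom p X D" and p1: "p1 \<in> lie_module_hom p D X"
    and j: "j \<in> lie_module_hom p Y D" and p2: "p2 \<in> lie_module_hom p D Y"
    and sum: "\<And>d. d \<in> carrier D \<Longrightarrow> i (p1 d) \<oplus>\<^bsub>D\<^esub> j (p2 d) = d"
begin

lemma fin_dim_summand:
  assumes U: "linear_subspace U X" "finite_dim_on X U"
    and V: "linear_subspace V Y" "finite_dim_on Y V"
    and W: "linear_subspace W D" "p1 ` W \<subseteq> U" "p2 ` W \<subseteq> V"
  shows "finite_dim_on D W"
proof -
  obtain S where S: "finite S" "S \<subseteq> carrier X" "U \<subseteq> linear_span X S"
    using X.fin_dim_subspace_iff[OF U(1)] U(2) by blast
  obtain T where T: "finite T" "T \<subseteq> carrier Y" "V \<subseteq> linear_span Y T"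
    using Y.fin_dim_subspace_iff[OF V(1)] V(2) by blast
  let ?R = "i ` S \<union> j ` T"
  have R: "finite ?R" "?R \<subseteq> carrier D"
    using S T lie_module_homD(1)[OF i] lie_module_homD(1)[OF j] by auto
  have sp: "linear_subspace (linear_span D ?R) D" using D.span_is_subspace R(2) by blast
  have in_span: "?R \<subseteq> linear_span D ?R" using D.module.in_own_span R(2) by blast
  have "i ` linear_span X S \<subseteq> linear_span D ?R"
    by (rule X.module_hom_span[OF D.vectorspace_axioms lie_module_homD(6)[OF i] S(2) sp]) (use in_span in blast)
  moreover have "j ` linear_span Y T \<subseteq> linear_span D ?R"
    by (rule Y.module_hom_span[OF D.vectorspace_axioms lie_module_homD(6)[OF j] T(2) sp]) (use in_span in blast)
  ultimately have parts: "i (p1 w) \<in> linear_span D ?R" "j (p2 w) \<in> linear_span D ?R" if "w \<in> W" for w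
    using that W S(3) T(3) by blast+
  have "w \<in> linear_span D ?R" if "w \<in> W" for w
    using D.subspace_carrierD(3)[OF sp parts[OF that]] sum that D.subspace_carrierD(1)[OF W(1)] by auto
  then show ?thesis using D.fin_dim_subspace_iff[OF W(1)] R by blast
qed

lemma preimage_subspace:
  assumes U: "linear_subspace U X" and V: "linear_subspace V Y"
  shows "linear_subspace {d \<in> carrier D. p1 d \<in> U \<and> p2 d \<in> V} D"
  using X.subspace_carrierD[OF U] Y.subspace_carrierD[OF V] lie_module_homD[OF p1] lie_module_homD[OF p2]
    lie_hom_zero[OF D.lie_module_axioms X.lie_module_axioms p1]
    lie_hom_zero[OF D.lie_module_axioms Y.lie_module_axioms p2]
  by (intro D.subspaceI) auto

text \<open>Each of the four conditions is inherited by direct summands. Homomorphisms preserve weight spaces and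
  vectors killed by \<open>n\<close>, and \<open>d = i (p1 d) + j (p2 d)\<close> writes an element of \<open>D\<close> in terms of its components in
  \<open>X\<close> and \<open>Y\<close>. So \<open>D\<close> is spanned by weight vectors, its weight spaces and the submodules \<open>U(n) d\<close> lie in
  sums of two finite-dimensional spaces, and a maximal vector of \<open>D\<close> has a nonzero, hence maximal,
  component.\<close>
lemma summand_in_Mp:
  assumes hp: "h \<subseteq> p" and np: "n \<subseteq> p"
    and X: "X \<in> Obj (cat_Mp G h n p)" and Y: "Y \<in> Obj (cat_Mp G h n p)"
  shows "D \<in> Obj (cat_Mp G h n p)"
  unfolding cat_Mp_Obj
proof (intro conjI ballI D.lie_module_axioms)
  note Xo = X[unfolded cat_Mp_Obj] and Yo = Y[unfolded cat_Mp_Obj]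
  have wX: "weight_space h X \<mu> \<subseteq> carrier X" and wY: "weight_space h Y \<mu> \<subseteq> carrier Y"
    and wD: "weight_space h D \<mu> \<subseteq> carrier D" for \<mu> by (auto simp: weight_space_def)
  let ?W = "\<lambda>Z. \<Union>\<mu>\<in>dual_space G h. weight_space h Z \<mu>"
  have WD: "?W D \<subseteq> carrier D" using wD by blast
  have sp: "linear_subspace (linear_span D (?W D)) D" using D.span_is_subspace WD by blast
  have in_span: "?W D \<subseteq> linear_span D (?W D)" using D.module.in_own_span WD by blast
  have "i ` linear_span X (?W X) \<subseteq> linear_span D (?W D)"
    by (rule X.module_hom_span[OF D.vectorspace_axioms lie_module_homD(6)[OF i] _ sp])
      (use wX in_span hom_weight_space[OF i hp] in blast)+
  then have iX: "i x \<in> linear_span D (?W D)" if "x \<in> carrier X" for x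
    using Xo that by (auto simp: weight_semisimple_def)
  have "j ` linear_span Y (?W Y) \<subseteq> linear_span D (?W D)"
    by (rule Y.module_hom_span[OF D.vectorspace_axioms lie_module_homD(6)[OF j] _ sp])
      (use wY in_span hom_weight_space[OF j hp] in blast)+
  then have jY: "j y \<in> linear_span D (?W D)" if "y \<in> carrier Y" for y
    using Yo that by (auto simp: weight_semisimple_def)
  have "d \<in> linear_span D (?W D)" if "d \<in> carrier D" for d
    using D.subspace_carrierD(3)[OF sp iX[OF lie_module_homD(1)[OF p1 that]]
        jY[OF lie_module_homD(1)[OF p2 that]]] unfolding sum[OF that] .
  then show "weight_semisimple G h D"
    using D.module.span_is_subset2[OF WD] unfolding weight_semisimple_def by blast
  show "finite_dim_on D (weight_space h D \<mu>)" if "\<mu> \<in> dual_space G h" for \<mu>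
    by (rule fin_dim_summand[OF X.weight_space_subspace[OF hp] _ Y.weight_space_subspace[OF hp] _
          D.weight_space_subspace[OF hp]])
      (use Xo Yo that hom_weight_space[OF p1 hp] hom_weight_space[OF p2 hp] in blast)+
  show "locally_finite n D"
    unfolding locally_finite_def
  proof
    fix d assume d: "d \<in> carrier D"
    note c = lie_module_homD(1)[OF p1 d] lie_module_homD(1)[OF p2 d]
    note gX = X.generated_submodule_props[OF np c(1)] and gY = Y.generated_submodule_props[OF np c(2)]
    note gD = D.generated_submodule_props[OF np d]
    \<comment> \<open>The elements whose components lie in \<open>U(n) (p1 d)\<close> and \<open>U(n) (p2 d)\<close> form an \<open>n\<close>-stable
      subspace.\<close>
    let ?P = "{d' \<in> carrier D. p1 d' \<in> generated_submodule n X (p1 d) \<and> p2 d' \<in> generated_submodule n Y (p2 d)}"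
    have "generated_submodule n D d \<subseteq> ?P"
      by (rule gD(4)[OF preimage_subspace[OF gX(1) gY(1)]])
        (use d gX(2,3) gY(2,3) D.act_closed subsetD[OF np] lie_module_homD(4)[OF p1] lie_module_homD(4)[OF p2] in auto)
    then show "finite_dim_on D (generated_submodule n D d)"
      using fin_dim_summand[OF gX(1) _ gY(1) _ gD(1)] Xo Yo c unfolding locally_finite_def by blast
  qed
  have "maximal_weights G h n D \<subseteq> maximal_weights G h n X \<union> maximal_weights G h n Y"
  proof
    fix \<mu> assume "\<mu> \<in> maximal_weights G h n D"
    then obtain v where v: "\<mu> \<in> dual_space G h" "v \<in> maximal_space h n D \<mu>" "v \<noteq> \<zero>\<^bsub>D\<^esub>"
      using maximal_weights_iff[OF D.lie_module_axioms hp np] by blast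
    have "v \<in> carrier D" using v by (simp add: maximal_space_def weight_space_def)
    then have "\<not> (p1 v = \<zero>\<^bsub>X\<^esub> \<and> p2 v = \<zero>\<^bsub>Y\<^esub>)"
      using v(3) sum[of v] lie_hom_zero[OF X.lie_module_axioms D.lie_module_axioms i]
        lie_hom_zero[OF Y.lie_module_axioms D.lie_module_axioms j] by auto
    then show "\<mu> \<in> maximal_weights G h n X \<union> maximal_weights G h n Y"
      using v hom_maximal_space[OF D.lie_module_axioms X.lie_module_axioms p1 hp np v(2)]
        hom_maximal_space[OF D.lie_module_axioms Y.lie_module_axioms p2 hp np v(2)]
        maximal_weights_iff[OF X.lie_module_axioms hp np] maximal_weights_iff[OF Y.lie_module_axioms hp np]
      by blast
  qed
  then show "finite (maximal_weights G h n D)" using Xo Yo finite_subset by blast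
qed

end

lemma hom_image_subspace:
  assumes "lie_module G p M" "f \<in> lie_module_hom p M M"
  shows "linear_subspace (f ` carrier M) M" "\<And>x v. x \<in> p \<Longrightarrow> v \<in> f ` carrier M \<Longrightarrow> act M x v \<in> f ` carrier M"
proof -
  interpret lie_module G p M by fact
  note f = lie_module_homD[OF assms(2)]
  show "linear_subspace (f ` carrier M) M"
    using f(1) f(2,3)[symmetric] lie_hom_zero[OF assms(1,1,2), symmetric]
    by (intro subspaceI) auto
  show "act M x v \<in> f ` carrier M" if "x \<in> p" "v \<in> f ` carrier M" for x v
    using that f(4)[symmetric] act_closed by auto
qed

lemma submodule_inclusion_hom:
  assumes M: "lie_module G p M" and W: "linear_subspace W M"
    and stable: "\<And>x v. x \<in> p \<Longrightarrow> v \<in> W \<Longrightarrow> act M x v \<in> W"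
  shows "(\<lambda>v\<in>W. v) \<in> lie_module_hom p (M\<lparr>carrier := W\<rparr>) M"
proof -
  interpret lie_module G p M by fact
  show ?thesis
    using subspace_carrierD[OF W] stable by (auto simp: lie_module_hom_iff)
qed

lemma idem_image_in_Mp:
  assumes hp: "h \<subseteq> p" and np: "n \<subseteq> p" and M: "M \<in> Obj (cat_Mp G h n p)"
    and e: "e \<in> lie_module_hom p M M" "compose (carrier M) e e = e"
  shows "M\<lparr>carrier := e ` carrier M\<rparr> \<in> Obj (cat_Mp G h n p)" (is "?N \<in> _")
    and "e \<in> lie_module_hom p M (M\<lparr>carrier := e ` carrier M\<rparr>)"
    and "(\<lambda>v\<in>e ` carrier M. v) \<in> lie_module_hom p (M\<lparr>carrier := e ` carrier M\<rparr>) M"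
    and "\<And>v. v \<in> carrier M \<Longrightarrow> e (e v) = e v"
proof -
  have "lie_module G p M" using M by (simp add: cat_Mp_Obj)
  then interpret lie_module G p M .
  note im = hom_image_subspace[OF lie_module_axioms e(1)]
  have N: "lie_module G p ?N" using submodule_is_lie_module[OF lie_module_axioms im] .
  interpret N: lie_module G p ?N by fact
  note eD = lie_module_homD[OF e(1)]
  show ee: "e (e v) = e v" if "v \<in> carrier M" for v
    using fun_cong[OF e(2), of v] that by (simp add: compose_def)
  show 1: "e \<in> lie_module_hom p M ?N"
    using eD by (simp add: lie_module_hom_iff)
  have imc: "v \<in> carrier M" if "v \<in> e ` carrier M" for v using that eD(1) by auto
  show 2: "(\<lambda>v\<in>e ` carrier M. v) \<in> lie_module_hom p ?N M"
    using submodule_inclusion_hom[OF lie_module_axioms im] .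
  interpret lie_summand G p M M ?N e "\<lambda>v\<in>e ` carrier M. v" "\<lambda>v\<in>carrier M. \<zero>\<^bsub>?N\<^esub>" "\<lambda>v\<in>carrier ?N. \<zero>\<^bsub>M\<^esub>"
  proof unfold_locales
    show "(\<lambda>v\<in>carrier M. \<zero>\<^bsub>?N\<^esub>) \<in> lie_module_hom p M ?N" using lie_hom_zero_map[OF lie_module_axioms N] .
    show "(\<lambda>v\<in>carrier ?N. \<zero>\<^bsub>M\<^esub>) \<in> lie_module_hom p ?N M" using lie_hom_zero_map[OF N lie_module_axioms] .
    fix d assume "d \<in> carrier ?N"
    then show "e ((\<lambda>v\<in>e ` carrier M. v) d) \<oplus>\<^bsub>?N\<^esub> (\<lambda>v\<in>carrier M. \<zero>\<^bsub>?N\<^esub>) ((\<lambda>v\<in>carrier ?N. \<zero>\<^bsub>M\<^esub>) d) = d"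
      using ee imc by auto
  qed (fact 1 2)+
  show "?N \<in> Obj (cat_Mp G h n p)" using summand_in_Mp[OF hp np M M] .
qed

lemma cat_Mp_idempotent_complete:
  assumes hp: "h \<subseteq> p" and np: "n \<subseteq> p"
  shows "idempotent_complete_category (cat_Mp G h n p :: (('g, 'v) lie_mod, 'v \<Rightarrow> 'v) preadd_cat)"
proof -
  interpret preadditive_category "cat_Mp G h n p :: (('g, 'v) lie_mod, 'v \<Rightarrow> 'v) preadd_cat"
    by (rule cat_Mp_preadditive)
  show ?thesis
  proof (unfold_locales, unfold cat_Mp_simps)
    fix M :: "('g, 'v) lie_mod" and e
    assume M: "M \<in> Obj (cat_Mp G h n p)" and e: "e \<in> lie_module_hom p M M" "compose (carrier M) e e = e"
    note N = idem_image_in_Mp[OF hp np M e]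
    let ?N = "M\<lparr>carrier := e ` carrier M\<rparr>" and ?i = "\<lambda>v\<in>e ` carrier M. v"
    have "retract M ?N ?i e"
      unfolding retract_def using M N lie_module_homD(1)[OF e(1)] by (auto simp: compose_def fun_eq_iff)
    moreover have "compose (carrier M) ?i e = e"
      using lie_module_homD(5)[OF e(1)] by (auto simp: compose_def fun_eq_iff extensional_def)
    ultimately show "\<exists>X i p. retract M X i p \<and> compose (carrier M) i p = e" by blast
  qed
qed

section \<open>Direct sums of objects\<close>

text \<open>The line through a nonzero vector is a copy of the complex numbers.\<close>
lemma nonzero_lie_module_infinite:
  assumes "lie_module G p M" "v \<in> carrier M" "v \<noteq> \<zero>\<^bsub>M\<^esub>"
  shows "infinite (carrier M)"
proof -
  interpret lie_module G p M by fact
  have "inj (\<lambda>c :: complex. c \<odot>\<^bsub>M\<^esub> v)"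
    using smult_cancel_right[OF assms(2,3)] by (rule injI)
  then have "infinite (range (\<lambda>c :: complex. c \<odot>\<^bsub>M\<^esub> v))"
    using finite_imageD infinite_UNIV_char_0 by blast
  moreover have "range (\<lambda>c :: complex. c \<odot>\<^bsub>M\<^esub> v) \<subseteq> carrier M" using assms(2) by auto
  ultimately show ?thesis using finite_subset by blast
qed

text \<open>All objects live on subsets of the fixed type \<open>'v\<close>, so a direct sum needs room for pairs there. If
  \<open>'v\<close> is infinite, it is equinumerous with its square; if \<open>'v\<close> is finite, all modules on it are zero.\<close>
lemma carrier_product_injection:
  fixes A B :: "('g, 'v) lie_mod"
  assumes A: "lie_module G p A" and B: "lie_module G p B"
  shows "\<exists>\<phi> :: 'v \<times> 'v \<Rightarrow> 'v. inj_on \<phi> (carrier A \<times> carrier B)"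
proof (cases "finite (UNIV :: 'v set)")
  case True
  then have "carrier A \<subseteq> {\<zero>\<^bsub>A\<^esub>}"
    using nonzero_lie_module_infinite[OF A] finite_subset[OF subset_UNIV] by blast
  then have "inj_on snd (carrier A \<times> carrier B)" by (auto simp: inj_on_def)
  then show ?thesis by blast
next
  case False
  then obtain \<phi> :: "'v \<times> 'v \<Rightarrow> 'v" where "bij_betw \<phi> (UNIV \<times> UNIV) UNIV"
    using card_of_Times_same_infinite card_of_ordIso by blast
  then show ?thesis using bij_betw_imp_inj_on inj_on_subset by (metis UNIV_Times_UNIV subset_UNIV)
qed

text \<open>The structure of \<open>A \<oplus> B\<close>, transported along an injection \<open>\<phi>\<close> of pairs into the type.\<close>
definition biproduct_module ::
    "('v \<times> 'v \<Rightarrow> 'v) \<Rightarrow> ('g, 'v) lie_mod \<Rightarrow> ('g, 'v) lie_mod \<Rightarrow> ('g, 'v) lie_mod" where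
  "biproduct_module \<phi> A B =
     (let \<psi> = inv_into (carrier A \<times> carrier B) \<phi> in
      \<lparr>carrier = \<phi> ` (carrier A \<times> carrier B), monoid.mult = (\<lambda>u v. u), one = \<phi> (\<zero>\<^bsub>A\<^esub>, \<zero>\<^bsub>B\<^esub>),
       zero = \<phi> (\<zero>\<^bsub>A\<^esub>, \<zero>\<^bsub>B\<^esub>),
       add = (\<lambda>u v. \<phi> (fst (\<psi> u) \<oplus>\<^bsub>A\<^esub> fst (\<psi> v), snd (\<psi> u) \<oplus>\<^bsub>B\<^esub> snd (\<psi> v))),
       smult = (\<lambda>c u. \<phi> (c \<odot>\<^bsub>A\<^esub> fst (\<psi> u), c \<odot>\<^bsub>B\<^esub> snd (\<psi> u))),
       act = (\<lambda>x u. \<phi> (act A x (fst (\<psi> u)), act B x (snd (\<psi> u))))\<rparr>)"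

lemma cat_direct_sum_biproduct_module:
  fixes A B :: "('g, 'v) lie_mod"
  assumes hp: "h \<subseteq> p" and np: "n \<subseteq> p"
    and A: "A \<in> Obj (cat_Mp G h n p)" and B: "B \<in> Obj (cat_Mp G h n p)"
    and inj: "inj_on \<phi> (carrier A \<times> carrier B)"
  shows "cat_direct_sum (cat_Mp G h n p) (biproduct_module \<phi> A B) [A, B]"
proof -
  have "lie_module G p A" "lie_module G p B" using A B by (simp_all add: cat_Mp_Obj)
  then interpret A: lie_module G p A + B: lie_module G p B .
  define D where "D = biproduct_module \<phi> A B"
  define \<psi> where "\<psi> = inv_into (carrier A \<times> carrier B) \<phi>"
  have \<psi>: "\<psi> (\<phi> (a, b)) = (a, b)" if "a \<in> carrier A" "b \<in> carrier B" for a b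
    using that inj by (simp add: \<psi>_def)
  have Dc: "carrier D = \<phi> ` (carrier A \<times> carrier B)" and D0: "\<zero>\<^bsub>D\<^esub> = \<phi> (\<zero>\<^bsub>A\<^esub>, \<zero>\<^bsub>B\<^esub>)"
    by (simp_all add: D_def biproduct_module_def Let_def)
  have DE: "(\<And>a b. a \<in> carrier A \<Longrightarrow> b \<in> carrier B \<Longrightarrow> P (\<phi> (a, b))) \<Longrightarrow> u \<in> carrier D \<Longrightarrow> P u" for P u
    by (auto simp: Dc)
  have inD: "\<phi> (a, b) \<in> carrier D" if "a \<in> carrier A" "b \<in> carrier B" for a b
    using that by (simp add: Dc)
  have add: "\<phi> (a, b) \<oplus>\<^bsub>D\<^esub> \<phi> (a', b') = \<phi> (a \<oplus>\<^bsub>A\<^esub> a', b \<oplus>\<^bsub>B\<^esub> b')"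
    if "a \<in> carrier A" "b \<in> carrier B" "a' \<in> carrier A" "b' \<in> carrier B" for a b a' b'
    using \<psi> that by (simp add: D_def biproduct_module_def Let_def flip: \<psi>_def)
  have smult: "c \<odot>\<^bsub>D\<^esub> \<phi> (a, b) = \<phi> (c \<odot>\<^bsub>A\<^esub> a, c \<odot>\<^bsub>B\<^esub> b)" if "a \<in> carrier A" "b \<in> carrier B" for a b c
    using \<psi> that by (simp add: D_def biproduct_module_def Let_def flip: \<psi>_def)
  have act: "act D x (\<phi> (a, b)) = \<phi> (act A x a, act B x b)" if "a \<in> carrier A" "b \<in> carrier B" for a b x
    using \<psi> that by (simp add: D_def biproduct_module_def Let_def flip: \<psi>_def)
  note ops = add smult act inD D0
  have group: "abelian_group D"
  proof (rule abelian_groupI)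
    show "\<zero>\<^bsub>D\<^esub> \<in> carrier D" by (simp add: ops)
    show "u \<oplus>\<^bsub>D\<^esub> v \<in> carrier D" if "u \<in> carrier D" "v \<in> carrier D" for u v
      using that by (auto simp: ops Dc)
    show "u \<oplus>\<^bsub>D\<^esub> v \<oplus>\<^bsub>D\<^esub> w = u \<oplus>\<^bsub>D\<^esub> (v \<oplus>\<^bsub>D\<^esub> w)"
      if "u \<in> carrier D" "v \<in> carrier D" "w \<in> carrier D" for u v w
      using that by (auto simp: ops Dc A.M.a_assoc B.M.a_assoc)
    show "u \<oplus>\<^bsub>D\<^esub> v = v \<oplus>\<^bsub>D\<^esub> u" if "u \<in> carrier D" "v \<in> carrier D" for u v
      using that by (auto simp: ops Dc A.M.a_comm B.M.a_comm)
    show "\<zero>\<^bsub>D\<^esub> \<oplus>\<^bsub>D\<^esub> u = u" if "u \<in> carrier D" for u using that by (auto simp: ops Dc)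
    fix u assume "u \<in> carrier D"
    then obtain a b where u: "a \<in> carrier A" "b \<in> carrier B" "u = \<phi> (a, b)" by (auto simp: Dc)
    then have "\<phi> (\<ominus>\<^bsub>A\<^esub> a, \<ominus>\<^bsub>B\<^esub> b) \<oplus>\<^bsub>D\<^esub> u = \<zero>\<^bsub>D\<^esub>" by (simp add: ops A.M.l_neg B.M.l_neg)
    then show "\<exists>v\<in>carrier D. v \<oplus>\<^bsub>D\<^esub> u = \<zero>\<^bsub>D\<^esub>" using u inD by blast
  qed
  have "module CC D"
    by (rule moduleI[OF Module.module.axioms(1)[OF A.module_axioms] group])
      (auto simp: ops Dc A.smult_simps B.smult_simps)
  then have vs: "vectorspace CC D" using A.vectorspace_axioms by (simp add: vectorspace_def)
  have D: "lie_module G p D"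
    unfolding lie_module_def is_lie_module_def
    using vs
    by (auto simp: minus_as_smult[OF vs] minus_as_smult[OF A.vectorspace_axioms]
        minus_as_smult[OF B.vectorspace_axioms] ops Dc A.act_rules B.act_rules)
  interpret D: lie_module G p D by fact
  define i j p1 p2 where "i = (\<lambda>a\<in>carrier A. \<phi> (a, \<zero>\<^bsub>B\<^esub>))" and "j = (\<lambda>b\<in>carrier B. \<phi> (\<zero>\<^bsub>A\<^esub>, b))"
    and "p1 = (\<lambda>u\<in>carrier D. fst (\<psi> u))" and "p2 = (\<lambda>u\<in>carrier D. snd (\<psi> u))"
  have p: "p1 (\<phi> (a, b)) = a" "p2 (\<phi> (a, b)) = b" if "a \<in> carrier A" "b \<in> carrier B" for a b
    using that \<psi> inD by (simp_all add: p1_def p2_def)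
  have homs: "i \<in> lie_module_hom p A D" "j \<in> lie_module_hom p B D"
    unfolding lie_module_hom_iff i_def j_def
    by (auto simp: ops A.act_closed B.act_closed A.act_zero B.act_zero A.smult_zero_right B.smult_zero_right)
  have "p1 \<in> extensional (carrier D)" "p2 \<in> extensional (carrier D)" by (simp_all add: p1_def p2_def)
  then have homs': "p1 \<in> lie_module_hom p D A" "p2 \<in> lie_module_hom p D B"
    unfolding lie_module_hom_iff by (auto simp: Dc ops p A.act_closed B.act_closed)
  interpret lie_summand G p A B D i p1 j p2
    by unfold_locales (fact homs homs', fact homs homs', fact homs homs', fact homs homs',
      auto simp: Dc i_def j_def p ops)
  have DO: "D \<in> Obj (cat_Mp G h n p)" using summand_in_Mp[OF hp np A B] .
  interpret C: preadditive_category "cat_Mp G h n p :: (('g, 'v) lie_mod, 'v \<Rightarrow> 'v) preadd_cat"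
    by (rule cat_Mp_preadditive)
  define \<iota> \<pi> where "\<iota> k = (if k = 0 then i else j)" and "\<pi> k = (if k = 0 then p1 else p2)" for k :: nat
  have lt: "k < length [A, B] \<longleftrightarrow> k = 0 \<or> k = 1" for k by auto
  have comps: "compose (carrier A) p1 i = (\<lambda>v\<in>carrier A. v)" "compose (carrier B) p2 j = (\<lambda>v\<in>carrier B. v)"
    "compose (carrier B) p1 j = (\<lambda>v\<in>carrier B. \<zero>\<^bsub>A\<^esub>)" "compose (carrier A) p2 i = (\<lambda>v\<in>carrier A. \<zero>\<^bsub>B\<^esub>)"
    by (auto simp: compose_def i_def j_def p fun_eq_iff)
  have ends: "compose (carrier D) i p1 \<in> lie_module_hom p D D" "compose (carrier D) j p2 \<in> lie_module_hom p D D"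
    using lie_hom_compose[OF D] homs homs' by blast+
  have "{..<length [A, B]} = {..<2::nat}" by simp
  then have "(\<Oplus>\<^bsub>end_ring (cat_Mp G h n p) D\<^esub>k\<in>{..<length [A, B]}. compose (carrier D) (\<iota> k) (\<pi> k)) =
      (\<lambda>v\<in>carrier D. compose (carrier D) i p1 v \<oplus>\<^bsub>D\<^esub> compose (carrier D) j p2 v)"
    using C.finsum_lessThan_2[OF DO, of "\<lambda>k. compose (carrier D) (\<iota> k) (\<pi> k)"] ends
    by (simp only:) (simp add: \<iota>_def \<pi>_def)
  also have "\<dots> = (\<lambda>v\<in>carrier D. v)" using sum by (auto simp: compose_def fun_eq_iff)
  finally have total: "(\<Oplus>\<^bsub>end_ring (cat_Mp G h n p) D\<^esub>k\<in>{..<length [A, B]}. compose (carrier D) (\<iota> k) (\<pi> k)) =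
      (\<lambda>v\<in>carrier D. v)" .
  show ?thesis
    unfolding cat_direct_sum_def cat_Mp_simps D_def[symmetric]
  proof (intro conjI, fact DO, use A B in simp, rule exI[of _ \<iota>], rule exI[of _ \<pi>], intro conjI)
    show "\<forall>k<length [A, B]. \<iota> k \<in> lie_module_hom p ([A, B] ! k) D \<and> \<pi> k \<in> lie_module_hom p D ([A, B] ! k)"
      unfolding lt using homs homs' by (auto simp: \<iota>_def \<pi>_def)
    show "\<forall>k<length [A, B]. \<forall>l<length [A, B]. compose (carrier ([A, B] ! l)) (\<pi> k) (\<iota> l) =
      (if k = l then (\<lambda>v\<in>carrier ([A, B] ! k). v) else (\<lambda>v\<in>carrier ([A, B] ! l). \<zero>\<^bsub>[A, B] ! k\<^esub>))"
      unfolding lt using comps by (auto simp: \<iota>_def \<pi>_def)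
    show "(\<Oplus>\<^bsub>end_ring (cat_Mp G h n p) D\<^esub>k\<in>{..<length [A, B]}. compose (carrier D) (\<iota> k) (\<pi> k)) =
      (\<lambda>v\<in>carrier D. v)" by (rule total)
  qed
qed

lemma cat_Mp_additive:
  fixes M :: "('g, 'v) lie_mod"
  assumes hp: "h \<subseteq> p" and np: "n \<subseteq> p" and M: "M \<in> Obj (cat_Mp G h n p)"
  shows "additive_category (cat_Mp G h n p :: (('g, 'v) lie_mod, 'v \<Rightarrow> 'v) preadd_cat)"
  unfolding additive_category_def
proof (intro conjI ballI)
  show "preadditive_category (cat_Mp G h n p :: (('g, 'v) lie_mod, 'v \<Rightarrow> 'v) preadd_cat)"
    by (rule cat_Mp_preadditive)
  interpret idempotent_complete_category "cat_Mp G h n p :: (('g, 'v) lie_mod, 'v \<Rightarrow> 'v) preadd_cat"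
    by (rule cat_Mp_idempotent_complete[OF hp np])
  show "\<exists>Z :: ('g, 'v) lie_mod. zero_object (cat_Mp G h n p) Z" using zero_object_exists[OF M] .
  fix A B :: "('g, 'v) lie_mod" assume AB: "A \<in> Obj (cat_Mp G h n p)" "B \<in> Obj (cat_Mp G h n p)"
  then obtain \<phi> :: "'v \<times> 'v \<Rightarrow> 'v" where "inj_on \<phi> (carrier A \<times> carrier B)"
    using carrier_product_injection[of G p A B] by (auto simp: cat_Mp_Obj)
  then show "\<exists>S. cat_direct_sum (cat_Mp G h n p) S [A, B]"
    using cat_direct_sum_biproduct_module[OF hp np AB] by blast
qed

section \<open>Fitting decomposition of endomorphisms\<close>

context lie_module
begin

text \<open>The two Fitting components of an endomorphism \<open>f\<close>: the vectors killed by a power of \<open>f\<close>, and those in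
  a finite-dimensional subspace on which \<open>f\<close> is surjective, hence bijective. The description of the
  second one by finite-dimensional subspaces makes sense without a projection to weight spaces, and an
  element of \<open>p\<close> carries such a subspace to another one.\<close>
definition nil_part :: "('v \<Rightarrow> 'v) \<Rightarrow> 'v set" where
  "nil_part f = {v \<in> carrier M. \<exists>k. (f ^^ k) v = \<zero>}"

definition unit_part :: "('v \<Rightarrow> 'v) \<Rightarrow> 'v set" where
  "unit_part f = {v. \<exists>W. linear_subspace W M \<and> finite_dim_on M W \<and> f ` W = W \<and> v \<in> W}"

context
  fixes f assumes f: "f \<in> lie_module_hom p M M"
begin

lemma hom_zero: "f \<zero> = \<zero>"
  using lie_hom_zero[OF lie_module_axioms lie_module_axioms f] .

lemma
  shows funpow_closed: "v \<in> carrier M \<Longrightarrow> (f ^^ k) v \<in> carrier M"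
    and funpow_plus: "v \<in> carrier M \<Longrightarrow> w \<in> carrier M \<Longrightarrow> (f ^^ k) (v \<oplus> w) = (f ^^ k) v \<oplus> (f ^^ k) w"
    and funpow_smult: "v \<in> carrier M \<Longrightarrow> (f ^^ k) (c \<odot> v) = c \<odot> (f ^^ k) v"
    and funpow_act: "x \<in> p \<Longrightarrow> v \<in> carrier M \<Longrightarrow> (f ^^ k) (act M x v) = act M x ((f ^^ k) v)"
    and funpow_zero: "(f ^^ k) \<zero> = \<zero>"
proof -
  note fD = lie_module_homD[OF f]
  show 1: "v \<in> carrier M \<Longrightarrow> (f ^^ k) v \<in> carrier M" for v k
    by (induction k) (use fD(1) in auto)
  show "v \<in> carrier M \<Longrightarrow> w \<in> carrier M \<Longrightarrow> (f ^^ k) (v \<oplus> w) = (f ^^ k) v \<oplus> (f ^^ k) w"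
    by (induction k) (use 1 fD(2) in auto)
  show "v \<in> carrier M \<Longrightarrow> (f ^^ k) (c \<odot> v) = c \<odot> (f ^^ k) v"
    by (induction k) (use 1 fD(3) in auto)
  show "x \<in> p \<Longrightarrow> v \<in> carrier M \<Longrightarrow> (f ^^ k) (act M x v) = act M x ((f ^^ k) v)"
    by (induction k) (use 1 fD(4) in auto)
  show "(f ^^ k) \<zero> = \<zero>" by (induction k) (use hom_zero in auto)
qed

lemma funpow_zero_mono: "(f ^^ k) v = \<zero> \<Longrightarrow> (f ^^ (j + k)) v = \<zero>"
  by (simp add: funpow_add funpow_zero)

lemma nil_part_subspace: "linear_subspace (nil_part f) M"
proof (rule subspaceI)
  show "nil_part f \<subseteq> carrier M" by (auto simp: nil_part_def)
  have "(f ^^ 0) \<zero> = \<zero>" by simp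
  then show "\<zero> \<in> nil_part f" unfolding nil_part_def by blast
  show "c \<odot> v \<in> nil_part f" if "v \<in> nil_part f" for c v
  proof -
    from that obtain k where v: "v \<in> carrier M" "(f ^^ k) v = \<zero>" by (auto simp: nil_part_def)
    then have "(f ^^ k) (c \<odot> v) = \<zero>" by (simp add: funpow_smult smult_zero_right)
    then show ?thesis using v unfolding nil_part_def by auto
  qed
  fix v w assume "v \<in> nil_part f" "w \<in> nil_part f"
  then obtain j k where v: "v \<in> carrier M" "(f ^^ j) v = \<zero>" and w: "w \<in> carrier M" "(f ^^ k) w = \<zero>"
    by (auto simp: nil_part_def)
  have "(f ^^ (j + k)) (v \<oplus> w) = \<zero>"
    using funpow_zero_mono[OF v(2), of k] funpow_zero_mono[OF w(2), of j] v w
    by (simp add: funpow_plus add.commute)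
  then show "v \<oplus> w \<in> nil_part f" using v w unfolding nil_part_def by blast
qed

lemma nil_part_stable:
  assumes "x \<in> p" "v \<in> nil_part f" shows "act M x v \<in> nil_part f"
proof -
  from assms(2) obtain k where v: "v \<in> carrier M" "(f ^^ k) v = \<zero>" by (auto simp: nil_part_def)
  then have "(f ^^ k) (act M x v) = \<zero>" using assms(1) by (simp add: funpow_act act_zero)
  then show ?thesis using v act_closed[OF assms(1)] unfolding nil_part_def by auto
qed

lemma unit_part_subspace: "linear_subspace (unit_part f) M"
proof (rule subspaceI)
  note fD = lie_module_homD[OF f]
  show "unit_part f \<subseteq> carrier M" using subspace_carrierD(1) by (auto simp: unit_part_def)
  have "linear_subspace {\<zero>} M"
    by (rule subspaceI) (simp_all add: smult_zero_right)
  moreover from this have "finite_dim_on M {\<zero>}"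
    using fin_dim_subspace_iff[of "{\<zero>}"] span_empty by blast
  ultimately show "\<zero> \<in> unit_part f" unfolding unit_part_def using hom_zero by auto
  show "c \<odot> v \<in> unit_part f" if "c \<in> carrier CC" "v \<in> unit_part f" for c v
    using that subspace_carrierD(4) unfolding unit_part_def by blast
  fix v w assume "v \<in> unit_part f" "w \<in> unit_part f"
  then obtain U W where U: "linear_subspace U M" "finite_dim_on M U" "f ` U = U" "v \<in> U"
    and W: "linear_subspace W M" "finite_dim_on M W" "f ` W = W" "w \<in> W"
    unfolding unit_part_def by blast
  note UD = subspace_carrierD[OF U(1)] and WD = subspace_carrierD[OF W(1)]
  have Uc: "u \<in> U \<Longrightarrow> u \<in> carrier M" and Wc: "u \<in> W \<Longrightarrow> u \<in> carrier M" for u using UD(1) WD(1) by auto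
  let ?S = "submodule_sum U W"
  have S: "linear_subspace ?S M" using sum_is_subspace[OF U(1) W(1)] .
  have SI: "u \<oplus> w \<in> ?S" if "u \<in> U" "w \<in> W" for u w
    using that by (auto simp: submodule_sum_def)
  have SE: thesis if "z \<in> ?S" "\<And>u w. u \<in> U \<Longrightarrow> w \<in> W \<Longrightarrow> z = u \<oplus> w \<Longrightarrow> thesis" for z thesis
    using that by (auto simp: submodule_sum_def)
  obtain A B where A: "finite A" "A \<subseteq> carrier M" "U \<subseteq> linear_span M A"
    and B: "finite B" "B \<subseteq> carrier M" "W \<subseteq> linear_span M B"
    using U W fin_dim_subspace_iff by meson
  have AB: "linear_subspace (linear_span M (A \<union> B)) M"
    by (rule span_is_subspace) (use A(2) B(2) in blast)
  have "U \<subseteq> linear_span M (A \<union> B)" "W \<subseteq> linear_span M (A \<union> B)"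
    using A(3) B(3) span_is_monotone[of A "A \<union> B"] span_is_monotone[of B "A \<union> B"] by blast+
  then have "?S \<subseteq> linear_span M (A \<union> B)"
    using vsum_is_minimal[OF U(1) W(1) AB] by blast
  then have fdS: "finite_dim_on M ?S"
    by (rule fin_dim_subspaceI[OF S, rotated -1]) (use A(1,2) B(1,2) in blast)+
  have fS: "f ` ?S \<subseteq> ?S"
  proof (rule image_subsetI)
    fix z assume "z \<in> ?S"
    then obtain u w where uw: "u \<in> U" "w \<in> W" "z = u \<oplus> w" by (rule SE)
    have "f z = f u \<oplus> f w" using uw Uc Wc fD(2) by simp
    moreover have "f u \<in> U" "f w \<in> W" using U(3) W(3) uw by blast+
    ultimately show "f z \<in> ?S" using SI by simp
  qed
  have Sf: "?S \<subseteq> f ` ?S"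
  proof
    fix z assume "z \<in> ?S"
    then obtain u w where uw: "u \<in> U" "w \<in> W" "z = u \<oplus> w" by (rule SE)
    obtain u' where u': "u' \<in> U" "u = f u'" using U(3) uw(1) by blast
    obtain w' where w': "w' \<in> W" "w = f w'" using W(3) uw(2) by blast
    have "z = f (u' \<oplus> w')" using uw u' w' fD(2) Uc Wc by simp
    then show "z \<in> f ` ?S" using SI[OF u'(1) w'(1)] by (rule image_eqI)
  qed
  have "f ` ?S = ?S" using fS Sf by (rule equalityI)
  then show "v \<oplus> w \<in> unit_part f" using S fdS SI[OF U(4) W(4)] unfolding unit_part_def by blast
qed

lemma unit_part_stable:
  assumes x: "x \<in> p" and v: "v \<in> unit_part f" shows "act M x v \<in> unit_part f"
proof -
  obtain W where W: "linear_subspace W M" "finite_dim_on M W" "f ` W = W" "v \<in> W"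
    using v unfolding unit_part_def by blast
  note WD = subspace_carrierD[OF W(1)]
  have Wc: "u \<in> W \<Longrightarrow> u \<in> carrier M" for u using WD(1) by auto
  let ?T = "act M x"
  have T: "?T \<in> linear_maps M M"
    using x by (auto simp: LinearCombinations.module_hom_def act_closed act_plus_right act_smult_right)
  have TW: "?T \<in> linear_maps (M\<lparr>carrier := W\<rparr>) M"
    using x Wc by (auto simp: LinearCombinations.module_hom_def act_closed act_plus_right act_smult_right)
  have S: "linear_subspace (?T ` W) M" using linear_image_subspace[OF W(1) TW] .
  obtain A where A: "finite A" "A \<subseteq> carrier M" "W \<subseteq> linear_span M A"
    using W fin_dim_subspace_iff by meson
  have TA: "?T ` A \<subseteq> carrier M" using A x act_closed by auto
  have "?T ` linear_span M A \<subseteq> linear_span M (?T ` A)"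
    by (rule module_hom_span[OF vectorspace_axioms T A(2) span_is_subspace[OF TA] module.in_own_span[OF TA]])
  then have "?T ` W \<subseteq> linear_span M (?T ` A)" using A(3) by blast
  then have fd: "finite_dim_on M (?T ` W)"
    by (rule fin_dim_subspaceI[OF S, rotated -1]) (use A(1) TA in blast)+
  have "f ` ?T ` W = (\<lambda>w. ?T (f w)) ` W"
    unfolding image_image using lie_module_homD(4)[OF f x] Wc by (intro image_cong) auto
  also have "\<dots> = ?T ` f ` W" by (simp add: image_image)
  finally have "f ` ?T ` W = ?T ` W" using W(3) by simp
  then show ?thesis using S fd W(4) unfolding unit_part_def by blast
qed

lemma restricted_hom:
  assumes "linear_subspace W M" "f ` W \<subseteq> W"
  shows "f \<in> linear_maps (M\<lparr>carrier := W\<rparr>) (M\<lparr>carrier := W\<rparr>)"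
  using assms(2) subspace_carrierD(1)[OF assms(1)] lie_module_homD[OF f]
  by (auto simp: LinearCombinations.module_hom_def subset_iff)

text \<open>On a finite-dimensional \<open>W\<close> with \<open>f W = W\<close> the map \<open>f\<close> is injective, so no power of it kills a nonzero
  vector of \<open>W\<close>.\<close>
lemma nil_unit_disjoint: "nil_part f \<inter> unit_part f = {\<zero>}"
proof
  show "{\<zero>} \<subseteq> nil_part f \<inter> unit_part f"
    using subspace_carrierD(2) nil_part_subspace unit_part_subspace by blast
  show "nil_part f \<inter> unit_part f \<subseteq> {\<zero>}"
  proof
    fix v assume "v \<in> nil_part f \<inter> unit_part f"
    then obtain k W where k: "(f ^^ k) v = \<zero>"
      and W: "linear_subspace W M" "finite_dim_on M W" "f ` W = W" and v: "v \<in> W"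
      unfolding nil_part_def unit_part_def by blast
    have "v = \<zero>" using k v
    proof (induction k arbitrary: v)
      case (Suc k)
      have "f v \<in> W" using W(3) Suc.prems(2) by blast
      moreover have "(f ^^ k) (f v) = \<zero>" using Suc.prems(1) by (simp add: funpow_swap1)
      ultimately have "f v = \<zero>" using Suc.IH by blast
      then show ?case
        using linear_surj_imp_inj[OF W(1,2) restricted_hom[OF W(1)] W(3) Suc.prems(2)] W(3) by blast
    qed simp
    then show "v \<in> {\<zero>}" by simp
  qed
qed

text \<open>It suffices to decompose a weight vector \<open>w\<close>. Its weight space is finite-dimensional and stable under
  \<open>f\<close>, so the images of the powers stabilise at some \<open>U = f\<^sup>m W\<close> with \<open>f U = U\<close>. Then \<open>f\<^sup>m w = f\<^sup>m u\<close> for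
  some \<open>u\<close> in \<open>U\<close>, and \<open>w = (w - u) + u\<close> is the required decomposition.\<close>
lemma fitting_sum:
  assumes hp: "h \<subseteq> p" and ss: "weight_semisimple G h M"
    and fd: "\<And>\<mu>. \<mu> \<in> dual_space G h \<Longrightarrow> finite_dim_on M (weight_space h M \<mu>)"
    and v: "v \<in> carrier M"
  shows "\<exists>k\<in>nil_part f. \<exists>i\<in>unit_part f. v = k \<oplus> i"
proof -
  let ?S = "submodule_sum (nil_part f) (unit_part f)"
  have S: "linear_subspace ?S M" using sum_is_subspace[OF nil_part_subspace unit_part_subspace] .
  have SI: "u \<oplus> w \<in> ?S" if "u \<in> nil_part f" "w \<in> unit_part f" for u w
    using that by (auto simp: submodule_sum_def)
  have "w \<in> ?S" if \<mu>: "\<mu> \<in> dual_space G h" and w: "w \<in> weight_space h M \<mu>" for w \<mu>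
  proof -
    let ?W = "weight_space h M \<mu>"
    have W: "linear_subspace ?W M" using weight_space_subspace[OF hp] .
    have "f ` ?W \<subseteq> ?W" using hom_weight_space[OF f hp] by blast
    from linear_image_stabilises[OF W fd[OF \<mu>] restricted_hom[OF W this]]
    obtain m where m: "linear_subspace ((f ^^ m) ` ?W) M" "(f ^^ m) ` ?W \<subseteq> ?W"
        "f ` ((f ^^ m) ` ?W) = (f ^^ m) ` ?W" by blast
    let ?U = "(f ^^ m) ` ?W"
    have "finite_dim_on M ?U"
      using fin_dim_subspace_iff[OF m(1)] fin_dim_subspace_iff[OF W] fd[OF \<mu>] m(2) by (meson subset_trans)
    then have Uu: "?U \<subseteq> unit_part f" using m unfolding unit_part_def by blast
    have iter: "(f ^^ k) ` ?U = ?U" for k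
    proof (induction k)
      case (Suc k)
      have "(f ^^ Suc k) ` ?U = f ` (f ^^ k) ` ?U" by (simp add: image_comp)
      then show ?case using Suc m(3) by simp
    qed simp
    have wc: "w \<in> carrier M" using w by (simp add: weight_space_def)
    have "(f ^^ m) w \<in> (f ^^ m) ` ?U" using iter[of m] w by blast
    then obtain u where u: "u \<in> ?U" "(f ^^ m) w = (f ^^ m) u" by blast
    have uc: "u \<in> carrier M" using u(1) subspace_carrierD(1)[OF m(1)] by blast
    have "(f ^^ m) (w \<ominus> u) = \<zero>"
      using uc wc u(2) funpow_closed[OF uc, of m] smult_neg_plus[of "(f ^^ m) u"]
      by (simp add: minus_as_smult[OF vectorspace_axioms] funpow_plus funpow_smult M.a_comm)
    then have "w \<ominus> u \<in> nil_part f" using wc uc unfolding nil_part_def by blast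
    then have "(w \<ominus> u) \<oplus> u \<in> ?S" using SI u(1) Uu by blast
    moreover have "(w \<ominus> u) \<oplus> u = w" using wc uc by (simp add: M.minus_eq M.a_assoc M.l_neg)
    ultimately show ?thesis by simp
  qed
  then have "linear_span M (\<Union>\<mu>\<in>dual_space G h. weight_space h M \<mu>) \<subseteq> ?S"
    by (intro span_subset_subspace[OF S]) blast
  then have "v \<in> ?S" using v ss unfolding weight_semisimple_def by blast
  then show ?thesis by (auto simp: submodule_sum_def)
qed

end

text \<open>The projection onto the nilpotent component is an idempotent endomorphism, hence \<open>0\<close> or the identity.
  In the first case \<open>M\<close> is the unit component and \<open>f\<close> is bijective.\<close>
lemma fitting_dichotomy:
  assumes hp: "h \<subseteq> p" and ss: "weight_semisimple G h M"
    and fd: "\<And>\<mu>. \<mu> \<in> dual_space G h \<Longrightarrow> finite_dim_on M (weight_space h M \<mu>)"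
    and triv: "\<And>e. e \<in> lie_module_hom p M M \<Longrightarrow> compose (carrier M) e e = e \<Longrightarrow>
      e = (\<lambda>v\<in>carrier M. \<zero>) \<or> e = (\<lambda>v\<in>carrier M. v)"
    and f: "f \<in> lie_module_hom p M M"
  shows "bij_betw f (carrier M) (carrier M) \<or> nil_part f = carrier M"
proof -
  note fD = lie_module_homD[OF f]
  have KM: "nil_part f \<subseteq> carrier M" by (auto simp: nil_part_def)
  have sum: "\<exists>k\<in>nil_part f. \<exists>i\<in>unit_part f. v = k \<oplus> i" if "v \<in> carrier M" for v
    by (rule fitting_sum[OF f hp ss _ that]) (rule fd)
  obtain e where e: "e \<in> lie_module_hom p M M" "\<And>v. v \<in> carrier M \<Longrightarrow> e v \<in> nil_part f"
      "\<And>v. v \<in> nil_part f \<Longrightarrow> e v = v" "\<And>v. v \<in> unit_part f \<Longrightarrow> e v = \<zero>"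
    using projection_hom[OF lie_module_axioms nil_part_subspace[OF f] nil_part_stable[OF f]
        unit_part_subspace[OF f] unit_part_stable[OF f] nil_unit_disjoint[OF f] sum] by blast
  have "compose (carrier M) e e = e"
    using e lie_module_homD(5)[OF e(1)] by (auto simp: compose_def fun_eq_iff extensional_def)
  then consider "e = (\<lambda>v\<in>carrier M. \<zero>)" | "e = (\<lambda>v\<in>carrier M. v)" using triv e(1) by blast
  then show ?thesis
  proof cases
    case 1
    then have K0: "v = \<zero>" if "v \<in> nil_part f" for v using e(3)[OF that] that KM by auto
    have IM: "v \<in> unit_part f" if v: "v \<in> carrier M" for v
    proof -
      obtain k i where ki: "k \<in> nil_part f" "i \<in> unit_part f" "v = k \<oplus> i" using sum[OF v] by blast
      then have "i \<in> carrier M" using subspace_carrierD(1)[OF unit_part_subspace[OF f]] by blast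
      then have "v = i" using ki(3) K0[OF ki(1)] by simp
      then show ?thesis using ki(2) by simp
    qed
    have "inj_on f (carrier M)"
    proof (rule inj_onI)
      fix v w assume vw: "v \<in> carrier M" "w \<in> carrier M" "f v = f w"
      have "(f ^^ 1) (v \<ominus> w) = \<zero>"
        using lie_hom_minus[OF lie_module_axioms lie_module_axioms f vw(1,2)] vw fD(1)
        by (simp add: M.minus_eq M.r_neg)
      then have "v \<ominus> w \<in> nil_part f" using vw unfolding nil_part_def by blast
      then have "v \<ominus> w = \<zero>" using K0 by blast
      moreover have "v = (v \<ominus> w) \<oplus> w" using vw by (simp add: M.minus_eq M.a_assoc M.l_neg)
      ultimately show "v = w" using vw by simp
    qed
    moreover have "carrier M \<subseteq> f ` carrier M"
    proof
      fix v assume "v \<in> carrier M"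
      then obtain W where "linear_subspace W M" "f ` W = W" "v \<in> W"
        using IM unfolding unit_part_def by blast
      then show "v \<in> f ` carrier M" using subspace_carrierD(1) by blast
    qed
    ultimately show ?thesis using fD(1) by (auto simp: bij_betw_def)
  next
    case 2
    then show ?thesis using e(2) KM by auto
  qed
qed

text \<open>Here \<open>g\<close> is \<open>1 - f\<close>. If \<open>f\<close> is locally nilpotent, the last nonzero vector \<open>w\<close> in a sequence
  \<open>v, f v, f\<^sup>2 v, \<dots>\<close> satisfies \<open>f w = 0\<close>, so \<open>g w = w\<close>; then \<open>g\<close> is not locally nilpotent, and the dichotomy
  makes it bijective.\<close>
lemma fitting_local:
  assumes hp: "h \<subseteq> p" and ss: "weight_semisimple G h M"
    and fd: "\<And>\<mu>. \<mu> \<in> dual_space G h \<Longrightarrow> finite_dim_on M (weight_space h M \<mu>)"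
    and triv: "\<And>e. e \<in> lie_module_hom p M M \<Longrightarrow> compose (carrier M) e e = e \<Longrightarrow>
      e = (\<lambda>v\<in>carrier M. \<zero>) \<or> e = (\<lambda>v\<in>carrier M. v)"
    and nz: "v \<in> carrier M" "v \<noteq> \<zero>"
    and f: "f \<in> lie_module_hom p M M" and g: "g \<in> lie_module_hom p M M"
    and fg: "\<And>v. v \<in> carrier M \<Longrightarrow> g v \<oplus> f v = v"
  shows "bij_betw f (carrier M) (carrier M) \<or> bij_betw g (carrier M) (carrier M)"
proof (rule ccontr)
  assume neg: "\<not> ?thesis"
  have dich: "bij_betw k (carrier M) (carrier M) \<or> nil_part k = carrier M" if "k \<in> lie_module_hom p M M" for k
    using fitting_dichotomy[OF hp ss fd triv that] by blast
  have "nil_part f = carrier M" "nil_part g = carrier M" using dich f g neg by blast+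
  define k where "k = (LEAST k. (f ^^ k) v = \<zero>)"
  have "\<exists>k. (f ^^ k) v = \<zero>" using nz(1) \<open>nil_part f = carrier M\<close> by (auto simp: nil_part_def)
  then have k: "(f ^^ k) v = \<zero>" unfolding k_def by (rule LeastI_ex)
  obtain m where m: "k = Suc m" using k nz(2) by (cases k) auto
  define w where "w = (f ^^ m) v"
  have w: "w \<in> carrier M" "w \<noteq> \<zero>" "f w = \<zero>"
    using funpow_closed[OF f nz(1)] not_less_Least[of m "\<lambda>k. (f ^^ k) v = \<zero>"] k m
    by (auto simp: w_def k_def)
  have "g w = w" using fg[OF w(1)] w lie_module_homD(1)[OF g w(1)] by simp
  then have iter: "(g ^^ j) w = w" for j by (induction j) auto
  have "w \<in> nil_part g" using w(1) \<open>nil_part g = carrier M\<close> by simp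
  then obtain j where "(g ^^ j) w = \<zero>" unfolding nil_part_def by blast
  then show False using iter w(2) by simp
qed

end

text \<open>An indecomposable object has no nontrivial idempotent endomorphisms, so Fitting's argument applies
  to it; a bijective endomorphism is a unit because its inverse map is again a homomorphism.\<close>
lemma cat_Mp_local_end_ring:
  fixes X :: "('g, 'v) lie_mod"
  assumes hp: "h \<subseteq> p" and np: "n \<subseteq> p" and X: "indecomposable_object (cat_Mp G h n p) X"
  shows "local_ring (end_ring (cat_Mp G h n p) X)"
proof -
  let ?C = "cat_Mp G h n p :: (('g, 'v) lie_mod, 'v \<Rightarrow> 'v) preadd_cat"
  interpret idempotent_complete_category ?C by (rule cat_Mp_idempotent_complete[OF hp np])
  have XO: "X \<in> Obj ?C" and nz: "\<not> zero_object ?C X" using X by (auto simp: indecomposable_object_def)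
  then have "lie_module G p X" by (simp add: cat_Mp_Obj)
  then interpret X: lie_module G p X .
  interpret R: ring "end_ring ?C X" using end_ring_is_ring[OF XO] .
  note Xo = XO[unfolded cat_Mp_Obj]
  have nid: "Ident ?C X \<noteq> Hzero ?C X X" using nz XO by (simp add: zero_object_iff)
  then obtain v where v: "v \<in> carrier X" "v \<noteq> \<zero>\<^bsub>X\<^esub>" by (auto simp: fun_eq_iff split: if_splits)
  have triv: "e = (\<lambda>v\<in>carrier X. \<zero>\<^bsub>X\<^esub>) \<or> e = (\<lambda>v\<in>carrier X. v)"
    if "e \<in> lie_module_hom p X X" "compose (carrier X) e e = e" for e
    using indecomposable_trivial_idems[OF X, of e] that by simp
  have units: "k \<in> Units (end_ring ?C X)" if "k \<in> lie_module_hom p X X" "bij_betw k (carrier X) (carrier X)" for k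
    using lie_module_isomorphism_Units[OF X.lie_module_axioms that]
    by (simp add: Units_def lie_module_category_simps)
  show ?thesis
  proof (rule local_ringI[OF R.ring_axioms])
    show "\<one>\<^bsub>end_ring ?C X\<^esub> \<noteq> \<zero>\<^bsub>end_ring ?C X\<^esub>" using nid by simp
    fix f assume "f \<in> carrier (end_ring ?C X)"
    then have f: "f \<in> lie_module_hom p X X" by simp
    define g where "g = \<one>\<^bsub>end_ring ?C X\<^esub> \<ominus>\<^bsub>end_ring ?C X\<^esub> f"
    have g: "g \<in> lie_module_hom p X X"
      using R.minus_closed[OF R.one_closed, of f] f by (simp add: g_def)
    have eq: "g \<oplus>\<^bsub>end_ring ?C X\<^esub> f = \<one>\<^bsub>end_ring ?C X\<^esub>"
      using R.minus_plus_cancel[OF R.one_closed, of f] f by (simp add: g_def)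
    have gf: "g w \<oplus>\<^bsub>X\<^esub> f w = w" if "w \<in> carrier X" for w
      using that fun_cong[OF eq, of w] by simp
    have "bij_betw f (carrier X) (carrier X) \<or> bij_betw g (carrier X) (carrier X)"
      by (rule X.fitting_local[OF hp _ _ triv v f g gf]) (use Xo in blast)+
    then show "f \<in> Units (end_ring ?C X) \<or> \<one>\<^bsub>end_ring ?C X\<^esub> \<ominus>\<^bsub>end_ring ?C X\<^esub> f \<in> Units (end_ring ?C X)"
      using units f g by (auto simp: g_def)
  qed
qed

section \<open>Maximal vectors and the number of summands\<close>

context lie_module
begin

lemma hom_lincomb:
  assumes "T \<in> linear_maps M M" "A \<subseteq> carrier M"
  shows "T (lincomb a A) = (\<Oplus>v\<in>A. a v \<odot> T v)"
proof -
  interpret T: mod_hom CC M M T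
    using assms(1) module_axioms by (simp add: mod_hom_def mod_hom_axioms_def)
  have "T (lincomb a A) = (\<Oplus>v\<in>A. T (a v \<odot> v))"
    unfolding lincomb_def using assms(2) by (intro T.hom_sum) auto
  also have "\<dots> = (\<Oplus>v\<in>A. a v \<odot> T v)"
    using assms(2) T.f_im by (intro finsum_cong') auto
  finally show ?thesis .
qed

text \<open>Vectors of distinct weights are independent. Subtract \<open>wt w y\<close> times a linear relation from its image
  under \<open>y\<close> in \<open>h\<close>: this eliminates \<open>w\<close> and multiplies the other coefficients by \<open>wt v y - wt w y\<close>, which
  is nonzero for a suitable \<open>y\<close>.\<close>
lemma weight_vectors_lin_indpt:
  assumes hp: "h \<subseteq> p" and A: "finite A" "inj_on wt A"
    and wt: "\<And>v. v \<in> A \<Longrightarrow> wt v \<in> extensional h \<and> v \<in> weight_space h M (wt v) \<and> v \<noteq> \<zero>"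
  shows "lin_indpt A"
proof -
  have Ac: "A \<subseteq> carrier M" using wt by (auto simp: weight_space_def)
  have "\<forall>v\<in>A. a v = 0" if "lincomb a A = \<zero>" for a
    using A Ac wt that
  proof (induction A arbitrary: a rule: finite_induct)
    case (insert w A)
    have Ac: "A \<subseteq> carrier M" and wc: "w \<in> carrier M" using insert.prems by auto
    have lc: "lincomb b A \<in> carrier M" for b using Ac by (intro lincomb_closed) auto
    have rel: "a w \<odot> w \<oplus> lincomb a A = \<zero>"
    proof -
      have "lincomb a (insert w A) = a w \<odot> w \<oplus> lincomb a A"
        unfolding lincomb_def using insert.hyps Ac wc by (intro finsum_insert) auto
      then show ?thesis using insert.prems(4) by simp
    qed
    \<comment> \<open>The relation with \<open>w\<close> eliminated has only zero coefficients by the induction hypothesis.\<close>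
    have shift: "\<forall>v\<in>A. a v * (wt v y - wt w y) = 0" if y: "y \<in> h" for y
    proof -
      have yp: "y \<in> p" using y hp by blast
      have actv: "act M y v = wt v y \<odot> v" if "v \<in> insert w A" for v
        using insert.prems(3)[OF that] y by (simp add: weight_space_def)
      have T: "act M y \<in> linear_maps M M"
        using yp by (auto simp: LinearCombinations.module_hom_def act_closed act_plus_right act_smult_right)
      have S: "(\<lambda>v. (- wt w y) \<odot> v) \<in> linear_maps M M"
        by (auto simp: LinearCombinations.module_hom_def smult_add_right smult_assoc mult.commute)
      let ?L = "lincomb (\<lambda>v. a v * wt v y) A" and ?R = "(- wt w y) \<odot> lincomb a A"
      have "act M y (lincomb a A) = (\<Oplus>v\<in>A. a v \<odot> act M y v)"
        by (rule hom_lincomb[OF T Ac])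
      also have "\<dots> = ?L"
        unfolding lincomb_def using Ac actv by (intro finsum_cong') (auto simp: smult_assoc)
      finally have L: "act M y (lincomb a A) = ?L" .
      have "?R = (\<Oplus>v\<in>A. a v \<odot> ((- wt w y) \<odot> v))"
        using hom_lincomb[OF S Ac] by simp
      also have "\<dots> = lincomb (\<lambda>v. a v * (- wt w y)) A"
        unfolding lincomb_def using Ac by (intro finsum_cong') (auto simp: smult_assoc)
      finally have R: "?R = lincomb (\<lambda>v. a v * (- wt w y)) A" .
      have "?L \<oplus> ?R = (\<Oplus>v\<in>A. (a v * wt v y) \<odot> v \<oplus> (a v * (- wt w y)) \<odot> v)"
        unfolding R unfolding lincomb_def using Ac by (intro finsum_addf[symmetric]) auto
      also have "\<dots> = lincomb (\<lambda>v. a v * (wt v y - wt w y)) A"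
        unfolding lincomb_def using Ac
        by (intro finsum_cong') (auto simp: subset_iff algebra_simps smult_add_left[symmetric])
      finally have LR: "?L \<oplus> ?R = lincomb (\<lambda>v. a v * (wt v y - wt w y)) A" .
      have "act M y (a w \<odot> w \<oplus> lincomb a A) = (a w * wt w y) \<odot> w \<oplus> ?L"
        using act_plus_right[OF yp _ lc] act_smult_right[OF yp wc] actv wc L by (simp add: smult_assoc)
      then have e1: "(a w * wt w y) \<odot> w \<oplus> ?L = \<zero>" using rel act_zero[OF yp] by simp
      have "(- wt w y) \<odot> (a w \<odot> w \<oplus> lincomb a A) = (- (a w * wt w y)) \<odot> w \<oplus> ?R"
        using smult_add_right[OF _ lc, of "a w \<odot> w"] wc by (simp add: smult_assoc mult.commute)
      then have e2: "(- (a w * wt w y)) \<odot> w \<oplus> ?R = \<zero>" using rel smult_zero_right by simp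
      have "((a w * wt w y) \<odot> w \<oplus> (- (a w * wt w y)) \<odot> w) \<oplus> (?L \<oplus> ?R) = \<zero>"
        using sum_swap[of "(a w * wt w y) \<odot> w" "(- (a w * wt w y)) \<odot> w" ?L ?R] e1 e2 wc lc by simp
      moreover have "(a w * wt w y) \<odot> w \<oplus> (- (a w * wt w y)) \<odot> w = \<zero>"
        using smult_add_left[OF wc, of "a w * wt w y" "- (a w * wt w y)"] smult_zero_left[OF wc] by simp
      ultimately have "lincomb (\<lambda>v. a v * (wt v y - wt w y)) A = \<zero>" using LR lc by simp
      then show ?thesis
        using insert.IH[of "\<lambda>v. a v * (wt v y - wt w y)"] insert.prems Ac by (auto simp: inj_on_def)
    qed
    have A0: "a v = 0" if v: "v \<in> A" for v
    proof -
      have "wt v \<noteq> wt w" using insert.prems(1) insert.hyps(2) v by (auto simp: inj_on_def)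
      then obtain y where "y \<in> h" "wt v y \<noteq> wt w y"
        using insert.prems(3) v extensionalityI[of "wt v" h "wt w"] by blast
      then show ?thesis using shift v by force
    qed
    have "lincomb a A = (\<Oplus>v\<in>A. \<zero>)"
      unfolding lincomb_def using Ac A0 smult_zero_left by (intro finsum_cong') auto
    then have z: "a w \<odot> w = \<zero>" using rel wc by simp
    have "a w = 0" using smult_eq_zero[OF wc _ z] insert.prems(3)[of w] by simp
    then show ?case using A0 by simp
  qed simp
  then show ?thesis using A(1) Ac by (intro finite_lin_indpt2) auto
qed

text \<open>Applying the map that fixes \<open>b\<close> and kills the other vectors to a relation isolates the coefficient of
  \<open>b\<close>.\<close>
lemma separated_vectors_lin_indpt:
  assumes B: "finite B" "B \<subseteq> carrier M" "\<zero> \<notin> B"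
    and sep: "\<And>b. b \<in> B \<Longrightarrow> \<exists>T\<in>linear_maps M M. T b = b \<and> (\<forall>b'\<in>B - {b}. T b' = \<zero>)"
  shows "lin_indpt B"
proof (rule finite_lin_indpt2[OF B(1,2)])
  fix a assume a: "lincomb a B = \<zero>"
  show "\<forall>b\<in>B. a b = \<zero>\<^bsub>CC\<^esub>"
  proof
    fix b assume b: "b \<in> B"
    then obtain T where T: "T \<in> linear_maps M M" "T b = b"
      "\<And>b'. b' \<in> B \<Longrightarrow> b' \<noteq> b \<Longrightarrow> T b' = \<zero>" using sep by fast
    have bc: "b \<in> carrier M" using b B by blast
    interpret T: mod_hom CC M M T
      using T(1) module_axioms by (simp add: mod_hom_def mod_hom_axioms_def)
    have "\<zero> = T (lincomb a B)" using a T.f0_is_0 by simp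
    also have "\<dots> = (\<Oplus>v\<in>B. a v \<odot> T v)" by (rule hom_lincomb[OF T(1) B(2)])
    also have "\<dots> = (\<Oplus>v\<in>B. if b = v then a b \<odot> b else \<zero>)"
      using T(2,3) bc smult_zero_right by (intro finsum_cong') auto
    also have "\<dots> = a b \<odot> b"
      using M.add.finprod_singleton[of b B "\<lambda>_. a b \<odot> b"] b B(1) bc by simp
    finally have z: "a b \<odot> b = \<zero>" by simp
    have "a b = 0" using smult_eq_zero[OF bc _ z] b B(3) by metis
    then show "a b = \<zero>\<^bsub>CC\<^esub>" by simp
  qed
qed

end

locale lie_weights =
  fixes G :: "'g lie_alg" and h n p :: "'g set" and \<Delta>
  assumes vs_G: "vectorspace CC G" and h: "linear_subspace h G"
    and base: "root_base G h \<Delta>"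
    and n_def: "n = linear_span G (\<Union>\<alpha>\<in>positive_roots G h \<Delta>. root_space G h \<alpha>)"
    and hp: "h \<subseteq> p" and np: "n \<subseteq> p"
begin

sublocale G: vectorspace CC G by (rule vs_G)

text \<open>The order on weights, restricted to \<open>h\<close>: \<open>\<nu> - \<mu>\<close> is a nonzero combination of simple roots with natural
  coefficients.\<close>
definition above :: "('g \<Rightarrow> complex) \<Rightarrow> ('g \<Rightarrow> complex) \<Rightarrow> bool" where
  "above \<mu> \<nu> \<longleftrightarrow> (\<exists>k :: ('g \<Rightarrow> complex) \<Rightarrow> nat. (\<exists>\<alpha>\<in>\<Delta>. k \<alpha> \<noteq> 0) \<and>
     (\<forall>y\<in>h. \<nu> y = \<mu> y + (\<Sum>\<alpha>\<in>\<Delta>. of_nat (k \<alpha>) * \<alpha> y)))"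

lemma above_irrefl: "\<not> above \<mu> \<mu>"
proof
  assume "above \<mu> \<mu>"
  then obtain k :: "('g \<Rightarrow> complex) \<Rightarrow> nat" and \<alpha> where k: "\<alpha> \<in> \<Delta>" "k \<alpha> \<noteq> 0"
    "\<forall>y\<in>h. (\<Sum>\<alpha>\<in>\<Delta>. of_nat (k \<alpha>) * \<alpha> y) = 0" unfolding above_def by auto
  have indep: "\<And>c :: ('g \<Rightarrow> complex) \<Rightarrow> complex.
      (\<forall>y\<in>h. (\<Sum>\<alpha>\<in>\<Delta>. c \<alpha> * \<alpha> y) = 0) \<Longrightarrow> (\<forall>\<alpha>\<in>\<Delta>. c \<alpha> = 0)"
    using base by (simp add: root_base_def)
  have "of_nat (k \<alpha>) = (0 :: complex)" using indep[of "\<lambda>\<alpha>. of_nat (k \<alpha>)"] k by blast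
  then show False using k(2) by simp
qed

lemma above_trans: "above \<kappa> \<mu> \<Longrightarrow> above \<mu> \<nu> \<Longrightarrow> above \<kappa> \<nu>"
proof -
  assume "above \<kappa> \<mu>" "above \<mu> \<nu>"
  then obtain k l :: "('g \<Rightarrow> complex) \<Rightarrow> nat" where k: "\<exists>\<alpha>\<in>\<Delta>. k \<alpha> \<noteq> 0"
    "\<forall>y\<in>h. \<mu> y = \<kappa> y + (\<Sum>\<alpha>\<in>\<Delta>. of_nat (k \<alpha>) * \<alpha> y)"
    "\<forall>y\<in>h. \<nu> y = \<mu> y + (\<Sum>\<alpha>\<in>\<Delta>. of_nat (l \<alpha>) * \<alpha> y)" unfolding above_def by blast
  have "\<forall>y\<in>h. \<nu> y = \<kappa> y + (\<Sum>\<alpha>\<in>\<Delta>. of_nat (k \<alpha> + l \<alpha>) * \<alpha> y)"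
    using k(2,3) by (simp add: distrib_right sum.distrib)
  moreover have "\<exists>\<alpha>\<in>\<Delta>. k \<alpha> + l \<alpha> \<noteq> 0" using k(1) by auto
  ultimately show ?thesis unfolding above_def by (intro exI[of _ "\<lambda>\<alpha>. k \<alpha> + l \<alpha>"] conjI)
qed

text \<open>Root vectors of positive roots strictly raise weights, by \<open>y x v = [y, x] v + x y v\<close>.\<close>
lemma root_vector_shifts_weight:
  assumes M: "lie_module G p M" and \<mu>: "\<mu> \<in> dual_space G h" and v: "v \<in> weight_space h M \<mu>"
    and \<beta>: "\<beta> \<in> positive_roots G h \<Delta>" and x: "x \<in> root_space G h \<beta>" "x \<in> p"
  defines "\<nu> \<equiv> (\<lambda>y\<in>h. \<mu> y + \<beta> y)"
  shows "\<nu> \<in> dual_space G h" "act M x v \<in> weight_space h M \<nu>" "above \<mu> \<nu>"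
proof -
  interpret lie_module G p M by fact
  note hD = G.subspace_carrierD[OF h]
  have \<beta>d: "\<beta> \<in> dual_space G h" "\<beta> \<noteq> (\<lambda>y\<in>h. 0)" "\<beta> \<in> nat_combinations h \<Delta>"
    using \<beta> by (auto simp: positive_roots_def roots_def)
  show "\<nu> \<in> dual_space G h"
    using \<mu> \<beta>d(1) hD(3,4) by (simp add: dual_space_def \<nu>_def algebra_simps)
  have vc: "v \<in> carrier M" using v by (simp add: weight_space_def)
  have "act M y (act M x v) = \<nu> y \<odot>\<^bsub>M\<^esub> act M x v" if y: "y \<in> h" for y
  proof -
    have yp: "y \<in> p" using y hp by blast
    have c: "act M x v \<in> carrier M" "act M x (act M y v) \<in> carrier M" "act M y (act M x v) \<in> carrier M"
      using vc x yp act_closed by simp_all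
    have "act M y (act M x v) = act M (bracket G y x) v \<oplus>\<^bsub>M\<^esub> act M x (act M y v)"
      using act_bracket[OF yp x(2) vc] c by (simp add: M.minus_eq M.a_assoc M.l_neg)
    also have "bracket G y x = \<beta> y \<odot>\<^bsub>G\<^esub> x" using x(1) y by (simp add: root_space_def)
    also have "act M y v = \<mu> y \<odot>\<^bsub>M\<^esub> v" using v y by (simp add: weight_space_def)
    finally show ?thesis
      using act_smult_left[OF x(2) vc] act_smult_right[OF x(2) vc] c y
      by (simp add: \<nu>_def smult_add_left M.a_comm)
  qed
  then show "act M x v \<in> weight_space h M \<nu>"
    using vc x act_closed by (simp add: weight_space_def)
  obtain k :: "('g \<Rightarrow> complex) \<Rightarrow> nat" where k: "\<beta> = (\<lambda>y\<in>h. \<Sum>\<alpha>\<in>\<Delta>. of_nat (k \<alpha>) * \<alpha> y)"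
    using \<beta>d(3) by (auto simp: nat_combinations_def)
  have "\<exists>\<alpha>\<in>\<Delta>. k \<alpha> \<noteq> 0"
  proof (rule ccontr)
    assume "\<not> ?thesis"
    then have "\<beta> = (\<lambda>y\<in>h. 0)" unfolding k by (intro restrict_ext) simp
    then show False using \<beta>d(2) by simp
  qed
  moreover have "\<forall>y\<in>h. \<nu> y = \<mu> y + (\<Sum>\<alpha>\<in>\<Delta>. of_nat (k \<alpha>) * \<alpha> y)"
    by (simp add: \<nu>_def k)
  ultimately show "above \<mu> \<nu>" unfolding above_def by blast
qed

lemma annihilated_by_root_vectors:
  assumes M: "lie_module G p M" and v: "v \<in> carrier M"
    and z: "\<And>\<beta> x. \<beta> \<in> positive_roots G h \<Delta> \<Longrightarrow> x \<in> root_space G h \<beta> \<Longrightarrow> x \<in> p \<Longrightarrow> act M x v = \<zero>\<^bsub>M\<^esub>"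
  shows "\<forall>x\<in>n. act M x v = \<zero>\<^bsub>M\<^esub>"
proof -
  interpret lie_module G p M by fact
  let ?S = "\<Union>\<alpha>\<in>positive_roots G h \<Delta>. root_space G h \<alpha>"
  have S: "?S \<subseteq> carrier G" by (auto simp: root_space_def)
  have n: "linear_subspace n G" "?S \<subseteq> n"
    unfolding n_def using G.span_is_subspace[OF S] G.module.in_own_span[OF S] by auto
  note nD = G.subspace_carrierD[OF n(1)]
  have np': "x \<in> n \<Longrightarrow> x \<in> p" for x using np by blast
  have z0: "act M \<zero>\<^bsub>G\<^esub> v = \<zero>\<^bsub>M\<^esub>"
    using act_smult_left[OF np'[OF nD(2)] v, of 0] smult_zero_left[OF act_closed[OF np'[OF nD(2)] v]]
      G.smult_l_null[of "\<zero>\<^bsub>G\<^esub>"] by simp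
  have "linear_subspace {x \<in> n. act M x v = \<zero>\<^bsub>M\<^esub>} G"
    by (rule G.subspaceI)
      (use nD z0 np' v in \<open>auto simp: act_plus_left act_smult_left smult_zero_right\<close>)
  moreover have "?S \<subseteq> {x \<in> n. act M x v = \<zero>\<^bsub>M\<^esub>}" using n(2) z np' by blast
  ultimately have "n \<subseteq> {x \<in> n. act M x v = \<zero>\<^bsub>M\<^esub>}"
    using G.span_subset_subspace n_def by blast
  then show ?thesis by blast
qed

text \<open>Start with a nonzero weight vector \<open>v0\<close>. The space \<open>W = U(n) v0\<close> is finite-dimensional, so only finitely
  many weights occur in it, because weight vectors of distinct weights are independent. A vector of
  \<open>W\<close> whose weight is maximal among them is killed by all positive root vectors: they preserve \<open>W\<close> and
  raise weights.\<close>
lemma maximal_vector_exists: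
  assumes M: "M \<in> Obj (cat_Mp G h n p)" and nz: "w \<in> carrier M" "w \<noteq> \<zero>\<^bsub>M\<^esub>"
  shows "\<exists>\<mu>\<in>dual_space G h. \<exists>v\<in>maximal_space h n M \<mu>. v \<noteq> \<zero>\<^bsub>M\<^esub>"
proof -
  note Mo = M[unfolded cat_Mp_Obj]
  then interpret lie_module G p M by blast
  have "\<exists>\<mu>\<in>dual_space G h. \<exists>v\<in>weight_space h M \<mu>. v \<noteq> \<zero>\<^bsub>M\<^esub>"
  proof (rule ccontr)
    assume "\<not> ?thesis"
    then have "(\<Union>\<mu>\<in>dual_space G h. weight_space h M \<mu>) \<subseteq> {\<zero>\<^bsub>M\<^esub>}" by blast
    moreover have "linear_subspace {\<zero>\<^bsub>M\<^esub>} M"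
      by (rule subspaceI) (simp_all add: smult_zero_right)
    ultimately have "carrier M \<subseteq> {\<zero>\<^bsub>M\<^esub>}"
      using span_subset_subspace Mo unfolding weight_semisimple_def by metis
    then show False using nz by blast
  qed
  then obtain \<mu>0 v0 where \<mu>0: "\<mu>0 \<in> dual_space G h" and v0: "v0 \<in> weight_space h M \<mu>0" "v0 \<noteq> \<zero>\<^bsub>M\<^esub>" by blast
  have v0c: "v0 \<in> carrier M" using v0 by (simp add: weight_space_def)
  define W where "W = generated_submodule n M v0"
  note gen = generated_submodule_props[OF np v0c, folded W_def]
  have fd: "finite_dim_on M W" using Mo v0c unfolding locally_finite_def W_def by blast
  define \<Lambda> where "\<Lambda> = {\<mu> \<in> dual_space G h. \<exists>v\<in>weight_space h M \<mu> \<inter> W. v \<noteq> \<zero>\<^bsub>M\<^esub>}"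
  have "\<forall>\<mu>\<in>\<Lambda>. \<exists>v. v \<in> weight_space h M \<mu> \<and> v \<in> W \<and> v \<noteq> \<zero>\<^bsub>M\<^esub>" unfolding \<Lambda>_def by blast
  then obtain u where u: "\<And>\<mu>. \<mu> \<in> \<Lambda> \<Longrightarrow> u \<mu> \<in> weight_space h M \<mu> \<and> u \<mu> \<in> W \<and> u \<mu> \<noteq> \<zero>\<^bsub>M\<^esub>" by metis
  have ext: "\<mu> \<in> extensional h" if "\<mu> \<in> \<Lambda>" for \<mu> using that by (simp add: \<Lambda>_def dual_space_def)
  have u_inj: "\<mu> = \<nu>" if "\<mu> \<in> \<Lambda>" "\<nu> \<in> \<Lambda>" "u \<mu> = u \<nu>" for \<mu> \<nu>
  proof (rule extensionalityI[OF ext ext])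
    fix y assume y: "y \<in> h"
    have eq: "\<mu> y \<odot>\<^bsub>M\<^esub> u \<mu> = \<nu> y \<odot>\<^bsub>M\<^esub> u \<mu>" and c: "u \<mu> \<in> carrier M"
      using u[OF that(1)] u[OF that(2)] that(3) y by (auto simp: weight_space_def)
    show "\<mu> y = \<nu> y" using smult_cancel_right[OF c _ eq] u[OF that(1)] by blast
  qed (use that in auto)
  have "finite \<Lambda>"
  proof (rule conjunct1[OF finite_if_finite_subsets_card_bdd])
    fix F assume F: "F \<subseteq> \<Lambda>" "finite F"
    have inj: "inj_on u F" using u_inj F by (auto simp: inj_on_def)
    have inv: "the_inv_into F u (u \<mu>) = \<mu>" if "\<mu> \<in> F" for \<mu> using the_inv_into_f_f[OF inj that] .
    have "lin_indpt (u ` F)"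
      by (rule weight_vectors_lin_indpt[OF hp, where wt = "the_inv_into F u"])
        (use F u ext inv in \<open>auto simp: inj_on_def\<close>)
    then have "card (u ` F) \<le> vectorspace.dim CC (M\<lparr>carrier := W\<rparr>)"
      using lin_indpt_card_le_dim[OF gen(1) fd] u F by blast
    then show "card F \<le> vectorspace.dim CC (M\<lparr>carrier := W\<rparr>)" using card_image[OF inj] by simp
  qed
  moreover have "\<Lambda> \<noteq> {}" using \<mu>0 v0 gen(2) unfolding \<Lambda>_def by blast
  moreover have "asymp_on \<Lambda> above" by (rule asymp_onI) (use above_irrefl above_trans in blast)
  moreover have "transp_on \<Lambda> above" by (rule transp_onI) (rule above_trans)
  ultimately obtain \<mu> where \<mu>: "\<mu> \<in> \<Lambda>" "\<And>\<nu>. \<nu> \<in> \<Lambda> \<Longrightarrow> \<nu> \<noteq> \<mu> \<Longrightarrow> \<not> above \<mu> \<nu>"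
    using Finite_Set.bex_max_element[of \<Lambda> above] by metis
  have \<mu>d: "\<mu> \<in> dual_space G h" using \<mu>(1) by (simp add: \<Lambda>_def)
  have uc: "u \<mu> \<in> carrier M" using u[OF \<mu>(1)] by (simp add: weight_space_def)
  have zero: "act M x (u \<mu>) = \<zero>\<^bsub>M\<^esub>" if \<beta>: "\<beta> \<in> positive_roots G h \<Delta>" "x \<in> root_space G h \<beta>" "x \<in> p" for \<beta> x
  proof (rule ccontr)
    assume nz: "act M x (u \<mu>) \<noteq> \<zero>\<^bsub>M\<^esub>"
    let ?\<nu> = "\<lambda>y\<in>h. \<mu> y + \<beta> y"
    note sh = root_vector_shifts_weight[OF lie_module_axioms \<mu>d _ \<beta>, of "u \<mu>"]
    have uw: "u \<mu> \<in> weight_space h M \<mu>" "u \<mu> \<in> W" using u[OF \<mu>(1)] by auto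
    have S: "(\<Union>\<alpha>\<in>positive_roots G h \<Delta>. root_space G h \<alpha>) \<subseteq> carrier G" by (auto simp: root_space_def)
    have "x \<in> n" unfolding n_def using G.module.in_own_span[OF S] \<beta> by blast
    then have "act M x (u \<mu>) \<in> W" using gen(3) uw(2) by blast
    then have "?\<nu> \<in> \<Lambda>" using sh(1,2)[OF uw(1)] nz unfolding \<Lambda>_def by blast
    then show False using \<mu>(2) sh(3)[OF uw(1)] above_irrefl by metis
  qed
  have "u \<mu> \<in> maximal_space h n M \<mu>"
    using annihilated_by_root_vectors[OF lie_module_axioms uc zero] u[OF \<mu>(1)]
    by (simp add: maximal_space_def)
  then show ?thesis using \<mu>d u[OF \<mu>(1)] by blast
qed

text \<open>Each nonzero image \<open>e M\<close> is again an object and contains a maximal vector, so that \<open>e\<close> is nonzero on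
  \<open>M\<^sub>\<mu>\<close> for one of the finitely many maximal weights \<open>\<mu>\<close> of \<open>M\<close>. For fixed \<open>\<mu>\<close>, nonzero vectors of the
  spaces \<open>e M\<^sub>\<mu>\<close> with \<open>e\<close> in \<open>E\<close> are separated by the idempotents, hence independent, and there are at most
  \<open>dim M\<^sub>\<mu>\<close> of them.\<close>
lemma orthogonal_idems_bound:
  fixes M :: "('g, 'v) lie_mod"
  assumes M: "M \<in> Obj (cat_Mp G h n p)"
    and E: "finite E" "ring.orthogonal_idems (end_ring (cat_Mp G h n p) M) E (\<lambda>e. e)"
      "Hzero (cat_Mp G h n p) M M \<notin> E"
  shows "card E \<le> (\<Sum>\<mu>\<in>maximal_weights G h n M. vectorspace.dim CC (M\<lparr>carrier := weight_space h M \<mu>\<rparr>))"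
proof -
  interpret C: idempotent_complete_category "cat_Mp G h n p :: (('g, 'v) lie_mod, 'v \<Rightarrow> 'v) preadd_cat"
    by (rule cat_Mp_idempotent_complete[OF hp np])
  note Mo = M[unfolded cat_Mp_Obj]
  then interpret lie_module G p M by blast
  interpret R: ring "end_ring (cat_Mp G h n p) M" using C.end_ring_is_ring[OF M] .
  note D = R.orthogonal_idemsD[OF E(2), unfolded end_ring_simps cat_Mp_simps]
  have eh: "e \<in> lie_module_hom p M M" and ee: "compose (carrier M) e e = e" if "e \<in> E" for e
    using D(1,2)[OF that] .
  define F where "F \<mu> = {e \<in> E. \<exists>v\<in>weight_space h M \<mu>. e v \<noteq> \<zero>\<^bsub>M\<^esub>}" for \<mu>
  have "e \<in> (\<Union>\<mu>\<in>maximal_weights G h n M. F \<mu>)" if e: "e \<in> E" for e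
  proof -
    let ?N = "M\<lparr>carrier := e ` carrier M\<rparr>"
    note N = idem_image_in_Mp[OF hp np M eh[OF e] ee[OF e]]
    have "e \<noteq> (\<lambda>v\<in>carrier M. \<zero>\<^bsub>M\<^esub>)" using E(3) e by auto
    then obtain w where "w \<in> carrier M" "e w \<noteq> \<zero>\<^bsub>M\<^esub>"
      using extensionalityI[OF lie_module_homD(5)[OF eh[OF e]], of "\<lambda>v\<in>carrier M. \<zero>\<^bsub>M\<^esub>"] by auto
    then obtain \<mu> v where \<mu>: "\<mu> \<in> dual_space G h" "v \<in> maximal_space h n ?N \<mu>" "v \<noteq> \<zero>\<^bsub>M\<^esub>"
      using maximal_vector_exists[OF N(1), of "e w"] by auto
    then have vN: "v \<in> e ` carrier M" by (simp add: maximal_space_def weight_space_def)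
    then have vM: "v \<in> maximal_space h n M \<mu>"
      using \<mu>(2) lie_module_homD(1)[OF eh[OF e]] by (auto simp: maximal_space_def weight_space_def)
    have "e v = v" using vN N(4) by auto
    then have "e \<in> F \<mu>" using e vM \<mu>(3) unfolding F_def maximal_space_def by force
    moreover have "\<mu> \<in> maximal_weights G h n M"
      using maximal_weights_iff[OF lie_module_axioms hp np] \<mu> vM by blast
    ultimately show ?thesis by blast
  qed
  then have "card E \<le> card (\<Union>\<mu>\<in>maximal_weights G h n M. F \<mu>)"
    using Mo E(1) by (intro card_mono) (auto simp: F_def)
  also have "\<dots> \<le> (\<Sum>\<mu>\<in>maximal_weights G h n M. card (F \<mu>))"
    using Mo by (intro card_UN_le) blast
  also have "\<dots> \<le> (\<Sum>\<mu>\<in>maximal_weights G h n M. vectorspace.dim CC (M\<lparr>carrier := weight_space h M \<mu>\<rparr>))"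
  proof (rule sum_mono)
    fix \<mu> assume "\<mu> \<in> maximal_weights G h n M"
    then have fd: "finite_dim_on M (weight_space h M \<mu>)" using Mo by (auto simp: maximal_weights_def)
    have "\<forall>e\<in>F \<mu>. \<exists>v. v \<in> weight_space h M \<mu> \<and> e v \<noteq> \<zero>\<^bsub>M\<^esub>" unfolding F_def by blast
    then obtain w where w: "\<And>e. e \<in> F \<mu> \<Longrightarrow> w e \<in> weight_space h M \<mu> \<and> e (w e) \<noteq> \<zero>\<^bsub>M\<^esub>" by metis
    define v where "v e = e (w e)" for e
    have wc: "w e \<in> carrier M" if "e \<in> F \<mu>" for e using w[OF that] by (simp add: weight_space_def)
    have FE: "e \<in> E" if "e \<in> F \<mu>" for e using that by (simp add: F_def)
    have v: "v e \<in> weight_space h M \<mu>" "v e \<noteq> \<zero>\<^bsub>M\<^esub>" if "e \<in> F \<mu>" for e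
      using hom_weight_space[OF eh[OF FE[OF that]] hp] w[OF that] by (auto simp: v_def)
    have vc: "v e \<in> carrier M" if "e \<in> F \<mu>" for e using v(1)[OF that] by (simp add: weight_space_def)
    have ev: "e' (v e) = (if e' = e then v e else \<zero>\<^bsub>M\<^esub>)" if "e \<in> F \<mu>" "e' \<in> F \<mu>" for e e'
      using fun_cong[OF D(2)[OF FE[OF that(1)]], of "w e"] fun_cong[OF D(3)[OF FE[OF that(2)] FE[OF that(1)]], of "w e"]
        wc[OF that(1)] by (auto simp: v_def compose_def)
    have inj: "inj_on v (F \<mu>)"
    proof (rule inj_onI)
      fix e e' assume ee': "e \<in> F \<mu>" "e' \<in> F \<mu>" "v e = v e'"
      show "e = e'"
      proof (rule ccontr)
        assume "e \<noteq> e'"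
        then have "e (v e') = \<zero>\<^bsub>M\<^esub>" using ev[OF ee'(2,1)] by simp
        then show False using ev[OF ee'(1,1)] ee'(3) v(2)[OF ee'(1)] by simp
      qed
    qed
    have "lin_indpt (v ` F \<mu>)"
    proof (rule separated_vectors_lin_indpt)
      show "finite (v ` F \<mu>)" using E(1) by (simp add: F_def)
      show "v ` F \<mu> \<subseteq> carrier M" using vc by blast
      show "\<zero>\<^bsub>M\<^esub> \<notin> v ` F \<mu>" using v(2) by (metis imageE)
      fix b assume "b \<in> v ` F \<mu>"
      then obtain e where e: "e \<in> F \<mu>" "b = v e" by blast
      have "e b = b" using ev[OF e(1) e(1)] e(2) by simp
      moreover have "e b' = \<zero>\<^bsub>M\<^esub>" if b': "b' \<in> v ` F \<mu> - {b}" for b'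
      proof -
        obtain e' where e': "e' \<in> F \<mu>" "b' = v e'" using b' by blast
        moreover from this have "e \<noteq> e'" using b' e by blast
        ultimately show ?thesis using ev[OF e'(1) e(1)] by simp
      qed
      ultimately show "\<exists>T\<in>linear_maps M M. T b = b \<and> (\<forall>b'\<in>v ` F \<mu> - {b}. T b' = \<zero>\<^bsub>M\<^esub>)"
        using lie_module_homD(6)[OF eh[OF FE[OF e(1)]]] by blast
    qed
    then have "card (v ` F \<mu>) \<le> vectorspace.dim CC (M\<lparr>carrier := weight_space h M \<mu>\<rparr>)"
      using lin_indpt_card_le_dim[OF weight_space_subspace[OF hp] fd] v(1) by blast
    then show "card (F \<mu>) \<le> vectorspace.dim CC (M\<lparr>carrier := weight_space h M \<mu>\<rparr>)"
      using card_image[OF inj] by simp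
  qed
  finally show ?thesis .
qed

end

section \<open>The Krull--Schmidt property\<close>

lemma cartan_decomposition_lie_weights:
  assumes G: "lie_algebra G" and cd: "cartan_decomposition G nm h n" and p: "standard_parabolic G h n p"
  shows "\<exists>\<Delta>. lie_weights G h n p \<Delta>"
proof -
  have vs: "vectorspace CC G" using G by (simp add: lie_algebra_def)
  interpret vectorspace CC G by (rule vs)
  obtain \<Delta> where base: "root_base G h \<Delta>"
    and n: "n = linear_span G (\<Union>\<alpha>\<in>positive_roots G h \<Delta>. root_space G h \<alpha>)"
    using cd unfolding cartan_decomposition_def by blast
  have h: "linear_subspace h G"
    using cd by (simp add: cartan_decomposition_def cartan_subalgebra_def lie_subalgebra_def)
  have S: "(\<Union>\<alpha>\<in>positive_roots G h \<Delta>. root_space G h \<alpha>) \<subseteq> carrier G" by (auto simp: root_space_def)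
  have nS: "linear_subspace n G" unfolding n using span_is_subspace[OF S] .
  have "submodule_sum h n \<subseteq> p" using p by (simp add: standard_parabolic_def borel_def)
  then have "h \<subseteq> p" "n \<subseteq> p"
    using in_sum_vs[OF h nS] in_sum_vs[OF nS h] vsum_comm[OF h nS] by auto
  then show ?thesis using vs h base n unfolding lie_weights_def by blast
qed

theorem theorem1:
  fixes G :: "'g lie_alg" and nm h n p :: "'g set" and M :: "('g, 'v) lie_mod"
  assumes "lie_algebra G" and "vectorspace.fin_dim CC G" and "lie_semisimple G"
    and "cartan_decomposition G nm h n" and "standard_parabolic G h n p"
    and "M \<in> Obj (cat_Mp G h n p)"
  shows "(\<exists>Xs. krull_schmidt_decomposition (cat_Mp G h n p) M Xs) \<and>
    krull_schmidt_category (cat_Mp G h n p :: (('g, 'v) lie_mod, 'v \<Rightarrow> 'v) preadd_cat) \<and>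
    (\<forall>Xs Ys.
       cat_direct_sum (cat_Mp G h n p) M Xs \<and> (\<forall>X\<in>set Xs. indecomposable_object (cat_Mp G h n p) X) \<and>
       cat_direct_sum (cat_Mp G h n p) M Ys \<and> (\<forall>Y\<in>set Ys. indecomposable_object (cat_Mp G h n p) Y) \<longrightarrow>
       (\<exists>\<sigma>. bij_betw \<sigma> {..<length Xs} {..<length Ys} \<and>
          (\<forall>i<length Xs. isomorphic_objects (cat_Mp G h n p) (Xs ! i) (Ys ! \<sigma> i))))"
proof -
  let ?C = "cat_Mp G h n p :: (('g, 'v) lie_mod, 'v \<Rightarrow> 'v) preadd_cat"
  obtain \<Delta> where "lie_weights G h n p \<Delta>"
    using cartan_decomposition_lie_weights assms by blast
  then interpret lie_weights G h n p \<Delta> .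
  interpret C: idempotent_complete_category ?C by (rule cat_Mp_idempotent_complete[OF hp np])
  have loc: "local_ring (end_ring ?C X)" if "indecomposable_object ?C X" for X
    using cat_Mp_local_end_ring[OF hp np that] .
  have dec: "\<exists>Xs. krull_schmidt_decomposition ?C N Xs" if N: "N \<in> Obj ?C" for N
    using C.decomposition_into_indecomposables[OF N orthogonal_idems_bound[OF N]] loc
    unfolding krull_schmidt_decomposition_def by blast
  have "krull_schmidt_category ?C"
    using dec cat_Mp_additive[OF hp np assms(6)] by (simp add: krull_schmidt_category_def)
  moreover have "\<exists>\<sigma>. bij_betw \<sigma> {..<length Xs} {..<length Ys} \<and>
      (\<forall>i<length Xs. isomorphic_objects ?C (Xs ! i) (Ys ! \<sigma> i))"
    if "cat_direct_sum ?C M Xs" "\<forall>X\<in>set Xs. indecomposable_object ?C X"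
      "cat_direct_sum ?C M Ys" "\<forall>Y\<in>set Ys. indecomposable_object ?C Y" for Xs Ys
    using C.decomposition_unique[of M Xs Ys] that loc by blast
  ultimately show ?thesis using dec[OF assms(6)] by blast
qed

end
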